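(* Consider any instance of the weighted Nash social welfare problem (as defined in the context) and the convex program \[ \max \sum_{i\in N} w_i f_i(x_i)\quad\text{s.t.}\quad \sum_{j\in M_i}x_{ij}\ge 1\ \forall i\in N,\qquad \sum_{i\in N_j}x_{ij}=1\ \forall j\in M,\qquad x_{ij}\ge 0\ \forall ij\in E, \] where $x_i=(x_{ij})_{j\in M_i}$ and $f_i$ is defined in the context. Then: (i) the integrality gap of this program is at most $e^{1/e}$, i.e. $\max_{\rho}\prod_{i\in N}v_i(\rho^{-1}(i))^{w_i}\ \ge\ e^{-1/e}\exp(\mathrm{OPT})$, where the maximum is over allocations $\rho$ and $\mathrm{OPT}$ is the optimal value of the program; (ii) there is an efficient (polynomial-time) rounding algorithm that, given a feasible solution $x$ of the program, outputs an allocation $\rho$ with $\prod_{i\in N}v_i(\rho^{-1}(i))^{w_i}\ \ge\ e^{-1/e}\exp\big(\sum_{i\in N}w_if_i(x_i)\big)$.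
   Context: Weighted Nash social welfare (NSW) instance: a set $N$ of $n$ agents with weights $w_i\in(0,1]$, $\sum_{i\in N}w_i=1$; a set $M$ of $m$ items; a set of edges $E\subseteq N\times M$ with a value $v_{ij}>0$ for every $ij\in E$; every agent and every item is incident to at least one edge. Let $M_i=\{j\in M: ij\in E\}$ and $N_j=\{i\in N: ij\in E\}$. An allocation is a map $\rho:M\to N$ with $\rho(j)j\in E$ for all $j$; its weighted NSW value is $\prod_{i\in N}v_i(\rho^{-1}(i))^{w_i}$ where $v_i(S)=\sum_{j\in S}v_{ij}$. For $x_i\in[0,1]^{M_i}$ with $\|x_i\|_1\ge1$, let $h_i(x_i)$ be any real $h>0$ satisfying $\sum_{j\in M_i}\min\{v_{ij},h\}x_{ij}=h$ (unique if $\|x_i\|_1>1$; if $\|x_i\|_1=1$ any $h\in(0,\min\{v_{ij}:x_{ij}>0\}]$ works). Define \[ f_i(x_i)=\sum_{j\in M_i:\,v_{ij}>h_i(x_i)}x_{ij}\ln\frac{v_{ij}}{h_i(x_i)}+\ln h_i(x_i), \] which does not depend on the choice of $h_i(x_i)$. *)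

theory Defs
  imports "HOL-Analysis.Analysis" "HOL-Computational_Algebra.Polynomial"
begin

section \<open>Weighted Nash social welfare\<close>

definition items_of :: "('a \<times> 'b) set \<Rightarrow> 'a \<Rightarrow> 'b set" where
  "items_of E i = {j. (i, j) \<in> E}"

definition agents_of :: "('a \<times> 'b) set \<Rightarrow> 'b \<Rightarrow> 'a set" where
  "agents_of E j = {i. (i, j) \<in> E}"

definition nsw_instance ::
  "'a set \<Rightarrow> 'b set \<Rightarrow> ('a \<times> 'b) set \<Rightarrow> ('a \<Rightarrow> real) \<Rightarrow> ('a \<Rightarrow> 'b \<Rightarrow> real) \<Rightarrow> bool" where
  "nsw_instance N M E w v \<longleftrightarrow>
     finite N \<and> finite M \<and> E \<subseteq> N \<times> M \<and>
     (\<forall>i\<in>N. 0 < w i \<and> w i \<le> 1) \<and> (\<Sum>i\<in>N. w i) = 1 \<and>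
     (\<forall>(i, j)\<in>E. v i j > 0) \<and>
     (\<forall>i\<in>N. items_of E i \<noteq> {}) \<and> (\<forall>j\<in>M. agents_of E j \<noteq> {})"

text \<open>An allocation is a function on \<open>M\<close>, represented extensionally
  (\<open>undefined\<close> outside \<open>M\<close>), so that there are only finitely many.\<close>

definition allocations :: "'b set \<Rightarrow> ('a \<times> 'b) set \<Rightarrow> ('b \<Rightarrow> 'a) set" where
  "allocations M E = (\<Pi>\<^sub>E j\<in>M. agents_of E j)"

definition nsw :: "'a set \<Rightarrow> 'b set \<Rightarrow> ('a \<Rightarrow> real) \<Rightarrow> ('a \<Rightarrow> 'b \<Rightarrow> real) \<Rightarrow> ('b \<Rightarrow> 'a) \<Rightarrow> real" where
  "nsw N M w v \<rho> = (\<Prod>i\<in>N. (\<Sum>j\<in>{j\<in>M. \<rho> j = i}. v i j) powr w i)"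

definition max_nsw ::
  "'a set \<Rightarrow> 'b set \<Rightarrow> ('a \<times> 'b) set \<Rightarrow> ('a \<Rightarrow> real) \<Rightarrow> ('a \<Rightarrow> 'b \<Rightarrow> real) \<Rightarrow> real" where
  "max_nsw N M E w v = Max (nsw N M w v ` allocations M E)"


section \<open>The convex program\<close>

definition is_level ::
  "('a \<times> 'b) set \<Rightarrow> ('a \<Rightarrow> 'b \<Rightarrow> real) \<Rightarrow> ('a \<Rightarrow> 'b \<Rightarrow> real) \<Rightarrow> 'a \<Rightarrow> real \<Rightarrow> bool" where
  "is_level E v x i h \<longleftrightarrow> h > 0 \<and> (\<Sum>j\<in>items_of E i. min (v i j) h * x i j) = h"

text \<open>A level exists whenever the entries of \<open>x i\<close> on \<open>items_of E i\<close> are nonnegative with sum at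
  least 1, and \<open>agent_obj\<close> does not depend on which level is chosen.\<close>

definition level ::
  "('a \<times> 'b) set \<Rightarrow> ('a \<Rightarrow> 'b \<Rightarrow> real) \<Rightarrow> ('a \<Rightarrow> 'b \<Rightarrow> real) \<Rightarrow> 'a \<Rightarrow> real" where
  "level E v x i = (SOME h. is_level E v x i h)"

definition agent_obj ::
  "('a \<times> 'b) set \<Rightarrow> ('a \<Rightarrow> 'b \<Rightarrow> real) \<Rightarrow> ('a \<Rightarrow> 'b \<Rightarrow> real) \<Rightarrow> 'a \<Rightarrow> real" where
  "agent_obj E v x i =
     (\<Sum>j\<in>{j\<in>items_of E i. v i j > level E v x i}. x i j * ln (v i j / level E v x i))
     + ln (level E v x i)"

definition cp_obj ::
  "'a set \<Rightarrow> ('a \<times> 'b) set \<Rightarrow> ('a \<Rightarrow> real) \<Rightarrow> ('a \<Rightarrow> 'b \<Rightarrow> real) \<Rightarrow> ('a \<Rightarrow> 'b \<Rightarrow> real) \<Rightarrow> real" where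
  "cp_obj N E w v x = (\<Sum>i\<in>N. w i * agent_obj E v x i)"

definition cp_feasible ::
  "'a set \<Rightarrow> 'b set \<Rightarrow> ('a \<times> 'b) set \<Rightarrow> ('a \<Rightarrow> 'b \<Rightarrow> real) \<Rightarrow> bool" where
  "cp_feasible N M E x \<longleftrightarrow>
     (\<forall>i\<in>N. (\<Sum>j\<in>items_of E i. x i j) \<ge> 1) \<and>
     (\<forall>j\<in>M. (\<Sum>i\<in>agents_of E j. x i j) = 1) \<and>
     (\<forall>(i, j)\<in>E. x i j \<ge> 0)"

text \<open>The optimal value is taken in the extended reals; it is \<open>-\<infinity>\<close> if the program is infeasible
  (for example, if there are fewer items than agents).\<close>

definition cp_opt ::
  "'a set \<Rightarrow> 'b set \<Rightarrow> ('a \<times> 'b) set \<Rightarrow> ('a \<Rightarrow> real) \<Rightarrow> ('a \<Rightarrow> 'b \<Rightarrow> real) \<Rightarrow> ereal" where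
  "cp_opt N M E w v = (SUP x\<in>{x. cp_feasible N M E x}. ereal (cp_obj N E w v x))"

definition exp_ereal :: "ereal \<Rightarrow> ereal" where
  "exp_ereal z = (case z of ereal r \<Rightarrow> ereal (exp r) | PInfty \<Rightarrow> \<infinity> | MInfty \<Rightarrow> 0)"


section \<open>Algorithms on real data\<close>

text \<open>Instances have real data, so the model of computation is the real RAM of Preparata and Shamos,
  which has unit-cost exact real arithmetic, comparisons, and the logarithm as a primitive. It is
  presented here as a structured imperative language. The memory consists of integer cells and real
  cells, each organised in numbered two-dimensional arrays; a program mentions only finitely many
  array numbers, and a scalar variable is the entry \<open>(0, 0)\<close> of an array.

  Integer expressions have no multiplication, so the integers occurring in a run of \<open>t\<close> steps have
  \<open>O(t)\<close> more bits than those in the input. There is no conversion from reals to integers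
  (in particular no floor): reals influence the control flow only through comparisons.\<close>

type_synonym memory = "(nat \<Rightarrow> nat \<Rightarrow> nat \<Rightarrow> nat) \<times> (nat \<Rightarrow> nat \<Rightarrow> nat \<Rightarrow> real)"

datatype iexp = INum nat | IGet nat iexp iexp | IAdd iexp iexp | ISub iexp iexp

datatype rexp = RNum nat | RGet nat iexp iexp
  | RAdd rexp rexp | RSub rexp rexp | RMul rexp rexp | RDiv rexp rexp | RLn rexp

datatype bexp = ILess iexp iexp | RLess rexp rexp | BNot bexp | BAnd bexp bexp

datatype com = Skip | ISet nat iexp iexp iexp | RSet nat iexp iexp rexp
  | Seq com com | Cond bexp com com | While bexp com

fun ieval :: "iexp \<Rightarrow> memory \<Rightarrow> nat" where
  "ieval (INum c) s = c"
| "ieval (IGet a e f) s = fst s a (ieval e s) (ieval f s)"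
| "ieval (IAdd e f) s = ieval e s + ieval f s"
| "ieval (ISub e f) s = ieval e s - ieval f s"

text \<open>Exceptional cases follow HOL: division by 0 gives 0, \<open>ln 0 = 0\<close> and \<open>ln (- r) = ln r\<close>.\<close>

fun reval :: "rexp \<Rightarrow> memory \<Rightarrow> real" where
  "reval (RNum c) s = real c"
| "reval (RGet a e f) s = snd s a (ieval e s) (ieval f s)"
| "reval (RAdd p q) s = reval p s + reval q s"
| "reval (RSub p q) s = reval p s - reval q s"
| "reval (RMul p q) s = reval p s * reval q s"
| "reval (RDiv p q) s = reval p s / reval q s"
| "reval (RLn p) s = ln (reval p s)"

fun beval :: "bexp \<Rightarrow> memory \<Rightarrow> bool" where
  "beval (ILess e f) s \<longleftrightarrow> ieval e s < ieval f s"
| "beval (RLess p q) s \<longleftrightarrow> reval p s < reval q s"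
| "beval (BNot b) s \<longleftrightarrow> \<not> beval b s"
| "beval (BAnd b c) s \<longleftrightarrow> beval b s \<and> beval c s"

definition upd3 :: "(nat \<Rightarrow> nat \<Rightarrow> nat \<Rightarrow> 'c) \<Rightarrow> nat \<Rightarrow> nat \<Rightarrow> nat \<Rightarrow> 'c \<Rightarrow> nat \<Rightarrow> nat \<Rightarrow> nat \<Rightarrow> 'c" where
  "upd3 A a i j c = A(a := (A a)(i := (A a i)(j := c)))"

text \<open>\<open>runs c s t s'\<close>: started in \<open>s\<close>, program \<open>c\<close> halts in \<open>s'\<close> after \<open>t\<close> steps. Every assignment and
  every test is one step; the size of the expressions in a fixed program is a constant.\<close>

inductive runs :: "com \<Rightarrow> memory \<Rightarrow> nat \<Rightarrow> memory \<Rightarrow> bool" where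
  Skip: "runs Skip s 1 s"
| ISet: "runs (ISet a e f g) s 1 (upd3 (fst s) a (ieval e s) (ieval f s) (ieval g s), snd s)"
| RSet: "runs (RSet a e f p) s 1 (fst s, upd3 (snd s) a (ieval e s) (ieval f s) (reval p s))"
| Seq: "runs c1 s t1 s' \<Longrightarrow> runs c2 s' t2 s'' \<Longrightarrow> runs (Seq c1 c2) s (t1 + t2) s''"
| CondTrue: "beval b s \<Longrightarrow> runs c1 s t s' \<Longrightarrow> runs (Cond b c1 c2) s (Suc t) s'"
| CondFalse: "\<not> beval b s \<Longrightarrow> runs c2 s t s' \<Longrightarrow> runs (Cond b c1 c2) s (Suc t) s'"
| WhileFalse: "\<not> beval b s \<Longrightarrow> runs (While b c) s 1 s"
| WhileTrue: "beval b s \<Longrightarrow> runs c s t1 s' \<Longrightarrow> runs (While b c) s' t2 s'' \<Longrightarrow>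
    runs (While b c) s (Suc (t1 + t2)) s''"

text \<open>Input for agents \<open>{..<n}\<close> and items \<open>{..<m}\<close>: integer arrays 0, 1, 2 hold \<open>n\<close>, \<open>m\<close> and the
  adjacency matrix of \<open>E\<close>; real arrays 0, 1, 2 hold the weights, the values and the fractional
  solution. All other cells are 0. The output is read off integer array 3.\<close>

definition input_memory ::
  "nat \<Rightarrow> nat \<Rightarrow> (nat \<times> nat) set \<Rightarrow> (nat \<Rightarrow> real) \<Rightarrow> (nat \<Rightarrow> nat \<Rightarrow> real) \<Rightarrow> (nat \<Rightarrow> nat \<Rightarrow> real) \<Rightarrow> memory"
where
  "input_memory n m E w v x =
     ((\<lambda>a i j. if a = 0 \<and> i = 0 \<and> j = 0 then n
        else if a = 1 \<and> i = 0 \<and> j = 0 then m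
        else if a = 2 \<and> (i, j) \<in> E then 1
        else 0),
      (\<lambda>a i j. if a = 0 \<and> i < n \<and> j = 0 then w i
        else if a = 1 \<and> (i, j) \<in> E then v i j
        else if a = 2 \<and> (i, j) \<in> E then x i j
        else 0))"

definition output_allocation :: "nat \<Rightarrow> memory \<Rightarrow> nat \<Rightarrow> nat" where
  "output_allocation m s = restrict (\<lambda>j. fst s 3 j 0) {..<m}"

text \<open>The program and the polynomial are fixed before the instance. The input consists of \<open>O(n m)\<close>
  numbers, so a bound polynomial in \<open>n + m\<close> is polynomial in the input size.\<close>

definition polytime_rounding :: "real \<Rightarrow> com \<Rightarrow> bool" where
  "polytime_rounding \<alpha> c \<longleftrightarrow> (\<exists>p :: nat poly. \<forall>n m E w v x.
     nsw_instance {..<n} {..<m} E w v \<longrightarrow> cp_feasible {..<n} {..<m} E x \<longrightarrow>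
     (\<exists>t s. runs c (input_memory n m E w v x) t s \<and> t \<le> poly p (n + m) \<and>
        output_allocation m s \<in> allocations {..<m} E \<and>
        nsw {..<n} {..<m} w v (output_allocation m s) \<ge> \<alpha> * exp (cp_obj {..<n} E w v x)))"

end

theory Submission
  imports Defs
begin

text \<open>Sort the items of agent \<open>i\<close> by decreasing value and cut the sequence of their shares \<open>x i j\<close> into
  buckets of mass 1 (the last one may be partial). An integral assignment of items to buckets that
  fills every full bucket gives the agent an item \<open>j\<close> of the first bucket and a total value \<open>X\<close> from
  the later ones. Let \<open>u\<close> be the largest value in the second bucket and \<open>R\<close> the sum of the largest
  values in the buckets after it. Then \<open>R \<le> X \<le> R + u\<close>, because the buckets are sorted. Hence
  \<open>ln (v i j + X)\<close> has two lower bounds that are linear in the assignment: \<open>ln (v i j + R)\<close>, and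
  \<open>ln (v i j + R + u) + c (X - R) / u - c\<close>, where \<open>c = ln ((2 u + R) / (u + R))\<close> bounds the increase of
  \<open>ln (v i j + X)\<close> as \<open>X\<close> runs from \<open>R\<close> to \<open>R + u\<close>. At the fractional assignment the better of
  the two is at least \<open>f\<^sub>i - 1 / e\<close>, essentially because \<open>t ln t \<ge> - 1 / e\<close>.

  The weighted sum of the chosen bounds is a linear function of a fractional bipartite matching. A
  slack column makes all row and column sums integral, so fractional entries can be eliminated by
  pushing along cycles in a direction in which this function does not decrease. Each push makes an
  entry integral, so polynomially many suffice.\<close>

section \<open>The inequality for one agent\<close>

text \<open>The obstacle is that the logarithm of an agent's total is not linear in the assignment,
  while pushing along cycles controls only linear functions. A chord of \<open>ln\<close> over the
  range of \<open>X\<close> is linear in \<open>X\<close>, but its slope depends on the item drawn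
  from the first bucket, so that the bound would contain products of two entries. One slope
  \<open>c / u\<close> for all items removes these products. Items of the first bucket have value at
  least \<open>u\<close>, and the increase of \<open>ln\<close> is largest for value exactly
  \<open>u\<close>; this is the origin of \<open>c\<close>. The first bound credits the later
  buckets with \<open>R\<close> only; the second follows \<open>X\<close> up to \<open>R + u\<close>
  at the fixed price \<open>c\<close>. Both are valid for every integral assignment, so each agent
  may choose between them by comparing them at the fractional one. For the loss, normalise the level
  to 1 and spread every smaller value of the first bucket over the two values \<open>u\<close> and
  1. Only the mass \<open>r\<close> that lands on \<open>u\<close> can lose, and the loss is that of
  \<open>r ln r\<close> or of a version of it with two groups.\<close>

lemma mult_ln_ge:
  fixes t :: real assumes "t > 0"
  shows "t * ln t \<ge> - 1 / exp 1"
proof -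
  \<comment> \<open>The tangent inequality at the point that makes it tight for
    \<open>t = 1 / exp 1\<close>; the constant in the approximation ratio originates here.\<close>
  have "ln (1 / (exp 1 * t)) \<le> 1 / (exp 1 * t) - 1"
    using assms by (intro ln_le_minus_one) simp
  then have "- ln t \<le> 1 / (exp 1 * t)"
    using assms by (simp add: ln_div ln_mult)
  then have "t * (- ln t) \<le> t * (1 / (exp 1 * t))"
    using assms by (intro mult_left_mono) auto
  then show ?thesis using assms by simp
qed

lemma ln_2_ge_inverse_e: "ln 2 \<ge> 1 / exp (1::real)"
proof -
  have "exp (1::real) \<ge> 2" using exp_ge_add_one_self[of 1] by simp
  then have "1 / exp (1::real) \<le> 1 / 2" by (intro divide_left_mono) auto
  also have "\<dots> \<le> ln (2::real)"
    using ln_le_minus_one[of "1/2::real"] by (simp add: ln_div)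
  finally show ?thesis .
qed

lemma ln_ge_chord:
  fixes a b l :: real
  assumes "a > 0" "b > 0" "0 \<le> l" "l \<le> 1"
  shows "ln ((1 - l) * a + l * b) \<ge> (1 - l) * ln a + l * ln b"
  using concave_onD[OF ln_concave, of l a b] assms by simp

text \<open>Both arguments of \<open>ln\<close> are affine in \<open>u\<close>, so the left side is
  concave in \<open>u\<close> and only the extreme values \<open>u = 0\<close> and
  \<open>u = t = r / (1 + z)\<close> matter; \<open>l\<close> locates \<open>u\<close> between them.
  At 0 the left side is \<open>r ln r\<close>. At \<open>t\<close> the arguments are
  \<open>2 t\<close> and \<open>t\<close>, which gives \<open>(1 + z) t ln t + z ln 2\<close>, and
  \<open>z ln 2\<close> pays for the surplus \<open>z / e\<close>.\<close>

lemma two_group_bound: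
  fixes r u z :: real
  assumes "0 < r" "r \<le> 1" "0 \<le> z" "z \<le> r" "0 \<le> u" "u \<le> r - u * z"
  shows "z * ln (r + u * (1 - z)) + (r - z) * ln (r - u * z) \<ge> - 1 / exp 1"
proof -
  define l where "l = u * (1 + z) / r"
  have l: "0 \<le> l" "l \<le> 1" using assms by (auto simp: l_def field_simps)
  define t where "t = r / (1 + z)"
  have t: "t > 0" "r = t * (1 + z)" using assms by (auto simp: t_def)
  have "u = l * t" using assms by (simp add: l_def t_def)
  have b: "r + u * (1 - z) = (1 - l) * r + l * (2 * t)"
    and a: "r - u * z = (1 - l) * r + l * t"
    unfolding \<open>u = l * t\<close> t(2) by (simp_all add: algebra_simps)
  have "(1 - l) * (- 1 / exp 1) + l * (- 1 / exp 1)
      \<le> (1 - l) * (r * ln r) + l * (r * ln t + z * ln 2)"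
  proof (intro add_mono mult_left_mono)
    show "- 1 / exp 1 \<le> r * ln r" using mult_ln_ge assms by simp
    have "(1 + z) * (- 1 / exp 1) \<le> (1 + z) * (t * ln t)"
      using mult_ln_ge[OF t(1)] assms by (intro mult_left_mono) auto
    moreover have "z * (1 / exp 1) \<le> z * ln 2"
      using ln_2_ge_inverse_e assms by (intro mult_left_mono) auto
    ultimately show "- 1 / exp 1 \<le> r * ln t + z * ln 2"
      unfolding t(2) by (simp add: algebra_simps add_divide_distrib)
  qed (use l in auto)
  also have "\<dots> = z * ((1 - l) * ln r + l * ln (2 * t)) + (r - z) * ((1 - l) * ln r + l * ln t)"
    using t by (simp add: ln_mult algebra_simps)
  also have "\<dots> \<le> z * ln (r + u * (1 - z)) + (r - z) * ln (r - u * z)"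
    unfolding a b using assms l t by (intro add_mono mult_left_mono ln_ge_chord) auto
  finally show ?thesis by (simp add: left_diff_distrib diff_divide_distrib)
qed

text \<open>With \<open>a\<close> written as a mixture of \<open>u\<close> and 1, concavity gives
  one term for each end, and the term at 1 is dropped since \<open>ln (1 + s)\<close> is
  nonnegative. An item of value \<open>a\<close> thus counts as a fraction
  \<open>(1 - a) / (1 - u)\<close> of an item of value \<open>u\<close>.\<close>

lemma ln_chord_interval:
  fixes a u s :: real
  assumes "u \<le> a" "a \<le> 1" "u < 1" "u + s > 0" "0 \<le> s"
  shows "ln (a + s) \<ge> (1 - a) / (1 - u) * ln (u + s)"
proof -
  define l where "l = (a - u) / (1 - u)"
  have l: "0 \<le> l" "l \<le> 1" "1 - l = (1 - a) / (1 - u)" using assms by (auto simp: l_def field_simps)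
  have "l * (1 - u) = a - u" using assms by (simp add: l_def)
  then have a: "a + s = (1 - l) * (u + s) + l * (1 + s)" by (simp add: algebra_simps)
  have "(1 - l) * ln (u + s) \<le> (1 - l) * ln (u + s) + l * ln (1 + s)"
    using l assms by simp
  also have "\<dots> \<le> ln (a + s)" unfolding a using l assms by (intro ln_ge_chord) auto
  finally show ?thesis using l by simp
qed

text \<open>One agent, with the level normalised to \<open>1\<close>: \<open>y\<close> is the first bucket, \<open>a\<close> the values, \<open>\<beta>\<close> the
  total value of the later buckets, \<open>u\<close> the largest value in the second bucket, and \<open>\<rho>\<close> the sum of
  the largest values in the buckets after it.\<close>

lemma surrogate_bound_normalised:
  fixes y a :: "'b \<Rightarrow> real" and \<rho> u \<beta> :: real
  assumes fin: "finite J"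
    and y: "\<And>j. j \<in> J \<Longrightarrow> y j \<ge> 0" "(\<Sum>j\<in>J. y j) = 1"
    and a: "\<And>j. j \<in> J \<Longrightarrow> y j > 0 \<Longrightarrow> a j > 0" "\<And>j. j \<in> J \<Longrightarrow> y j > 0 \<Longrightarrow> a j \<ge> u"
    and \<beta>: "(\<Sum>j\<in>{j\<in>J. a j \<le> 1}. y j * a j) + \<beta> = (\<Sum>j\<in>{j\<in>J. a j \<le> 1}. y j)"
    and u: "0 \<le> \<rho>" "0 \<le> u" "\<beta> \<le> \<rho> + u" "u = 0 \<Longrightarrow> \<beta> = 0 \<and> \<rho> = 0" "u > 0 \<Longrightarrow> \<beta> > 0"
  defines "c \<equiv> ln ((2 * u + \<rho>) / (u + \<rho>))"
  shows "max (\<Sum>j\<in>J. y j * ln (a j + \<rho>))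
             ((\<Sum>j\<in>J. y j * ln (a j + \<rho> + u)) + c / u * (\<beta> - \<rho>) - c)
      \<ge> (\<Sum>j\<in>{j\<in>J. a j > 1}. y j * ln (a j)) - 1 / exp 1"
proof -
  define L S where "L = {j\<in>J. a j > 1}" and "S = {j\<in>J. a j \<le> 1}"
  have finLS: "finite L" "finite S" using fin by (auto simp: L_def S_def)
  have split: "(\<Sum>j\<in>J. g j) = (\<Sum>j\<in>L. g j) + (\<Sum>j\<in>S. g j)" for g :: "'b \<Rightarrow> real"
  proof -
    have "J = L \<union> S" "L \<inter> S = {}" by (auto simp: L_def S_def)
    then show ?thesis using sum.union_disjoint[OF finLS, of g] by simp
  qed
  \<comment> \<open>The mass left at value \<open>u\<close> once every small value is written as a
    mixture of \<open>u\<close> and 1. The level equation becomes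
    \<open>r * (1 - u) = \<beta>\<close>.\<close>
  define r where "r = (\<Sum>j\<in>S. y j * ((1 - a j) / (1 - u)))"
  have large: "(\<Sum>j\<in>L. y j * ln (a j + s)) \<ge> (\<Sum>j\<in>L. y j * ln (a j))" if "s \<ge> 0" for s
    using that by (intro sum_mono mult_left_mono) (auto simp: L_def y)
  have \<beta>': "\<beta> = (\<Sum>j\<in>S. y j * (1 - a j))"
    using \<beta> by (simp add: S_def algebra_simps sum_subtractf)
  \<comment> \<open>If \<open>u >= 1\<close>, every small item with positive share has value exactly
    1, so \<open>\<beta>\<close> is not positive although \<open>u > 0\<close>.\<close>
  have u1: "u < 1"
  proof (rule ccontr)
    assume "\<not> u < 1"
    then have "y j * (1 - a j) \<le> 0" if "j \<in> S" for j
      using that a(2)[of j] y(1)[of j]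
      by (cases "y j = 0") (force simp: S_def mult_le_0_iff)+
    then have "\<beta> \<le> 0" unfolding \<beta>' by (intro sum_nonpos)
    with u(4,5) \<open>\<not> u < 1\<close> show False by auto
  qed
  have r\<beta>: "r * (1 - u) = \<beta>"
    using u1 by (simp add: r_def \<beta>' sum_distrib_right)
  have S_le: "(\<Sum>j\<in>S. y j) \<le> 1"
    using y(2) split[of y] sum_nonneg[of L y] y(1) by (auto simp: L_def)
  have r01: "0 \<le> r" "r \<le> 1"
  proof -
    show "0 \<le> r" unfolding r_def using u1 y by (intro sum_nonneg) (auto simp: S_def)
    have "r \<le> (\<Sum>j\<in>S. y j)" unfolding r_def
    proof (rule sum_mono)
      fix j assume j: "j \<in> S"
      show "y j * ((1 - a j) / (1 - u)) \<le> y j"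
      proof (cases "y j = 0")
        case False
        then have "y j > 0" using y(1)[of j] j by (simp add: S_def)
        with a(2)[of j] j have "(1 - a j) / (1 - u) \<le> 1" using u1 by (simp add: S_def)
        then show ?thesis using mult_left_mono[of "(1 - a j) / (1 - u)" 1 "y j"] \<open>y j > 0\<close> by simp
      qed auto
    qed
    with S_le show "r \<le> 1" by simp
  qed
  have small: "(\<Sum>j\<in>S. y j * ln (a j + s)) \<ge> r * ln (u + s)" if s: "s \<ge> 0" "u + s > 0" for s
    unfolding r_def sum_distrib_right
  proof (rule sum_mono)
    fix j assume j: "j \<in> S"
    show "y j * ((1 - a j) / (1 - u)) * ln (u + s) \<le> y j * ln (a j + s)"
    proof (cases "y j = 0")
      case False
      then have "y j > 0" using y(1)[of j] j by (simp add: S_def)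
      with a(2)[of j] j have "(1 - a j) / (1 - u) * ln (u + s) \<le> ln (a j + s)"
        using u1 s by (intro ln_chord_interval) (auto simp: S_def)
      then show ?thesis
        using mult_left_mono[of _ _ "y j"] \<open>y j > 0\<close> by (simp only: mult.assoc less_imp_le)
    qed auto
  qed
  \<comment> \<open>\<open>r = 0\<close> means that the later buckets are worthless. If
    \<open>u + \<rho>\<close> reaches \<open>r\<close>, monotonicity reduces the first bound to
    \<open>r ln r\<close>; otherwise the second bound is used.\<close>
  consider (zero) "r = 0" | (one) "r > 0" "u + \<rho> \<ge> r" | (two) "r > 0" "u + \<rho> < r"
    using r01 by linarith
  then show ?thesis
  proof cases
    case zero
    with r\<beta> u(2,4,5) have "u = 0" "\<rho> = 0" by (auto simp: order_less_le)
    have "(\<Sum>j\<in>S. y j * ln (a j)) = 0"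
    proof (rule sum.neutral, rule ballI)
      fix j assume j: "j \<in> S"
      have nn: "y i * (1 - a i) \<ge> 0" if "i \<in> S" for i using that y by (auto simp: S_def)
      have "(\<Sum>j\<in>S. y j * (1 - a j)) = 0" using \<beta>' r\<beta> zero by simp
      then have "y j * (1 - a j) = 0"
        using sum_nonneg_eq_0_iff[OF finLS(2), of "\<lambda>j. y j * (1 - a j)"] nn j by blast
      then show "y j * ln (a j) = 0" by auto
    qed
    then have "(\<Sum>j\<in>J. y j * ln (a j + \<rho>)) \<ge> (\<Sum>j\<in>L. y j * ln (a j)) - 1 / exp 1"
      using split[of "\<lambda>j. y j * ln (a j)"] \<open>\<rho> = 0\<close> by simp
    then show ?thesis by (simp add: L_def)
  next
    case one
    have "- 1 / exp 1 \<le> r * ln r" using mult_ln_ge one by simp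
    also have "\<dots> \<le> r * ln (u + \<rho>)" using one by simp
    also have "\<dots> \<le> (\<Sum>j\<in>S. y j * ln (a j + \<rho>))" using one u by (intro small) auto
    finally have "(\<Sum>j\<in>J. y j * ln (a j + \<rho>)) \<ge> (\<Sum>j\<in>L. y j * ln (a j)) - 1 / exp 1"
      using split[of "\<lambda>j. y j * ln (a j + \<rho>)"] large[OF u(1)] by simp
    then show ?thesis by (simp add: L_def)
  next
    case two
    have "\<beta> > 0" using r\<beta> two u1 by (metis diff_gt_0_iff_gt mult_pos_pos)
    then have "u > 0" using u(2,4) by (cases "u = 0") auto
    \<comment> \<open>\<open>\<delta>\<close> is the position of \<open>\<beta>\<close> in the
      window from \<open>\<rho>\<close> to \<open>\<rho> + u\<close>. As \<open>c\<close> is the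
      difference of the logarithms of \<open>2 u + \<rho>\<close> and \<open>u + \<rho>\<close>,
      choosing \<open>z = r - (1 - \<delta>)\<close> splits
      \<open>r ln (2 u + \<rho>) - c (1 - \<delta>)\<close> into the two groups of
      \<open>two_group_bound\<close>; the level equation supplies the arguments.\<close>
    define \<delta> where "\<delta> = (\<beta> - \<rho>) / u"
    have \<delta>: "\<beta> = \<rho> + u * \<delta>" using \<open>u > 0\<close> by (simp add: \<delta>_def)
    have "\<delta> \<le> 1" using u(3) \<open>u > 0\<close> by (simp add: \<delta>_def)
    define z where "z = r - 1 + \<delta>"
    have \<rho>: "u + \<rho> = r - u * z" using r\<beta> \<delta> by (simp add: z_def algebra_simps)
    then have "u * z > 0" using two by simp
    then have "z > 0" using \<open>u > 0\<close> zero_less_mult_pos by blast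
    have "- 1 / exp 1 \<le> z * ln (r + u * (1 - z)) + (r - z) * ln (r - u * z)"
      using two r01 \<open>z > 0\<close> \<open>\<delta> \<le> 1\<close> \<open>u > 0\<close> u(1) \<rho> by (intro two_group_bound) (auto simp: z_def)
    also have "r + u * (1 - z) = 2 * u + \<rho>" using \<rho> by (simp add: algebra_simps)
    also have "r - u * z = u + \<rho>" using \<rho> by simp
    also have "z * ln (2 * u + \<rho>) + (r - z) * ln (u + \<rho>) = r * ln (u + (\<rho> + u)) + c * \<delta> - c"
      using \<open>u > 0\<close> u(1) by (simp add: c_def ln_div z_def algebra_simps)
    also have "c * \<delta> = c / u * (\<beta> - \<rho>)" by (simp add: \<delta>_def)
    also have "r * ln (u + (\<rho> + u)) \<le> (\<Sum>j\<in>S. y j * ln (a j + (\<rho> + u)))"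
      using \<open>u > 0\<close> u(1) by (intro small) auto
    finally have "(\<Sum>j\<in>J. y j * ln (a j + \<rho> + u)) + c / u * (\<beta> - \<rho>) - c
        \<ge> (\<Sum>j\<in>L. y j * ln (a j)) - 1 / exp 1"
      using split[of "\<lambda>j. y j * ln (a j + \<rho> + u)"] large[of "\<rho> + u"] u(1) \<open>u > 0\<close>
      by (simp add: add.assoc)
    then show ?thesis by (simp add: L_def)
  qed
qed

section \<open>Buckets\<close>

text \<open>\<open>v_pos\<close> is restricted to positive shares because \<open>J\<close> may
  contain items that the agent has no edge to, with value and share 0. \<open>full_before\<close>
  guarantees that filling all full buckets puts an item into every bucket that precedes a nonempty
  one.\<close>

locale buckets =
  fixes J :: "'b set" and v :: "'b \<Rightarrow> real" and y :: "nat \<Rightarrow> 'b \<Rightarrow> real" and K :: nat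
  assumes finite_J: "finite J"
    and v_pos: "\<And>k j. j \<in> J \<Longrightarrow> y k j > 0 \<Longrightarrow> v j > 0"
    and y_nonneg: "\<And>k j. j \<in> J \<Longrightarrow> y k j \<ge> 0"
    and y_beyond: "\<And>k j. j \<in> J \<Longrightarrow> K \<le> k \<Longrightarrow> y k j = 0"
    and sum_le_1: "\<And>k. (\<Sum>j\<in>J. y k j) \<le> 1"
    and full_0: "(\<Sum>j\<in>J. y 0 j) = 1"
    and full_before: "\<And>k j. j \<in> J \<Longrightarrow> y (Suc k) j > 0 \<Longrightarrow> (\<Sum>j\<in>J. y k j) = 1"
    and sorted: "\<And>k l j j'. k < l \<Longrightarrow> j \<in> J \<Longrightarrow> j' \<in> J \<Longrightarrow> y k j > 0 \<Longrightarrow> y l j' > 0 \<Longrightarrow> v j' \<le> v j"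
begin

text \<open>\<open>E0\<close> and \<open>E1\<close> are the values of the two linear lower bounds at the fractional assignment.
  If \<open>u = 0\<close>, the quotient \<open>c / u\<close> is \<open>0\<close> and both coincide.\<close>

definition "maxval k = Max (insert 0 (v ` {j\<in>J. y k j > 0}))"
definition "u = maxval 1"
definition "R = (\<Sum>k\<in>{2..<K}. maxval k)"
definition "B = (\<Sum>k\<in>{1..<K}. \<Sum>j\<in>J. y k j * v j)"
definition "c = ln ((2 * u + R) / (u + R))"
definition "E0 = (\<Sum>j\<in>J. y 0 j * ln (v j + R))"
definition "E1 = (\<Sum>j\<in>J. y 0 j * ln (v j + R + u)) + c / u * (B - R) - c"

section \<open>Largest values of the buckets and the window for the later buckets\<close>

lemma maxval_nonneg: "maxval k \<ge> 0"
  unfolding maxval_def using finite_J by (intro Max_ge) auto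

lemma le_maxval: "j \<in> J \<Longrightarrow> y k j > 0 \<Longrightarrow> v j \<le> maxval k"
  unfolding maxval_def using finite_J by (intro Max_ge) auto

lemma maxval_cases: "maxval k = 0 \<or> (\<exists>j\<in>J. y k j > 0 \<and> maxval k = v j)"
proof -
  have "maxval k \<in> insert 0 (v ` {j\<in>J. y k j > 0})"
    unfolding maxval_def using finite_J by (intro Max_in) auto
  then show ?thesis by auto
qed

lemma maxval_le: "k < l \<Longrightarrow> j \<in> J \<Longrightarrow> y k j > 0 \<Longrightarrow> maxval l \<le> v j"
  using maxval_cases[of l] v_pos[of j k] sorted[of k l j] by force

lemma maxval_pos: "j \<in> J \<Longrightarrow> y k j > 0 \<Longrightarrow> maxval k > 0"
  using le_maxval v_pos by fastforce

lemma maxval_pos_imp_full: "maxval (Suc k) > 0 \<Longrightarrow> (\<Sum>j\<in>J. y k j) = 1"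
  using maxval_cases[of "Suc k"] full_before by auto

lemma maxval_Suc_pos: "maxval (Suc k) > 0 \<Longrightarrow> maxval k > 0"
proof -
  assume "maxval (Suc k) > 0"
  then have "(\<Sum>j\<in>J. y k j) \<noteq> 0" using maxval_pos_imp_full by simp
  then obtain j where "j \<in> J" "y k j \<noteq> 0" by (meson sum.neutral)
  then show ?thesis using maxval_pos y_nonneg[of j k] by simp
qed

lemma maxval_beyond: "K \<le> k \<Longrightarrow> maxval k = 0"
  using maxval_cases[of k] y_beyond by force

lemma K_pos: "K > 0"
proof (rule ccontr)
  assume "\<not> K > 0"
  then have "(\<Sum>j\<in>J. y 0 j) = 0" using y_beyond by simp
  with full_0 show False by simp
qed

lemma u_nonneg: "u \<ge> 0" and R_nonneg: "R \<ge> 0"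
  by (auto simp: u_def R_def maxval_nonneg intro: sum_nonneg)

text \<open>A nonempty bucket is preceded by a full one, so emptiness of bucket 1 spreads to all
  later buckets.\<close>

lemma maxval_eq_0: "u = 0 \<Longrightarrow> k \<ge> 1 \<Longrightarrow> maxval k = 0"
proof (induction k)
  case (Suc k)
  show ?case
  proof (cases "k = 0")
    case False
    then have "maxval k = 0" using Suc by simp
    then show ?thesis using maxval_Suc_pos[of k] maxval_nonneg[of "Suc k"] by linarith
  qed (use Suc.prems in \<open>simp add: u_def\<close>)
qed auto

lemma R_eq_0: "u = 0 \<Longrightarrow> R = 0"
  unfolding R_def using maxval_eq_0 by (intro sum.neutral) auto

lemma sum_maxval: "(\<Sum>k\<in>{1..<K}. maxval k) = u + R"
proof (cases "K = 1")
  case True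
  then show ?thesis unfolding u_def R_def using maxval_beyond[of 1] by simp
next
  case False
  then have "{1..<K} = insert 1 {2..<K}" using K_pos by auto
  then show ?thesis by (simp add: u_def R_def)
qed

text \<open>Shifting by one bucket loses \<open>maxval 1 = u\<close> and gains
  \<open>maxval K = 0\<close>. This is why the lower and the upper estimate of \<open>X\<close>
  differ by exactly \<open>u\<close>.\<close>

lemma sum_maxval_Suc: "(\<Sum>k\<in>{1..<K}. maxval (Suc k)) = R"
proof -
  have "(\<Sum>k\<in>{1..<K}. maxval (Suc k)) = (\<Sum>k\<in>{2..<Suc K}. maxval k)"
    using sum.shift_bounds_Suc_ivl[of maxval 1 K] by (simp add: numeral_2_eq_2)
  also have "\<dots> = R"
    unfolding R_def using maxval_beyond[of K] by (cases "K \<ge> 2") auto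
  finally show ?thesis .
qed

lemma bucket_value_le_maxval: "(\<Sum>j\<in>J. y k j * v j) \<le> maxval k"
proof -
  have "(\<Sum>j\<in>J. y k j * v j) \<le> (\<Sum>j\<in>J. y k j * maxval k)"
  proof (rule sum_mono)
    fix j assume "j \<in> J"
    then show "y k j * v j \<le> y k j * maxval k"
      using le_maxval[of j k] y_nonneg[of j k] by (cases "y k j = 0") auto
  qed
  also have "\<dots> = (\<Sum>j\<in>J. y k j) * maxval k" by (simp add: sum_distrib_right)
  also have "\<dots> \<le> 1 * maxval k" using sum_le_1 maxval_nonneg by (intro mult_right_mono)
  finally show ?thesis by simp
qed

lemma B_le: "B \<le> R + u"
  using sum_mono[of "{1..<K}" "\<lambda>k. \<Sum>j\<in>J. y k j * v j" maxval] bucket_value_le_maxval sum_maxval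
  by (simp add: B_def)

lemma yv_nonneg: "j \<in> J \<Longrightarrow> y k j * v j \<ge> 0"
  using y_nonneg[of j k] v_pos[of j k] by (cases "y k j = 0") auto

lemma B_pos: assumes "u > 0" shows "B > 0"
proof -
  obtain j where j: "j \<in> J" "y 1 j > 0" using maxval_cases[of 1] assms by (auto simp: u_def)
  then have "K > 1" using y_beyond[of j 1] by force
  have "0 < y 1 j * v j" using j v_pos by simp
  also have "\<dots> \<le> (\<Sum>j\<in>J. y 1 j * v j)"
    using member_le_sum[of j J "\<lambda>j. y 1 j * v j"] yv_nonneg finite_J j by auto
  also have "\<dots> \<le> B" unfolding B_def
    using member_le_sum[of 1 "{1..<K}" "\<lambda>k. \<Sum>j\<in>J. y k j * v j"] yv_nonneg \<open>K > 1\<close>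
    by (auto intro: sum_nonneg)
  finally show ?thesis .
qed

lemma B_eq_0: "u = 0 \<Longrightarrow> B = 0"
proof -
  assume "u = 0"
  then have "y k j * v j = 0" if "k \<ge> 1" "j \<in> J" for k j
    using maxval_eq_0[of k] that maxval_pos[of j k] y_nonneg[of j k] by (cases "y k j = 0") auto
  then show ?thesis unfolding B_def by (intro sum.neutral ballI) auto
qed

lemma E1_eq_E0: "u = 0 \<Longrightarrow> E1 = E0"
  by (simp add: E1_def E0_def R_eq_0 c_def)

text \<open>A single affine form covers both bounds. \<open>offset\<close> does not depend on the
  assignment, so it cancels in comparisons and the program stores only \<open>shift\<close> and
  \<open>rate\<close>.\<close>

definition "shift = (if E0 < E1 then R + u else R)"
definition "rate = (if E0 < E1 then c / u else 0)"
definition "offset = (if E0 < E1 then c + c / u * R else 0)"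

lemma surrogate_fractional: "(\<Sum>j\<in>J. y 0 j * ln (v j + shift)) + rate * B - offset = max E0 E1"
  by (simp add: shift_def rate_def offset_def E0_def E1_def add.assoc algebra_simps)

lemma surrogate_bound:
  assumes h: "h > 0" "(\<Sum>j\<in>J. min (v j) h * (\<Sum>k<K. y k j)) = h"
  shows "max E0 E1 \<ge>
    (\<Sum>j\<in>{j\<in>J. v j > h}. (\<Sum>k<K. y k j) * ln (v j / h)) + ln h - 1 / exp 1"
proof -
  have first: "(\<Sum>k<K. y k j) = y 0 j + (\<Sum>k\<in>{1..<K}. y k j)" for j
    using sum.atLeast_Suc_lessThan[of 0 K "\<lambda>k. y k j"] K_pos
    by (simp add: lessThan_atLeast0)
  have rest_nonneg: "(\<Sum>k\<in>{1..<K}. y k j) \<ge> 0" if "j \<in> J" for j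
    using y_nonneg that by (intro sum_nonneg) auto
  \<comment> \<open>An item above the level in a later bucket would force the whole first bucket
    above the level. That bucket alone would then contribute all of \<open>h\<close> to the level
    equation, and this item would exceed it.\<close>
  have small: "v j \<le> h" if kj: "k \<ge> 1" "j \<in> J" "y k j > 0" for k j
  proof (rule ccontr)
    assume "\<not> v j \<le> h"
    have "k < K" using y_beyond[of j k] kj by force
    have "(\<Sum>i\<in>J. h * y 0 i) < (\<Sum>i\<in>J. min (v i) h * (\<Sum>k<K. y k i))"
    proof (rule sum_strict_mono_ex1)
      have le: "h * y 0 i \<le> min (v i) h * y 0 i" if "i \<in> J" for i
        using sorted[of 0 k i j] kj \<open>\<not> v j \<le> h\<close> y_nonneg[of i 0] that
        by (cases "y 0 i = 0") auto
      have nn: "min (v i) h * (\<Sum>k\<in>{1..<K}. y k i) \<ge> 0" if "i \<in> J" for i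
      proof (cases "(\<Sum>k\<in>{1..<K}. y k i) = 0")
        case False
        then obtain l where "y l i \<noteq> 0" by (meson sum.neutral)
        then have "v i > 0" using v_pos[of i l] y_nonneg[of i l] that by simp
        then show ?thesis using rest_nonneg[OF that] h by simp
      qed auto
      show "\<forall>i\<in>J. h * y 0 i \<le> min (v i) h * (\<Sum>k<K. y k i)"
        unfolding first using le nn by (auto simp: distrib_left intro: add_increasing2)
      have "(\<Sum>k\<in>{1..<K}. y k j) \<ge> y k j"
        using kj \<open>k < K\<close> y_nonneg by (intro member_le_sum) auto
      then have "min (v j) h * (\<Sum>k\<in>{1..<K}. y k j) > 0"
        using \<open>\<not> v j \<le> h\<close> h kj by simp
      then have "h * y 0 j < min (v j) h * (\<Sum>k<K. y k j)"
        unfolding first using le[OF kj(2)] by (simp add: distrib_left)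
      then show "\<exists>i\<in>J. h * y 0 i < min (v i) h * (\<Sum>k<K. y k i)" using kj by blast
    qed (rule finite_J)
    then show False using full_0 h by (simp flip: sum_distrib_left)
  qed
  have rest0: "(\<Sum>k\<in>{1..<K}. y k j) = 0" if "j \<in> J" "v j > h" for j
  proof (rule sum.neutral, rule ballI)
    fix k assume "k \<in> {1..<K}"
    then show "y k j = 0" using small[of k j] y_nonneg[of j k] that by force
  qed
  define a where "a j = v j / h" for j
  define S L where "S = {j\<in>J. a j \<le> 1}" and "L = {j\<in>J. a j > 1}"
  have SL: "finite S" "finite L" "S \<inter> L = {}" "J = S \<union> L"
    using finite_J by (auto simp: S_def L_def)
  have L_eq: "L = {j\<in>J. v j > h}" using h by (auto simp: L_def a_def)
  have S_eq: "S = {j\<in>J. v j \<le> h}" using h by (auto simp: S_def a_def)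
  \<comment> \<open>Items above the level lie in the first bucket only and contribute
    \<open>h\<close> times their share. As this bucket has mass 1, they can be subtracted from both
    sides.\<close>
  have level: "(\<Sum>j\<in>S. y 0 j * a j) + B / h = (\<Sum>j\<in>S. y 0 j)"
  proof -
    have "h = (\<Sum>j\<in>S. min (v j) h * (\<Sum>k<K. y k j)) + (\<Sum>j\<in>L. min (v j) h * (\<Sum>k<K. y k j))"
      using h(2) SL by (simp add: sum.union_disjoint)
    also have "(\<Sum>j\<in>S. min (v j) h * (\<Sum>k<K. y k j))
        = (\<Sum>j\<in>S. y 0 j * v j) + (\<Sum>j\<in>S. \<Sum>k\<in>{1..<K}. y k j * v j)"
      unfolding first sum.distrib[symmetric]
      by (intro sum.cong refl) (simp add: S_eq distrib_left sum_distrib_left mult.commute)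
    also have "(\<Sum>j\<in>S. \<Sum>k\<in>{1..<K}. y k j * v j) = (\<Sum>j\<in>J. \<Sum>k\<in>{1..<K}. y k j * v j)"
    proof (rule sum.mono_neutral_left)
      show "\<forall>j\<in>J - S. (\<Sum>k\<in>{1..<K}. y k j * v j) = 0"
      proof
        fix j assume "j \<in> J - S"
        then have "j \<in> J" "v j > h" by (auto simp: S_eq)
        from rest0[OF this] show "(\<Sum>k\<in>{1..<K}. y k j * v j) = 0"
          by (simp flip: sum_distrib_right)
      qed
    qed (use SL in auto)
    also have "\<dots> = B" unfolding B_def by (rule sum.swap)
    also have "(\<Sum>j\<in>L. min (v j) h * (\<Sum>k<K. y k j)) = h * (\<Sum>j\<in>L. y 0 j)"
      unfolding first sum_distrib_left by (intro sum.cong) (auto simp: L_eq rest0[unfolded One_nat_def])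
    finally have *: "h = (\<Sum>j\<in>S. y 0 j * v j) + B + h * (\<Sum>j\<in>L. y 0 j)" .
    have "1 = (\<Sum>j\<in>S. y 0 j) + (\<Sum>j\<in>L. y 0 j)"
      using full_0 SL by (simp add: sum.union_disjoint)
    then have "h * (\<Sum>j\<in>S. y 0 j) = h - h * (\<Sum>j\<in>L. y 0 j)"
      by (metis add_diff_cancel_right' mult.right_neutral right_diff_distrib)
    with * have "(\<Sum>j\<in>S. y 0 j) = ((\<Sum>j\<in>S. y 0 j * v j) + B) / h"
      using h by (simp add: field_simps)
    then show ?thesis by (simp add: a_def add_divide_distrib sum_divide_distrib)
  qed
  define E0' E1' where "E0' = (\<Sum>j\<in>J. y 0 j * ln (a j + R / h))"
    and "E1' = (\<Sum>j\<in>J. y 0 j * ln (a j + R / h + u / h)) + c / (u / h) * (B / h - R / h) - c"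
  \<comment> \<open>\<open>c\<close> is invariant under scaling, so the normalised inequality
    applies with the same constant.\<close>
  have c': "c = ln ((2 * (u / h) + R / h) / (u / h + R / h))"
  proof -
    have "(2 * (u / h) + R / h) / (u / h + R / h) = ((2 * u + R) / h) / ((u + R) / h)"
      by (simp add: add_divide_distrib)
    also have "\<dots> = (2 * u + R) / (u + R)" using h by simp
    finally show ?thesis by (simp add: c_def)
  qed
  have main: "max E0' E1' \<ge> (\<Sum>j\<in>L. y 0 j * ln (a j)) - 1 / exp 1"
    unfolding E0'_def E1'_def L_def c'
  proof (rule surrogate_bound_normalised)
    show "\<And>j. j \<in> J \<Longrightarrow> y 0 j > 0 \<Longrightarrow> a j \<ge> u / h"
      using maxval_le[of 0 1] h by (simp add: a_def u_def divide_right_mono)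
    show "B / h \<le> R / h + u / h" using B_le h by (simp add: field_simps)
  qed (use finite_J y_nonneg full_0 v_pos h level u_nonneg R_nonneg B_eq_0 R_eq_0 B_pos
      in \<open>auto simp: a_def S_def zero_less_divide_iff\<close>)
  \<comment> \<open>Undoing the normalisation adds \<open>ln h\<close> exactly once because the
    first bucket has mass 1.\<close>
  have shift: "(\<Sum>j\<in>J. y 0 j * ln (v j + s)) = (\<Sum>j\<in>J. y 0 j * ln (a j + s / h)) + ln h"
    if "s \<ge> 0" for s
  proof -
    have "(\<Sum>j\<in>J. y 0 j * ln (v j + s)) = (\<Sum>j\<in>J. y 0 j * ln (a j + s / h) + y 0 j * ln h)"
    proof (intro sum.cong refl)
      fix j assume j: "j \<in> J"
      show "y 0 j * ln (v j + s) = y 0 j * ln (a j + s / h) + y 0 j * ln h"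
      proof (cases "y 0 j = 0")
        case False
        then have "v j > 0" using v_pos[of j 0] y_nonneg[of j 0] j by simp
        then have "ln (v j + s) = ln (a j + s / h) + ln h"
          using that h by (simp add: a_def ln_div flip: add_divide_distrib)
        then show ?thesis by (simp only: distrib_left)
      qed auto
    qed
    also have "\<dots> = (\<Sum>j\<in>J. y 0 j * ln (a j + s / h)) + ln h"
      using full_0 by (simp add: sum.distrib flip: sum_distrib_right)
    finally show ?thesis .
  qed
  have "E0 = E0' + ln h" unfolding E0_def E0'_def using shift[OF R_nonneg] .
  moreover have eq: "c / (u / h) * (B / h - R / h) = c / u * (B - R)"
    using h by (cases "u = 0") (auto simp: field_simps)
  have "E1 = E1' + ln h" unfolding E1_def E1'_def eq
    using shift[of "R + u"] R_nonneg u_nonneg by (simp add: add.assoc add_divide_distrib)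
  moreover have "(\<Sum>j\<in>L. y 0 j * ln (a j)) = (\<Sum>j\<in>{j\<in>J. v j > h}. (\<Sum>k<K. y k j) * ln (v j / h))"
    unfolding L_eq first a_def by (intro sum.cong) (auto simp: rest0[unfolded One_nat_def])
  ultimately show ?thesis using main by linarith
qed

section \<open>Integral assignments that fill every full bucket\<close>

context
  fixes z :: "nat \<Rightarrow> 'b \<Rightarrow> real"
  assumes z01: "\<And>k j. j \<in> J \<Longrightarrow> z k j = 0 \<or> z k j = 1 \<and> y k j > 0"
    and z_le_1: "\<And>k. (\<Sum>j\<in>J. z k j) \<le> 1"
    and z_full: "\<And>k. (\<Sum>j\<in>J. y k j) = 1 \<Longrightarrow> (\<Sum>j\<in>J. z k j) = 1"
begin

text \<open>A 0/1 vector with sum 1 is a unit vector, so every linear functional of the bucket is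
  evaluation at one item. This turns the linear bounds back into statements about that item.\<close>

lemma pick_obtain:
  assumes "(\<Sum>j\<in>J. z k j) = 1"
  obtains j where "j \<in> J" "y k j > 0" "z k j = 1" "\<And>g. (\<Sum>i\<in>J. z k i * g i) = (g j :: real)"
proof -
  have "(\<Sum>j\<in>J. z k j) \<noteq> 0" using assms by simp
  then obtain j where j: "j \<in> J" "z k j \<noteq> 0" by (meson sum.neutral)
  then have zj: "z k j = 1" "y k j > 0" using z01 by blast+
  have z_nonneg: "z k i \<ge> 0" if "i \<in> J" for i using z01[OF that, of k] by auto
  have "(\<Sum>i\<in>J - {j}. z k i) = 0"
    using assms zj j finite_J by (simp add: sum.remove)
  then have other: "z k i = 0" if "i \<in> J - {j}" for i
    using sum_nonneg_eq_0_iff[of "J - {j}" "z k"] that z_nonneg finite_J by blast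
  have "(\<Sum>i\<in>J. z k i * g i) = g j" for g
    using j zj other finite_J by (simp add: sum.remove)
  with that[of j] j zj show thesis by blast
qed

lemma pick_empty:
  assumes "(\<Sum>j\<in>J. z k j) \<noteq> 1"
  shows "(\<Sum>i\<in>J. z k i * g i) = 0"
proof -
  have z_nonneg: "z k i \<ge> 0" if "i \<in> J" for i using z01[OF that, of k] by auto
  have "z k i = 0" if "i \<in> J" for i
  proof (rule ccontr)
    assume "z k i \<noteq> 0"
    then have "z k i = 1" using z01[OF that] by auto
    moreover have "z k i \<le> (\<Sum>j\<in>J. z k j)"
      using finite_J that z_nonneg by (intro member_le_sum) auto
    ultimately show False using z_le_1[of k] assms by linarith
  qed
  then show ?thesis by simp
qed

lemma pick_le_maxval: "(\<Sum>j\<in>J. z k j * v j) \<le> maxval k"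
  using pick_obtain[of k "(\<Sum>j\<in>J. z k j * v j) \<le> maxval k"] pick_empty[of k v] le_maxval maxval_nonneg[of k]
  by (metis order.refl)

text \<open>If the next bucket is nonempty, this one is full and receives an item, which by sorting
  is worth at least everything in the next bucket.\<close>

lemma pick_ge_maxval: "(\<Sum>j\<in>J. z k j * v j) \<ge> maxval (Suc k)"
proof (cases "maxval (Suc k) > 0")
  case True
  then have "(\<Sum>j\<in>J. z k j) = 1" using maxval_pos_imp_full z_full by blast
  then show ?thesis using pick_obtain[of k] maxval_le[of k "Suc k"] by (metis lessI)
next
  case False
  have "z k j * v j \<ge> 0" if "j \<in> J" for j
    using z01[OF that, of k] v_pos[OF that, of k] by auto
  then have "(\<Sum>j\<in>J. z k j * v j) \<ge> 0" by (rule sum_nonneg)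
  with False show ?thesis by linarith
qed

definition "V = (\<Sum>k<K. \<Sum>j\<in>J. z k j * v j)"
definition "X = (\<Sum>k\<in>{1..<K}. \<Sum>j\<in>J. z k j * v j)"

lemma X_bounds: "R \<le> X" "X \<le> R + u"
  using sum_mono[of "{1..<K}" "\<lambda>k. \<Sum>j\<in>J. z k j * v j" maxval] pick_le_maxval
    sum_mono[of "{1..<K}" "\<lambda>k. maxval (Suc k)" "\<lambda>k. \<Sum>j\<in>J. z k j * v j"] pick_ge_maxval sum_maxval sum_maxval_Suc by (simp_all add: X_def)

lemma V_eq:
  obtains j where "j \<in> J" "y 0 j > 0" "V = v j + X" "\<And>g. (\<Sum>i\<in>J. z 0 i * g i) = (g j :: real)"
proof -
  obtain j where j: "j \<in> J" "y 0 j > 0" "\<And>g. (\<Sum>i\<in>J. z 0 i * g i) = (g j :: real)"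
    using pick_obtain[OF z_full[OF full_0]] by metis
  have "V = (\<Sum>j\<in>J. z 0 j * v j) + X"
    unfolding V_def X_def
    using sum.atLeast_Suc_lessThan[of 0 K "\<lambda>k. \<Sum>j\<in>J. z k j * v j"] K_pos
    by (simp add: lessThan_atLeast0)
  with that j show thesis by simp
qed

lemma V_pos: "V > 0"
proof -
  obtain j where j: "j \<in> J" "y 0 j > 0" "V = v j + X" using V_eq by metis
  then show ?thesis using v_pos[of j 0] X_bounds(1) R_nonneg by simp
qed

lemma surrogate_0_le: "(\<Sum>j\<in>J. z 0 j * ln (v j + R)) \<le> ln V"
proof -
  obtain j where j: "j \<in> J" "y 0 j > 0" "V = v j + X" "\<And>g. (\<Sum>i\<in>J. z 0 i * g i) = (g j :: real)"
    using V_eq by metis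
  then show ?thesis using v_pos[of j 0] X_bounds(1) R_nonneg by simp
qed

text \<open>With \<open>D\<close> the relative position of \<open>X\<close> in its window, concavity
  bounds \<open>ln V\<close> by the mixture of the values at both ends. The lower end is then
  replaced by the upper end minus \<open>c\<close>, which makes the coefficient of \<open>D\<close>
  the same for every picked item.\<close>

lemma surrogate_1_le:
  assumes "u > 0"
  shows "(\<Sum>j\<in>J. z 0 j * ln (v j + R + u)) + c / u * (X - R) - c \<le> ln V"
proof -
  obtain j where j: "j \<in> J" "y 0 j > 0" "V = v j + X" "\<And>g. (\<Sum>i\<in>J. z 0 i * g i) = (g j :: real)"
    using V_eq by metis
  have vj: "v j \<ge> u" using j maxval_le[of 0 1] by (simp add: u_def)
  define D where "D = (X - R) / u"
  have D: "0 \<le> D" "D \<le> 1" "X = R + u * D" using X_bounds assms by (auto simp: D_def)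
  have "ln (v j + R + u) - c \<le> ln (v j + R)"
  proof -
    have "(v j + R + u) / (v j + R) \<le> (2 * u + R) / (u + R)"
      using vj assms R_nonneg by (simp add: field_simps mult_mono)
    then have "ln ((v j + R + u) / (v j + R)) \<le> c"
      unfolding c_def using vj assms R_nonneg by (intro ln_mono) auto
    then show ?thesis using vj assms R_nonneg by (simp add: ln_div)
  qed
  then have "(1 - D) * (ln (v j + R + u) - c) + D * ln (v j + R + u)
      \<le> (1 - D) * ln (v j + R) + D * ln (v j + R + u)"
    using D by (intro add_right_mono mult_left_mono) auto
  also have "\<dots> \<le> ln ((1 - D) * (v j + R) + D * (v j + R + u))"
    using D vj assms R_nonneg by (intro ln_ge_chord) auto
  also have "(1 - D) * (v j + R) + D * (v j + R + u) = V"
    unfolding j(3) D(3) by (simp add: algebra_simps)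
  finally show ?thesis unfolding j(4) by (simp add: D_def algebra_simps diff_divide_distrib)
qed

lemma surrogate_integral: "(\<Sum>j\<in>J. z 0 j * ln (v j + shift)) + rate * X - offset \<le> ln V"
proof (cases "E0 < E1")
  case True
  then have "u > 0" using u_nonneg E1_eq_E0 by (cases "u = 0") auto
  from surrogate_1_le[OF this] True show ?thesis
    by (simp add: shift_def rate_def offset_def add.assoc algebra_simps)
next
  case False
  then show ?thesis using surrogate_0_le by (simp add: shift_def rate_def offset_def)
qed

end

end

section \<open>Cutting sorted shares into buckets\<close>

text \<open>For \<open>t >= 0\<close>, the length of the part of the interval from 0 to
  \<open>t\<close> that lies between \<open>k\<close> and \<open>k + 1\<close>.\<close>

definition clip :: "nat \<Rightarrow> real \<Rightarrow> real" where
  "clip k t = max 0 (min 1 (t - real k))"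

lemma clip_mono: "s \<le> t \<Longrightarrow> clip k s \<le> clip k t"
  by (auto simp: clip_def)

lemma clip_le_1: "clip k t \<le> 1"
  by (simp add: clip_def)

lemma clip_0: "clip k 0 = 0"
  by (simp add: clip_def)

lemma sum_clip: "t \<ge> 0 \<Longrightarrow> (\<Sum>k<K. clip k t) = min t (real K)"
  by (induction K) (auto simp: clip_def)

text \<open>Telescoping along a strict total order without listing the elements. A maximal element
  is removed: its predecessors are all the others, and it is a predecessor of none of them.\<close>

lemma sum_prefix_telescope:
  fixes x F :: "_ \<Rightarrow> real"
  assumes "finite J" "asymp_on J lt" "transp_on J lt" "totalp_on J lt"
  shows "(\<Sum>j\<in>J. F ((\<Sum>i\<in>{i\<in>J. lt i j}. x i) + x j) - F (\<Sum>i\<in>{i\<in>J. lt i j}. x i))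
    = F (\<Sum>j\<in>J. x j) - F 0"
  using assms
proof (induction "card J" arbitrary: J)
  case 0
  then show ?case by simp
next
  case (Suc n)
  then have "J \<noteq> {}" by auto
  then obtain m where m: "m \<in> J" "\<forall>j\<in>J. j \<noteq> m \<longrightarrow> \<not> lt m j"
    using Finite_Set.bex_max_element[of J lt] Suc.prems by blast
  define J' where "J' = J - {m}"
  have J: "J = insert m J'" "m \<notin> J'" "finite J'" using m Suc.prems by (auto simp: J'_def)
  have "n = card J'" using Suc(2) J by simp
  have "\<not> lt m m" using Suc.prems(2) m by (metis asymp_onD)
  have pre: "{i\<in>J. lt i j} = {i\<in>J'. lt i j}" if "j \<in> J'" for j
    using m(2) that by (auto simp: J'_def)
  have "{i\<in>J. lt i m} = J'"
    using m Suc.prems(4) \<open>\<not> lt m m\<close> by (auto simp: J'_def totalp_on_def)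
  moreover have "(\<Sum>j\<in>J'. F ((\<Sum>i\<in>{i\<in>J'. lt i j}. x i) + x j) - F (\<Sum>i\<in>{i\<in>J'. lt i j}. x i))
    = F (\<Sum>j\<in>J'. x j) - F 0"
    using Suc.prems by (intro Suc(1)[OF \<open>n = card J'\<close>])
      (auto simp: J'_def intro: asymp_on_subset transp_on_subset totalp_on_subset)
  moreover have "(\<Sum>j\<in>J'. F ((\<Sum>i\<in>{i\<in>J. lt i j}. x i) + x j) - F (\<Sum>i\<in>{i\<in>J. lt i j}. x i))
    = (\<Sum>j\<in>J'. F ((\<Sum>i\<in>{i\<in>J'. lt i j}. x i) + x j) - F (\<Sum>i\<in>{i\<in>J'. lt i j}. x i))"
    by (intro sum.cong refl) (simp only: pre)
  ultimately show ?case
    using sum.insert[OF J(3,2), of x]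
      sum.insert[OF J(3,2), of "\<lambda>j. F ((\<Sum>i\<in>{i\<in>J. lt i j}. x i) + x j) - F (\<Sum>i\<in>{i\<in>J. lt i j}. x i)"]
    by (simp add: J(1)[symmetric] add.commute)
qed

text \<open>Breaking ties by index makes this a strict total order, so that the items occupy
  consecutive intervals without overlap.\<close>

definition precedes :: "('b::linorder \<Rightarrow> real) \<Rightarrow> 'b \<Rightarrow> 'b \<Rightarrow> bool" where
  "precedes v i j \<longleftrightarrow> v i > v j \<or> v i = v j \<and> i < j"

definition prefix_mass :: "'b::linorder set \<Rightarrow> ('b \<Rightarrow> real) \<Rightarrow> ('b \<Rightarrow> real) \<Rightarrow> 'b \<Rightarrow> real" where
  "prefix_mass J v x j = (\<Sum>i\<in>{i\<in>J. precedes v i j}. x i)"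

text \<open>The length of the intersection of item \<open>j\<close>'s interval with the interval \<open>[k, k + 1]\<close>.\<close>

definition bucket_share :: "'b::linorder set \<Rightarrow> ('b \<Rightarrow> real) \<Rightarrow> ('b \<Rightarrow> real) \<Rightarrow> nat \<Rightarrow> 'b \<Rightarrow> real" where
  "bucket_share J v x k j = clip k (prefix_mass J v x j + x j) - clip k (prefix_mass J v x j)"

context
  fixes J :: "'b::linorder set" and v x :: "'b \<Rightarrow> real" and K :: nat
  assumes fin: "finite J" and x_nonneg: "\<And>j. j \<in> J \<Longrightarrow> x j \<ge> 0"
    and mass: "1 \<le> (\<Sum>j\<in>J. x j)" "(\<Sum>j\<in>J. x j) \<le> real K"
    and v_pos: "\<And>j. j \<in> J \<Longrightarrow> x j > 0 \<Longrightarrow> v j > 0"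
begin

lemma prefix_mass_nonneg: "prefix_mass J v x j \<ge> 0"
  unfolding prefix_mass_def using x_nonneg by (intro sum_nonneg) auto

lemma prefix_mass_add: "j \<in> J \<Longrightarrow> prefix_mass J v x j + x j = (\<Sum>i\<in>insert j {i\<in>J. precedes v i j}. x i)"
  using fin by (subst sum.insert) (auto simp: prefix_mass_def precedes_def)

lemma prefix_mass_add_le: "j \<in> J \<Longrightarrow> prefix_mass J v x j + x j \<le> (\<Sum>j\<in>J. x j)"
  unfolding prefix_mass_add using fin x_nonneg by (intro sum_mono2) auto

lemma prefix_mass_mono:
  assumes "i \<in> J" "j \<in> J" "precedes v i j"
  shows "prefix_mass J v x i + x i \<le> prefix_mass J v x j"
  unfolding prefix_mass_add[OF assms(1)] unfolding prefix_mass_def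
  using assms fin x_nonneg by (intro sum_mono2) (auto simp: precedes_def)

lemma sum_bucket_share: "(\<Sum>j\<in>J. bucket_share J v x k j) = clip k (\<Sum>j\<in>J. x j)"
  unfolding bucket_share_def prefix_mass_def
  by (subst sum_prefix_telescope[where F = "clip k"])
    (use fin in \<open>auto simp: clip_0 precedes_def asymp_on_def transp_on_def totalp_on_def\<close>)

lemma bucket_share_total: "j \<in> J \<Longrightarrow> (\<Sum>k<K. bucket_share J v x k j) = x j"
  using prefix_mass_nonneg[of j] x_nonneg[of j] prefix_mass_add_le[of j] mass(2)
  by (simp add: bucket_share_def sum_subtractf sum_clip)

lemma bucket_share_nonneg: "j \<in> J \<Longrightarrow> bucket_share J v x k j \<ge> 0"
  using clip_mono x_nonneg by (simp add: bucket_share_def)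

lemma bucket_share_posD:
  assumes "bucket_share J v x k j > 0" "j \<in> J"
  shows "prefix_mass J v x j < real k + 1" "prefix_mass J v x j + x j > real k" "x j > 0"
  using assms x_nonneg[of j]
  by (auto simp: bucket_share_def clip_def max_def min_def split: if_splits)

lemma buckets_bucket_share: "buckets J v (bucket_share J v x) K"
proof
  show "(\<Sum>j\<in>J. bucket_share J v x k j) \<le> 1" for k
    by (simp add: sum_bucket_share clip_le_1)
  show "(\<Sum>j\<in>J. bucket_share J v x 0 j) = 1"
    using mass by (simp add: sum_bucket_share clip_def)
  show "bucket_share J v x k j = 0" if "j \<in> J" "K \<le> k" for k j
  proof (rule ccontr)
    assume "bucket_share J v x k j \<noteq> 0"
    then have "prefix_mass J v x j + x j > real k"
      using bucket_share_nonneg[of j k] bucket_share_posD[of k j] that by simp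
    then show False using prefix_mass_add_le[of j] mass(2) that by simp
  qed
  show "(\<Sum>j\<in>J. bucket_share J v x k j) = 1" if "j \<in> J" "bucket_share J v x (Suc k) j > 0" for k j
  proof -
    have "prefix_mass J v x j + x j > real (Suc k)" using bucket_share_posD that by blast
    then have "(\<Sum>j\<in>J. x j) > real (Suc k)" using prefix_mass_add_le[of j] that by simp
    then show ?thesis by (simp add: sum_bucket_share clip_def)
  qed
  show "v j' \<le> v j" if "k < l" "j \<in> J" "j' \<in> J"
    "bucket_share J v x k j > 0" "bucket_share J v x l j' > 0" for k l j j'
  proof (rule ccontr)
    assume "\<not> v j' \<le> v j"
    \<comment> \<open>The interval of \<open>j'\<close> would end before that of \<open>j\<close>
      starts, although \<open>j\<close> meets an earlier bucket than \<open>j'\<close> does.\<close>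
    then have "prefix_mass J v x j' + x j' \<le> prefix_mass J v x j"
      using that by (intro prefix_mass_mono) (auto simp: precedes_def)
    moreover have "prefix_mass J v x j < real k + 1" "prefix_mass J v x j' + x j' > real l"
      using bucket_share_posD that by blast+
    ultimately show False using \<open>k < l\<close> by simp
  qed
  show "v j > 0" if "j \<in> J" "bucket_share J v x k j > 0" for k j
    using bucket_share_posD(3)[OF that(2,1)] v_pos that by blast
qed (use fin bucket_share_nonneg in auto)

end

section \<open>Counting-loop programs\<close>

text \<open>The only loops are counting loops \<open>LFor a b p\<close>, with counter in cell \<open>a\<close> and bound in cell \<open>b\<close>, so
  that programs denote functions on memories and the running time is polynomial in the bounds. The
  bound is read once by \<open>den\<close> but at every iteration by the compiled loop; the two agree only if
  the body does not write \<open>b\<close>.\<close>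

datatype lprog = LSkip | LI nat iexp iexp iexp | LR nat iexp iexp rexp
  | LSeq lprog lprog | LIf bexp lprog lprog | LFor nat nat lprog

abbreviation iv :: "nat \<Rightarrow> iexp" where "iv a \<equiv> IGet a (INum 0) (INum 0)"
abbreviation LN :: "nat \<Rightarrow> iexp \<Rightarrow> lprog" where "LN a e \<equiv> LI a (INum 0) (INum 0) e"
abbreviation LX :: "nat \<Rightarrow> rexp \<Rightarrow> lprog" where "LX a p \<equiv> LR a (INum 0) (INum 0) p"
abbreviation rv :: "nat \<Rightarrow> rexp" where "rv a \<equiv> RGet a (INum 0) (INum 0)"

definition seti :: "nat \<Rightarrow> nat \<Rightarrow> memory \<Rightarrow> memory" where
  "seti a k s = (upd3 (fst s) a 0 0 k, snd s)"

primrec compile :: "lprog \<Rightarrow> com" where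
  "compile LSkip = Skip"
| "compile (LI a e f g) = ISet a e f g"
| "compile (LR a e f p) = RSet a e f p"
| "compile (LSeq p q) = Seq (compile p) (compile q)"
| "compile (LIf b p q) = Cond b (compile p) (compile q)"
| "compile (LFor a b p) = Seq (ISet a (INum 0) (INum 0) (INum 0))
     (While (ILess (iv a) (iv b)) (Seq (compile p) (ISet a (INum 0) (INum 0) (IAdd (iv a) (INum 1)))))"

primrec den :: "lprog \<Rightarrow> memory \<Rightarrow> memory" where
  "den LSkip s = s"
| "den (LI a e f g) s = (upd3 (fst s) a (ieval e s) (ieval f s) (ieval g s), snd s)"
| "den (LR a e f p) s = (fst s, upd3 (snd s) a (ieval e s) (ieval f s) (reval p s))"
| "den (LSeq p q) s = den q (den p s)"
| "den (LIf b p q) s = (if beval b s then den p s else den q s)"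
| "den (LFor a b p) s = rec_nat (seti a 0 s) (\<lambda>k s. seti a (Suc k) (den p s)) (fst s b 0 0)"

primrec iwrites :: "lprog \<Rightarrow> nat set" where
  "iwrites LSkip = {}"
| "iwrites (LI a e f g) = {a}"
| "iwrites (LR a e f p) = {}"
| "iwrites (LSeq p q) = iwrites p \<union> iwrites q"
| "iwrites (LIf b p q) = iwrites p \<union> iwrites q"
| "iwrites (LFor a b p) = insert a (iwrites p)"

primrec rwrites :: "lprog \<Rightarrow> nat set" where
  "rwrites LSkip = {}"
| "rwrites (LI a e f g) = {}"
| "rwrites (LR a e f p) = {a}"
| "rwrites (LSeq p q) = rwrites p \<union> rwrites q"
| "rwrites (LIf b p q) = rwrites p \<union> rwrites q"
| "rwrites (LFor a b p) = rwrites p"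

primrec bounds :: "lprog \<Rightarrow> nat set" where
  "bounds LSkip = {}"
| "bounds (LI a e f g) = {}"
| "bounds (LR a e f p) = {}"
| "bounds (LSeq p q) = bounds p \<union> bounds q"
| "bounds (LIf b p q) = bounds p \<union> bounds q"
| "bounds (LFor a b p) = insert b (bounds p)"

primrec counters_ok :: "lprog \<Rightarrow> bool" where
  "counters_ok LSkip = True"
| "counters_ok (LI a e f g) = True"
| "counters_ok (LR a e f p) = True"
| "counters_ok (LSeq p q) = (counters_ok p \<and> counters_ok q)"
| "counters_ok (LIf b p q) = (counters_ok p \<and> counters_ok q)"
| "counters_ok (LFor a b p) = (a \<notin> iwrites p \<and> counters_ok p)"

text \<open>The variable stands for a common bound on all loop bounds. A conditional is charged for
  both branches, which keeps the cost a polynomial. The constants of \<open>LFor\<close> are the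
  initialisation and the last test, and for each iteration a test and an increment.\<close>

primrec cost :: "lprog \<Rightarrow> nat poly" where
  "cost LSkip = 1"
| "cost (LI a e f g) = 1"
| "cost (LR a e f p) = 1"
| "cost (LSeq p q) = cost p + cost q"
| "cost (LIf b p q) = 1 + cost p + cost q"
| "cost (LFor a b p) = 2 + [:0, 1:] * (cost p + 2)"

definition INe :: "iexp \<Rightarrow> iexp \<Rightarrow> bexp" where
  "INe e f = BNot (BAnd (BNot (ILess e f)) (BNot (ILess f e)))"

lemma beval_INe [simp]: "beval (INe e f) s \<longleftrightarrow> ieval e s \<noteq> ieval f s"
  by (auto simp: INe_def)

lemma seti_simps [simp]:
  "snd (seti a k s) = snd s"
  "fst (seti a k s) a 0 0 = k"
  "b \<noteq> a \<Longrightarrow> fst (seti a k s) b = fst s b"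
  by (auto simp: seti_def upd3_def)

section \<open>Frame conditions, invariants and running time of counting loops\<close>

lemma den_frame_int: "a \<notin> iwrites p \<Longrightarrow> fst (den p s) a = fst s a"
proof (induction p arbitrary: s)
  case (LFor c b p)
  have "fst (rec_nat (seti c 0 s) (\<lambda>k s. seti c (Suc k) (den p s)) K) a = fst s a" for K
    using LFor by (induction K) auto
  then show ?case by simp
qed (auto simp: upd3_def)

lemma den_frame_real: "a \<notin> rwrites p \<Longrightarrow> snd (den p s) a = snd s a"
proof (induction p arbitrary: s)
  case (LFor c b p)
  have "snd (rec_nat (seti c 0 s) (\<lambda>k s. seti c (Suc k) (den p s)) K) a = snd s a" for K
    using LFor by (induction K) auto
  then show ?case by simp
qed (auto simp: upd3_def)

definition agree :: "nat set \<Rightarrow> nat set \<Rightarrow> memory \<Rightarrow> memory \<Rightarrow> bool" where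
  "agree I R s s' \<longleftrightarrow> (\<forall>a. a \<notin> I \<longrightarrow> fst s' a = fst s a) \<and> (\<forall>a. a \<notin> R \<longrightarrow> snd s' a = snd s a)"

lemma agreeD:
  "agree I R s s' \<Longrightarrow> a \<notin> I \<Longrightarrow> fst s' a = fst s a"
  "agree I R s s' \<Longrightarrow> a \<notin> R \<Longrightarrow> snd s' a = snd s a"
  by (auto simp: agree_def)

text \<open>The step premise supplies the value of the counter and the agreement with the initial
  state outside the arrays written by the loop, so an invariant needs to speak only about arrays
  that change.\<close>

lemma den_for:
  assumes "I 0 (seti a 0 s0)"
    and "\<And>k s. k < K \<Longrightarrow> fst s a 0 0 = k \<Longrightarrow> agree (insert a (iwrites p)) (rwrites p) s0 s \<Longrightarrow>
           I k s \<Longrightarrow> I (Suc k) (seti a (Suc k) (den p s))"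
    and "fst s0 b 0 0 = K"
  shows "I K (den (LFor a b p) s0)"
proof -
  let ?r = "rec_nat (seti a 0 s0) (\<lambda>k s. seti a (Suc k) (den p s))"
  have "k \<le> K \<Longrightarrow> I k (?r k) \<and> fst (?r k) a 0 0 = k \<and>
      agree (insert a (iwrites p)) (rwrites p) s0 (?r k)" for k
  proof (induction k)
    case 0
    then show ?case using assms(1) by (simp add: agree_def)
  next
    case (Suc k)
    then have IH: "I k (?r k)" "fst (?r k) a 0 0 = k"
      "agree (insert a (iwrites p)) (rwrites p) s0 (?r k)" by auto
    from assms(2)[OF _ IH(2,3,1)] Suc.prems have "I (Suc k) (?r (Suc k))" by simp
    moreover have "agree (insert a (iwrites p)) (rwrites p) s0 (?r (Suc k))"
      using IH(3) by (auto simp: agree_def den_frame_int den_frame_real)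
    ultimately show ?case by simp
  qed
  from this[of K] show ?thesis using assms(3) by simp
qed

text \<open>Indexing the invariant by the set of visited pairs instead of two counters treats sums
  and pointwise statements over a matrix in one form. The invariant must ignore the counters, which
  also change outside the body.\<close>

lemma den_for_pairs:
  assumes init: "J {} s0"
    and inv: "\<And>S x s. J S (seti a x s) = J S s" "\<And>S x s. J S (seti c x s) = J S s"
    and step: "\<And>k l S s. k < K \<Longrightarrow> l < L \<Longrightarrow> fst s a 0 0 = k \<Longrightarrow> fst s c 0 0 = l \<Longrightarrow>
      agree (insert a (insert c (iwrites p))) (rwrites p) s0 s \<Longrightarrow>
      S \<subseteq> {..<K} \<times> {..<L} \<Longrightarrow> (k, l) \<notin> S \<Longrightarrow> J S s \<Longrightarrow> J (insert (k, l) S) (den p s)"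
    and K: "fst s0 b 0 0 = K" and L: "fst s0 d 0 0 = L"
    and d: "d \<notin> insert a (insert c (iwrites p))" and a: "a \<notin> insert c (iwrites p)"
  shows "J ({..<K} \<times> {..<L}) (den (LFor a b (LFor c d p)) s0)"
proof (rule den_for[where I = "\<lambda>k s. J ({..<k} \<times> {..<L}) s", OF _ _ K])
  show "J ({..<0} \<times> {..<L}) (seti a 0 s0)" using init inv(1) by simp
next
  fix k s
  assume k: "k < K" "fst s a 0 0 = k" "J ({..<k} \<times> {..<L}) s"
    and ag: "agree (insert a (iwrites (LFor c d p))) (rwrites (LFor c d p)) s0 s"
  have "J ({..<k} \<times> {..<L} \<union> {k} \<times> {..<L}) (den (LFor c d p) s)"
  proof (rule den_for[where I = "\<lambda>l s. J ({..<k} \<times> {..<L} \<union> {k} \<times> {..<l}) s"])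
    show "J ({..<k} \<times> {..<L} \<union> {k} \<times> {..<0}) (seti c 0 s)" using k inv(2) by simp
    show "fst s d 0 0 = L" using agreeD(1)[OF ag, of d] d L by simp
  next
    fix l s1
    assume l: "l < L" "fst s1 c 0 0 = l" "J ({..<k} \<times> {..<L} \<union> {k} \<times> {..<l}) s1"
      and ag1: "agree (insert c (iwrites p)) (rwrites p) s s1"
    have "fst s1 a = fst s a" using agreeD(1)[OF ag1 a] .
    moreover have "agree (insert a (insert c (iwrites p))) (rwrites p) s0 s1"
      using ag ag1 by (auto simp: agree_def)
    ultimately have "J (insert (k, l) ({..<k} \<times> {..<L} \<union> {k} \<times> {..<l})) (den p s1)"
      using k l by (intro step) auto
    also have "insert (k, l) ({..<k} \<times> {..<L} \<union> {k} \<times> {..<l}) = {..<k} \<times> {..<L} \<union> {k} \<times> {..<Suc l}"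
      by auto
    finally show "J ({..<k} \<times> {..<L} \<union> {k} \<times> {..<Suc l}) (seti c (Suc l) (den p s1))"
      using inv(2) by simp
  qed
  also have "{..<k} \<times> {..<L} \<union> {k} \<times> {..<L} = {..<Suc k} \<times> {..<L}" by auto
  finally show "J ({..<Suc k} \<times> {..<L}) (seti a (Suc k) (den (LFor c d p) s))"
    using inv(1) by simp
qed

text \<open>Disjointness of bounds and written arrays keeps the bounding cells fixed. Hence the
  bound read once by \<open>den\<close> is the one tested at every iteration, and \<open>B\<close>
  remains valid in all intermediate states.\<close>

lemma runs_compile:
  assumes "counters_ok p" "bounds p \<inter> iwrites p = {}" "\<And>b. b \<in> bounds p \<Longrightarrow> fst s b 0 0 \<le> B"
  shows "\<exists>t \<le> poly (cost p) B. runs (compile p) s t (den p s)"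
  using assms
proof (induction p arbitrary: s)
  case (LSeq p q)
  have "\<exists>t\<le>poly (cost p) B. runs (compile p) s t (den p s)"
    using LSeq.prems by (intro LSeq.IH(1)) auto
  moreover have "\<exists>t\<le>poly (cost q) B. runs (compile q) (den p s) t (den q (den p s))"
  proof (intro LSeq.IH(2))
    fix b assume b: "b \<in> bounds q"
    then have "b \<notin> iwrites p" using LSeq.prems(2) by auto
    with b LSeq.prems(3) show "fst (den p s) b 0 0 \<le> B" by (simp add: den_frame_int)
  qed (use LSeq.prems in auto)
  ultimately obtain t1 t2 where t: "t1 \<le> poly (cost p) B" "runs (compile p) s t1 (den p s)"
    "t2 \<le> poly (cost q) B" "runs (compile q) (den p s) t2 (den q (den p s))" by blast
  have "runs (compile (LSeq p q)) s (t1 + t2) (den (LSeq p q) s)"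
    using runs.Seq[OF t(2) t(4)] by simp
  moreover have "t1 + t2 \<le> poly (cost (LSeq p q)) B" using t by simp
  ultimately show ?case by blast
next
  case (LIf b p q)
  show ?case
  proof (cases "beval b s")
    case True
    have "\<exists>t\<le>poly (cost p) B. runs (compile p) s t (den p s)"
      using LIf.prems by (intro LIf.IH(1)) auto
    then obtain t where t: "t \<le> poly (cost p) B" "runs (compile p) s t (den p s)" by blast
    have "runs (compile (LIf b p q)) s (Suc t) (den (LIf b p q) s)"
      using runs.CondTrue[OF True t(2)] True by simp
    moreover have "Suc t \<le> poly (cost (LIf b p q)) B" using t by simp
    ultimately show ?thesis by blast
  next
    case False
    have "\<exists>t\<le>poly (cost q) B. runs (compile q) s t (den q s)"
      using LIf.prems by (intro LIf.IH(2)) auto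
    then obtain t where t: "t \<le> poly (cost q) B" "runs (compile q) s t (den q s)" by blast
    have "runs (compile (LIf b p q)) s (Suc t) (den (LIf b p q) s)"
      using runs.CondFalse[OF False t(2)] False by simp
    moreover have "Suc t \<le> poly (cost (LIf b p q)) B" using t by simp
    ultimately show ?thesis by blast
  qed
next
  case (LFor a b p)
  define K where "K = fst s b 0 0"
  let ?body = "Seq (compile p) (ISet a (INum 0) (INum 0) (IAdd (iv a) (INum 1)))"
  define r where "r = rec_nat (seti a 0 s) (\<lambda>k s. seti a (Suc k) (den p s))"
  have r0: "r 0 = seti a 0 s" and rSuc: "r (Suc k) = seti a (Suc k) (den p (r k))" for k
    by (simp_all add: r_def)
  from LFor.prems have ab: "a \<noteq> b" "a \<notin> iwrites p" "b \<notin> iwrites p" "counters_ok p" by auto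
  have fr: "fst (r k) c = fst s c" if "c \<noteq> a" "c \<notin> iwrites p" for c k
    using that by (induction k) (auto simp: den_frame_int r0 rSuc)
  have va: "fst (r k) a 0 0 = k" for k
    by (cases k) (auto simp: r0 rSuc)
  have step: "\<exists>t \<le> poly (cost p) B + 1. runs ?body (r k) t (r (Suc k))" for k
  proof -
    have "\<exists>t\<le>poly (cost p) B. runs (compile p) (r k) t (den p (r k))"
    proof (intro LFor.IH)
      fix c assume c: "c \<in> bounds p"
      then have "c \<noteq> a" "c \<notin> iwrites p" using LFor.prems(2) by auto
      with fr[OF this, of k] LFor.prems(3)[of c] c show "fst (r k) c 0 0 \<le> B" by simp
    qed (use LFor.prems in auto)
    then obtain t where t: "t \<le> poly (cost p) B" "runs (compile p) (r k) t (den p (r k))" by blast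
    have "runs (ISet a (INum 0) (INum 0) (IAdd (iv a) (INum 1))) (den p (r k)) 1 (r (Suc k))"
      using runs.ISet[of a "INum 0" "INum 0" "IAdd (iv a) (INum 1)" "den p (r k)"] va[of k] ab
      by (simp add: seti_def den_frame_int rSuc)
    from runs.Seq[OF t(2) this] t(1) show ?thesis by (metis add_le_cancel_right)
  qed
  \<comment> \<open>Induction on the number of remaining iterations, since the rules for
    \<open>While\<close> peel off the first one.\<close>
  have loop: "\<exists>t \<le> d * (poly (cost p) B + 2) + 1.
      runs (While (ILess (iv a) (iv b)) ?body) (r (K - d)) t (r K)" if "d \<le> K" for d
    using that
  proof (induction d)
    case 0
    have "\<not> beval (ILess (iv a) (iv b)) (r K)" using va[of K] fr[of b K] ab by (simp flip: K_def)
    from runs.WhileFalse[OF this] show ?case by (intro exI[of _ 1]) simp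
  next
    case (Suc d)
    have "beval (ILess (iv a) (iv b)) (r (K - Suc d))"
      using va[of "K - Suc d"] fr[of b "K - Suc d"] ab Suc.prems by (simp flip: K_def)
    moreover obtain t1 where t1: "t1 \<le> poly (cost p) B + 1"
      "runs ?body (r (K - Suc d)) t1 (r (K - d))"
      using step[of "K - Suc d"] Suc.prems by (metis Suc_diff_Suc Suc_le_lessD)
    moreover obtain t2 where t2: "t2 \<le> d * (poly (cost p) B + 2) + 1"
      "runs (While (ILess (iv a) (iv b)) ?body) (r (K - d)) t2 (r K)"
      using Suc by auto
    ultimately have "runs (While (ILess (iv a) (iv b)) ?body) (r (K - Suc d)) (Suc (t1 + t2)) (r K)"
      by (blast intro: runs.WhileTrue)
    moreover have "Suc (t1 + t2) \<le> Suc d * (poly (cost p) B + 2) + 1" using t1 t2 by simp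
    ultimately show ?case by blast
  qed
  from loop[of K] obtain t where t: "t \<le> K * (poly (cost p) B + 2) + 1"
    "runs (While (ILess (iv a) (iv b)) ?body) (seti a 0 s) t (r K)" by (auto simp: r0)
  have "runs (ISet a (INum 0) (INum 0) (INum 0)) s 1 (seti a 0 s)"
    using runs.ISet[of a "INum 0" "INum 0" "INum 0" s] by (simp add: seti_def)
  from runs.Seq[OF this t(2)] have "runs (compile (LFor a b p)) s (1 + t) (den (LFor a b p) s)"
    by (simp add: K_def r_def)
  moreover have "1 + t \<le> poly (cost (LFor a b p)) B"
  proof -
    have "K \<le> B" using LFor.prems(3)[of b] by (simp add: K_def)
    then have "K * (poly (cost p) B + 2) \<le> B * (poly (cost p) B + 2)" by (rule mult_le_mono1)
    with t(1) show ?thesis by simp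
  qed
  ultimately show ?case by blast
next
  case LSkip
  show ?case using runs.Skip by (intro exI[of _ 1]) simp
next
  case (LI a e f g)
  show ?case using runs.ISet[of a e f g s] by (intro exI[of _ 1]) simp
next
  case (LR a e f p)
  show ?case using runs.RSet[of a e f p s] by (intro exI[of _ 1]) simp
qed

section \<open>Cycle cancelling\<close>

definition fractional :: "real \<Rightarrow> bool" where
  "fractional y \<longleftrightarrow> 0 < y \<and> y < 1"

lemma fractional_iff:
  assumes "0 \<le> y" "y \<le> 1"
  shows "fractional y \<longleftrightarrow> y \<notin> \<int>"
proof
  show "fractional y \<Longrightarrow> y \<notin> \<int>" by (auto simp: fractional_def elim!: Ints_cases)
  show "y \<notin> \<int> \<Longrightarrow> fractional y"
    using assms by (cases "y = 0"; cases "y = 1") (auto simp: fractional_def)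
qed

text \<open>A sum with exactly one non-integral term is not an integer. This is what keeps a walk
  through fractional entries from getting stuck.\<close>

lemma other_fractional:
  assumes "finite A" "(\<Sum>i\<in>A. f i) \<in> \<int>" "\<And>i. i \<in> A \<Longrightarrow> 0 \<le> f i \<and> f i \<le> 1"
    and "i \<in> A" "fractional (f i)"
  shows "\<exists>i'\<in>A. i' \<noteq> i \<and> fractional (f i')"
proof (rule ccontr)
  assume none: "\<not> ?thesis"
  have "f i' \<in> \<int>" if "i' \<in> A - {i}" for i'
    using that assms(3)[of i'] fractional_iff[of "f i'"] none by blast
  then have "(\<Sum>i'\<in>A - {i}. f i') \<in> \<int>" by (rule Ints_sum)
  moreover have "f i = (\<Sum>i\<in>A. f i) - (\<Sum>i'\<in>A - {i}. f i')"
    using assms(1,4) by (simp add: sum.remove)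
  ultimately have "f i \<in> \<int>" using assms(2) by (metis Ints_diff)
  then show False using assms fractional_iff by blast
qed

definition int_margins :: "nat \<Rightarrow> nat \<Rightarrow> (nat \<Rightarrow> nat \<Rightarrow> real) \<Rightarrow> bool" where
  "int_margins p q Y \<longleftrightarrow> (\<forall>b<p. \<forall>j<q. 0 \<le> Y b j \<and> Y b j \<le> 1) \<and>
     (\<forall>b<p. (\<Sum>j<q. Y b j) \<in> \<int>) \<and> (\<forall>j<q. (\<Sum>b<p. Y b j) \<in> \<int>)"

definition fracs :: "nat \<Rightarrow> nat \<Rightarrow> (nat \<Rightarrow> nat \<Rightarrow> real) \<Rightarrow> (nat \<times> nat) set" where
  "fracs p q Y = {(b, j). b < p \<and> j < q \<and> fractional (Y b j)}"

lemma finite_fracs: "finite (fracs p q Y)"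
  by (rule finite_subset[of _ "{..<p} \<times> {..<q}"]) (auto simp: fracs_def)

lemma card_fracs_le: "card (fracs p q Y) \<le> p * q"
  using card_mono[of "{..<p} \<times> {..<q}" "fracs p q Y"] by (auto simp: fracs_def)

lemma other_fractional_in_row:
  assumes "int_margins p q Y" "b < p" "j < q" "fractional (Y b j)"
  shows "\<exists>j'<q. j' \<noteq> j \<and> fractional (Y b j')"
  using assms other_fractional[of "{..<q}" "Y b" j] by (auto simp: int_margins_def)

lemma other_fractional_in_column:
  assumes "int_margins p q Y" "b < p" "j < q" "fractional (Y b j)"
  shows "\<exists>b'<p. b' \<noteq> b \<and> fractional (Y b' j)"
  using assms other_fractional[of "{..<p}" "\<lambda>b. Y b j" b] by (auto simp: int_margins_def)

definition zero_margins :: "nat \<Rightarrow> nat \<Rightarrow> (nat \<Rightarrow> nat \<Rightarrow> real) \<Rightarrow> bool" where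
  "zero_margins p q G \<longleftrightarrow> (\<forall>b<p. (\<Sum>j<q. G b j) = 0) \<and> (\<forall>j<q. (\<Sum>b<p. G b j) = 0)"

text \<open>A walk alternates between moves within row \<open>R i\<close> to column \<open>C i\<close> and within this column to row
  \<open>R (Suc i)\<close>. Only the rows are required to be distinct: if a column repeats, the circulation
  along the closed part is still nonzero and has zero margins.\<close>

definition walk :: "nat \<Rightarrow> nat \<Rightarrow> (nat \<Rightarrow> nat \<Rightarrow> real) \<Rightarrow> (nat \<Rightarrow> nat) \<Rightarrow> (nat \<Rightarrow> nat) \<Rightarrow> nat \<Rightarrow> bool" where
  "walk p q Y R C t \<longleftrightarrow> (\<forall>i\<le>t. R i < p) \<and>
     (\<forall>i<t. C i < q \<and> fractional (Y (R i) (C i)) \<and> fractional (Y (R (Suc i)) (C i)) \<and> R (Suc i) \<noteq> R i) \<and>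
     (\<forall>i. Suc i < t \<longrightarrow> C (Suc i) \<noteq> C i) \<and> inj_on R {..<t}"

text \<open>Sign \<open>+ 1\<close> where a row is left and \<open>- 1\<close> where the next row is
  entered through the same column. If the first and the last column of the closed part coincide, the
  two contributions in the closing row cancel.\<close>

definition circulation :: "(nat \<Rightarrow> nat) \<Rightarrow> (nat \<Rightarrow> nat) \<Rightarrow> nat \<Rightarrow> nat \<Rightarrow> nat \<Rightarrow> nat \<Rightarrow> real" where
  "circulation R C a t b j = (\<Sum>i\<in>{a..<t}. of_bool (R i = b \<and> C i = j) - of_bool (R (Suc i) = b \<and> C i = j))"

lemma circulation_support:
  assumes "walk p q Y R C t" "circulation R C a t b j \<noteq> 0"
  shows "b < p" "j < q" "fractional (Y b j)"
proof -
  from assms(2) obtain i where i: "i \<in> {a..<t}"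
    "of_bool (R i = b \<and> C i = j) - of_bool (R (Suc i) = b \<and> C i = j) \<noteq> (0::real)"
    unfolding circulation_def by (rule sum.not_neutral_contains_not_neutral)
  then have "i < t" "(R i = b \<or> R (Suc i) = b) \<and> C i = j" by (auto simp: of_bool_def split: if_splits)
  with assms(1) show "b < p" "j < q" "fractional (Y b j)"
    unfolding walk_def by (auto simp: Suc_le_eq)
qed

text \<open>In a column both signs of a step appear together. In a row the contributions telescope
  to those of \<open>R a\<close> and \<open>R t\<close>, which agree.\<close>

lemma zero_margins_circulation:
  assumes "walk p q Y R C t" "a \<le> t" "R t = R a"
  shows "zero_margins p q (circulation R C a t)"
proof -
  have "(\<Sum>j<q. circulation R C a t b j) = 0" for b
  proof -
    have "(\<Sum>j<q. circulation R C a t b j) =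
        (\<Sum>i\<in>{a..<t}. \<Sum>j<q. of_bool (R i = b \<and> C i = j) - of_bool (R (Suc i) = b \<and> C i = j))"
      unfolding circulation_def by (rule sum.swap)
    also have "\<dots> = (\<Sum>i\<in>{a..<t}. of_bool (R i = b) - of_bool (R (Suc i) = b))"
    proof (intro sum.cong refl)
      fix i assume "i \<in> {a..<t}"
      then have "C i < q" using assms(1) by (simp add: walk_def)
      then have "(\<Sum>j<q. of_bool (P \<and> C i = j)) = (of_bool P :: real)" for P
        using sum.delta'[of "{..<q}" "C i" "\<lambda>_. 1::real"] by (cases P) (simp_all add: of_bool_def)
      then show "(\<Sum>j<q. of_bool (R i = b \<and> C i = j) - of_bool (R (Suc i) = b \<and> C i = j))
          = (of_bool (R i = b) - of_bool (R (Suc i) = b) :: real)"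
        unfolding sum_subtractf by (simp only:)
    qed
    also have "\<dots> = of_bool (R a = b) - of_bool (R t = b)"
      using sum_Suc_diff'[OF assms(2), of "\<lambda>i. - (of_bool (R i = b) :: real)"] by simp
    finally show ?thesis using assms(3) by simp
  qed
  moreover have "(\<Sum>b<p. circulation R C a t b j) = 0" for j
  proof -
    have "(\<Sum>b<p. circulation R C a t b j) =
        (\<Sum>i\<in>{a..<t}. \<Sum>b<p. of_bool (R i = b \<and> C i = j) - of_bool (R (Suc i) = b \<and> C i = j))"
      unfolding circulation_def by (rule sum.swap)
    also have "\<dots> = 0"
    proof (rule sum.neutral, rule ballI)
      fix i assume "i \<in> {a..<t}"
      then have "R i < p" "R (Suc i) < p" using assms(1) by (auto simp: walk_def)
      then have "(\<Sum>b<p. of_bool (R i' = b \<and> P)) = (of_bool P :: real)" if "i' \<in> {i, Suc i}" for P i'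
        using that sum.delta'[of "{..<p}" "R i'" "\<lambda>_. 1::real"] by (cases P) (auto simp: of_bool_def)
      then show "(\<Sum>b<p. of_bool (R i = b \<and> C i = j) - of_bool (R (Suc i) = b \<and> C i = j)) = (0::real)"
        unfolding sum_subtractf by (simp only: insert_iff simp_thms diff_self)
    qed
    finally show ?thesis .
  qed
  ultimately show ?thesis by (simp add: zero_margins_def)
qed

text \<open>The last row before the walk closes is visited only once and is entered and left through
  different columns, so nothing cancels there. This entry certifies that the circulation is
  nonzero.\<close>

lemma circulation_last:
  assumes "walk p q Y R C t" "a < t" "R t = R a"
  shows "circulation R C a t (R (t - 1)) (C (t - 1)) = 1"
proof -
  obtain l where l: "t = Suc l" using assms(2) by (cases t) auto
  have inj: "R i = R l \<longleftrightarrow> i = l" if "i < t" for i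
    using assms(1) that l by (auto simp: walk_def inj_on_def)
  have "R t \<noteq> R l" using assms(1) l by (auto simp: walk_def)
  then have "a \<noteq> l" using assms(3) by auto
  have "(\<Sum>i\<in>{a..<t}. of_bool (R i = R l \<and> C i = C l) - of_bool (R (Suc i) = R l \<and> C i = C l))
    = (\<Sum>i\<in>{a..<t}. of_bool (i = l) :: real)"
  proof (intro sum.cong refl)
    fix i assume i: "i \<in> {a..<t}"
    have "\<not> (R (Suc i) = R l \<and> C i = C l)"
    proof (cases "i = l")
      case False
      then have "Suc i < t" using i l by auto
      moreover have "Suc i < t \<Longrightarrow> C (Suc i) \<noteq> C i" using assms(1) by (simp add: walk_def)
      ultimately show ?thesis using inj[of "Suc i"] by auto
    qed (use \<open>R t \<noteq> R l\<close> l in auto)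
    then show "of_bool (R i = R l \<and> C i = C l) - of_bool (R (Suc i) = R l \<and> C i = C l) = (of_bool (i = l) :: real)"
      using inj[of i] i by auto
  qed
  also have "\<dots> = 1" using assms(2) l by (auto simp: of_bool_def)
  finally show ?thesis by (simp add: circulation_def l)
qed

lemma add_zero_margins:
  assumes "zero_margins p q G"
  shows "b < p \<Longrightarrow> (\<Sum>j<q. Y b j + e * G b j) = (\<Sum>j<q. Y b j)"
    and "j < q \<Longrightarrow> (\<Sum>b<p. Y b j + e * G b j) = (\<Sum>b<p. Y b j)"
proof -
  have *: "(\<Sum>i\<in>A. f i + e * g i) = (\<Sum>i\<in>A. f i) + e * (\<Sum>i\<in>A. g i)" for A :: "nat set" and f g :: "nat \<Rightarrow> real"
    by (simp add: sum.distrib sum_distrib_left)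
  show "b < p \<Longrightarrow> (\<Sum>j<q. Y b j + e * G b j) = (\<Sum>j<q. Y b j)"
    and "j < q \<Longrightarrow> (\<Sum>b<p. Y b j + e * G b j) = (\<Sum>b<p. Y b j)"
    using assms unfolding * by (simp_all add: zero_margins_def)
qed

text \<open>The change is confined to fractional entries, so no integral entry becomes fractional
  again and the number of fractional entries measures progress.\<close>

lemma fracs_add_psubset:
  assumes "\<And>b j. b < p \<Longrightarrow> j < q \<Longrightarrow> G b j \<noteq> 0 \<Longrightarrow> fractional (Y b j)"
    and "b0 < p" "j0 < q" "fractional (Y b0 j0)" "\<not> fractional (Y b0 j0 + e * G b0 j0)"
  shows "card (fracs p q (\<lambda>b j. Y b j + e * G b j)) < card (fracs p q Y)"
proof (rule psubset_card_mono[OF finite_fracs])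
  have "fracs p q (\<lambda>b j. Y b j + e * G b j) \<subseteq> fracs p q Y"
  proof clarify
    fix b j assume "(b, j) \<in> fracs p q (\<lambda>b j. Y b j + e * G b j)"
    then show "(b, j) \<in> fracs p q Y"
      using assms(1)[of b j] by (cases "G b j = 0") (auto simp: fracs_def)
  qed
  moreover have "(b0, j0) \<in> fracs p q Y" "(b0, j0) \<notin> fracs p q (\<lambda>b j. Y b j + e * G b j)"
    using assms by (auto simp: fracs_def)
  ultimately show "fracs p q (\<lambda>b j. Y b j + e * G b j) \<subset> fracs p q Y" by blast
qed

lemma circulation_Suc:
  "a \<le> t \<Longrightarrow> circulation R C a (Suc t) b j =
    circulation R C a t b j + of_bool (R t = b \<and> C t = j) - of_bool (R (Suc t) = b \<and> C t = j)"
  by (simp add: circulation_def)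

lemma circulation_empty: "t \<le> a \<Longrightarrow> circulation R C a t b j = 0"
  by (simp add: circulation_def)

lemma walk_length_le:
  assumes "walk p q Y R C t"
  shows "t \<le> p"
proof -
  have "card {..<t} \<le> card {..<p}"
    using assms by (intro card_inj_on_le[of R]) (auto simp: walk_def)
  then show ?thesis by simp
qed

text \<open>\<open>c\<close> is the column through which the current row was entered, or that of the
  starting entry if \<open>t = 0\<close>; the next column has to differ from it. \<open>pos\<close>
  is one plus the inverse of \<open>R\<close> on the rows already left, so the current row
  \<open>R t\<close> is not yet recorded.\<close>

definition open_walk where
  "open_walk p q Y R C t c pos \<longleftrightarrow> walk p q Y R C t \<and> inj_on R {..t} \<and> c < q \<and> fractional (Y (R t) c) \<and>
     (\<forall>i. Suc i = t \<longrightarrow> C i = c) \<and> (\<forall>i<t. pos (R i) = Suc i) \<and>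
     (\<forall>b<p. pos b > 0 \<longrightarrow> pos b \<le> t \<and> R (pos b - 1) = b)"

lemma open_walk_0:
  assumes "R 0 < p" "c < q" "fractional (Y (R 0) c)" "\<And>b. b < p \<Longrightarrow> pos b = 0"
  shows "open_walk p q Y R C 0 c pos"
  using assms by (auto simp: open_walk_def walk_def)

lemma open_walk_length_less:
  assumes "open_walk p q Y R C t c pos"
  shows "t < p"
proof -
  have "card {..t} \<le> card {..<p}"
    using assms by (intro card_inj_on_le[of R]) (auto simp: open_walk_def walk_def)
  then show ?thesis by simp
qed

context
  fixes p q t c c' r' :: nat and Y and R C pos R' C' pos' :: "nat \<Rightarrow> nat"
  assumes ow: "open_walk p q Y R C t c pos"
    and c': "c' < q" "c' \<noteq> c" "fractional (Y (R t) c')"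
    and r': "r' < p" "r' \<noteq> R t" "fractional (Y r' c')"
  defines "R' \<equiv> R(Suc t := r')" and "C' \<equiv> C(t := c')" and "pos' \<equiv> pos(R t := Suc t)"
begin

lemma walk_extend: "walk p q Y R' C' (Suc t)"
proof -
  have "inj_on R' {..<Suc t}"
    using ow by (auto simp: open_walk_def R'_def inj_on_def)
  then show ?thesis
    using ow c' r' by (auto simp: open_walk_def walk_def R'_def C'_def less_Suc_eq le_Suc_eq)
qed

text \<open>The new row differs from the current one, so a positive record for it stems from an
  earlier position on the walk.\<close>

lemma walk_close: "pos' r' > 0 \<Longrightarrow> pos' r' - 1 < Suc t \<and> R' (pos' r' - 1) = R' (Suc t)"
proof -
  assume "pos' r' > 0"
  then have "pos r' > 0" using r' by (simp add: pos'_def)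
  then have "pos r' \<le> t" "R (pos r' - 1) = r'" using ow r' by (auto simp: open_walk_def)
  with \<open>pos r' > 0\<close> show ?thesis using r' by (auto simp: pos'_def R'_def)
qed

lemma open_walk_extend:
  assumes "pos' r' = 0"
  shows "open_walk p q Y R' C' (Suc t) c' pos'"
proof -
  have inj: "inj_on R {..t}" and pos: "\<forall>i<t. pos (R i) = Suc i"
    using ow by (auto simp: open_walk_def)
  have pos'_R: "pos' (R i) = Suc i" if "i \<le> t" for i
  proof (cases "i = t")
    case False
    then have "R i \<noteq> R t" using inj that by (auto simp: inj_on_def)
    then show ?thesis using pos that False by (simp add: pos'_def)
  qed (simp add: pos'_def)
  then have fresh: "R i \<noteq> r'" if "i \<le> t" for i using assms that by force
  then have notin: "r' \<notin> R ` {..t}" by auto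
  moreover have "R' ` {..t} = R ` {..t}" by (intro image_cong) (auto simp: R'_def)
  ultimately have "inj_on R' {..Suc t}"
    using inj_on_fun_updI[OF inj notin] by (simp add: atMost_Suc R'_def)
  moreover have "\<forall>i<Suc t. pos' (R' i) = Suc i" using pos'_R by (auto simp: R'_def)
  moreover have "\<forall>b<p. pos' b > 0 \<longrightarrow> pos' b \<le> Suc t \<and> R' (pos' b - 1) = b"
  proof (intro allI impI)
    fix b assume b: "b < p" "pos' b > 0"
    show "pos' b \<le> Suc t \<and> R' (pos' b - 1) = b"
    proof (cases "b = R t")
      case False
      then have "pos b > 0" "pos' b = pos b" using b by (auto simp: pos'_def)
      moreover from this ow b(1) have "pos b \<le> t" "R (pos b - 1) = b" by (auto simp: open_walk_def)
      ultimately show ?thesis by (auto simp: R'_def)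
    qed (simp add: pos'_def R'_def)
  qed
  ultimately show ?thesis
    using walk_extend c' r' unfolding open_walk_def by (auto simp: R'_def C'_def)
qed

end

text \<open>The largest step that keeps an entry in the unit interval. An entry with
  \<open>d = 0\<close> imposes no limit; its default 1 is harmless because the minimum computed by
  the program starts at 1 as well.\<close>

definition step_cap :: "real \<Rightarrow> real \<Rightarrow> real" where
  "step_cap y d = (if d > 0 then (1 - y) / d else if d < 0 then y / (- d) else 1)"

lemma step_cap_pos: "d = 0 \<or> fractional y \<Longrightarrow> step_cap y d > 0"
  by (auto simp: step_cap_def fractional_def divide_pos_neg)

lemma step_within_cap:
  assumes "0 \<le> y" "y \<le> 1" "0 \<le> e" "e \<le> step_cap y d"
  shows "0 \<le> y + e * d" "y + e * d \<le> 1"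
proof -
  consider "d = 0" | "d > 0" | "d < 0" by linarith
  then have "0 \<le> y + e * d \<and> y + e * d \<le> 1"
  proof cases
    case 2
    then have "e * d \<le> 1 - y" using assms by (simp add: step_cap_def field_simps)
    moreover have "e * d \<ge> 0" using 2 assms by simp
    ultimately show ?thesis using assms by linarith
  next
    case 3
    then have "e * d \<ge> - y" using assms by (simp add: step_cap_def field_simps)
    moreover have "e * d \<le> 0" using 3 assms by (simp add: mult_nonneg_nonpos)
    ultimately show ?thesis using assms by linarith
  qed (use assms in auto)
  then show "0 \<le> y + e * d" "y + e * d \<le> 1" by auto
qed

lemma step_at_cap: "d \<noteq> 0 \<Longrightarrow> \<not> fractional (y + step_cap y d * d)"
  by (auto simp: step_cap_def fractional_def)

text \<open>A reflexive and transitive relation, hence suited as a loop invariant. Preserving zeros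
  confines items to buckets in which they have a share and keeps the slack of a full bucket at
  0.\<close>

definition rounding_progress ::
  "nat \<Rightarrow> nat \<Rightarrow> (nat \<Rightarrow> nat \<Rightarrow> real) \<Rightarrow> (nat \<Rightarrow> nat \<Rightarrow> real) \<Rightarrow> (nat \<Rightarrow> nat \<Rightarrow> real) \<Rightarrow> bool" where
  "rounding_progress p q W Y Y' \<longleftrightarrow> int_margins p q Y' \<and>
     (\<forall>b<p. (\<Sum>j<q. Y' b j) = (\<Sum>j<q. Y b j)) \<and> (\<forall>j<q. (\<Sum>b<p. Y' b j) = (\<Sum>b<p. Y b j)) \<and>
     (\<forall>b<p. \<forall>j<q. Y b j = 0 \<longrightarrow> Y' b j = 0) \<and>
     (\<Sum>b<p. \<Sum>j<q. W b j * Y b j) \<le> (\<Sum>b<p. \<Sum>j<q. W b j * Y' b j)"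

lemma rounding_progress_refl: "int_margins p q Y \<Longrightarrow> rounding_progress p q W Y Y"
  by (simp add: rounding_progress_def)

lemma rounding_progress_trans:
  "rounding_progress p q W X Y \<Longrightarrow> rounding_progress p q W Y Z \<Longrightarrow> rounding_progress p q W X Z"
  by (auto simp: rounding_progress_def)

text \<open>\<open>sg\<close> is a direction in which the objective does not fall, and
  \<open>e\<close> a minimum of caps. The alternative \<open>e = 1\<close> mirrors the start value
  of this minimum. Since some entry of the circulation is 1 or -1 in absolute terms and sits at a
  fractional entry, its cap is below 1, so the minimum is attained at an entry that really
  moves.\<close>

lemma cancel_circulation:
  assumes Y: "int_margins p q Y" and w: "walk p q Y R C t" "a < t" "R t = R a"
    and sg: "sg \<noteq> 0" "sg * (\<Sum>b<p. \<Sum>j<q. W b j * circulation R C a t b j) \<ge> 0"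
    and e_le: "\<And>b j. b < p \<Longrightarrow> j < q \<Longrightarrow> e \<le> step_cap (Y b j) (sg * circulation R C a t b j)"
    and e_cases: "e = 1 \<or> (\<exists>b<p. \<exists>j<q. e = step_cap (Y b j) (sg * circulation R C a t b j))"
    and sg_abs: "\<bar>sg\<bar> = 1"
  defines "Y' \<equiv> \<lambda>b j. Y b j + e * (sg * circulation R C a t b j)"
  shows "rounding_progress p q W Y Y'" "card (fracs p q Y') < card (fracs p q Y)"
proof -
  define G where "G = (\<lambda>b j. sg * circulation R C a t b j)"
  have zm: "zero_margins p q G"
    using zero_margins_circulation[OF w(1) _ w(3)] w(2)
    by (simp add: zero_margins_def G_def flip: sum_distrib_left)
  have supp: "b < p \<and> j < q \<and> fractional (Y b j)" if "G b j \<noteq> 0" for b j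
    using circulation_support[OF w(1), of a b j] that by (auto simp: G_def)
  have e_pos: "e > 0" using e_cases step_cap_pos supp by (metis G_def zero_less_one)
  have Y01: "0 \<le> Y b j" "Y b j \<le> 1" if "b < p" "j < q" for b j
    using Y that by (auto simp: int_margins_def)
  have Y'_eq: "Y' = (\<lambda>b j. Y b j + e * G b j)" by (simp add: Y'_def G_def)
  have Y'01: "0 \<le> Y' b j" "Y' b j \<le> 1" if "b < p" "j < q" for b j
    using step_within_cap[OF Y01[OF that], of e "G b j"] e_le[OF that] e_pos
    by (auto simp: Y'_def G_def)
  have "(\<Sum>b<p. \<Sum>j<q. W b j * Y' b j)
      = (\<Sum>b<p. \<Sum>j<q. W b j * Y b j) + e * (sg * (\<Sum>b<p. \<Sum>j<q. W b j * circulation R C a t b j))"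
    unfolding Y'_def sum_distrib_left sum.distrib[symmetric]
    by (intro sum.cong refl) (simp add: algebra_simps)
  then have "(\<Sum>b<p. \<Sum>j<q. W b j * Y b j) \<le> (\<Sum>b<p. \<Sum>j<q. W b j * Y' b j)"
    using e_pos sg(2) by simp
  moreover have "Y' b j = 0" if "b < p" "j < q" "Y b j = 0" for b j
    using supp[of b j] that by (auto simp: Y'_eq fractional_def)
  ultimately show "rounding_progress p q W Y Y'"
    using Y Y'01 add_zero_margins[OF zm, of _ Y e]
    unfolding rounding_progress_def int_margins_def by (simp add: Y'_eq)
  obtain b0 j0 where b0: "G b0 j0 \<noteq> 0" "\<not> fractional (Y b0 j0 + e * G b0 j0)"
  proof (cases "\<exists>b<p. \<exists>j<q. G b j \<noteq> 0 \<and> e = step_cap (Y b j) (G b j)")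
    case True
    then show thesis using that step_at_cap by blast
  next
    case False
    have "e = 1"
    proof (rule ccontr)
      assume "e \<noteq> 1"
      then obtain b j where bj: "b < p" "j < q" "e = step_cap (Y b j) (G b j)"
        using e_cases by (auto simp: G_def)
      then have "G b j = 0" using False by blast
      with bj \<open>e \<noteq> 1\<close> show False by (simp add: step_cap_def)
    qed
    define b j where "b = R (t - 1)" and "j = C (t - 1)"
    have "\<bar>G b j\<bar> = 1"
      using circulation_last[OF w] sg_abs by (simp add: G_def b_def j_def abs_mult)
    then have G: "G b j = 1 \<or> G b j = -1" by linarith
    then have bj: "b < p" "j < q" "fractional (Y b j)" using supp[of b j] by auto
    \<comment> \<open>This cap is \<open>Y b j\<close> or \<open>1 - Y b j\<close>, both below 1,
      which contradicts \<open>e = 1\<close>.\<close>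
    have "e \<le> step_cap (Y b j) (G b j)" using e_le[OF bj(1,2)] by (simp add: G_def)
    then show thesis using bj(3) G \<open>e = 1\<close> by (auto simp: step_cap_def fractional_def)
  qed
  show "card (fracs p q Y') < card (fracs p q Y)"
    unfolding Y'_eq using supp[OF b0(1)] b0 supp by (intro fracs_add_psubset) auto
qed

lemma rounding_progress_cong:
  assumes "\<And>b j. b < p \<Longrightarrow> j < q \<Longrightarrow> Y' b j = Z b j"
  shows "rounding_progress p q W Y Y' = rounding_progress p q W Y Z"
  unfolding rounding_progress_def int_margins_def using assms by (simp cong: sum.cong_simp)

lemma fracs_cong:
  assumes "\<And>b j. b < p \<Longrightarrow> j < q \<Longrightarrow> Y b j = Z b j"
  shows "fracs p q Y = fracs p q Z"
  using assms by (auto simp: fracs_def)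

section \<open>The cycle cancelling program\<close>

definition BFrac :: "rexp \<Rightarrow> bexp" where
  "BFrac e = BAnd (RLess (RNum 0) e) (RLess e (RNum 1))"

lemma beval_BFrac [simp]: "beval (BFrac e) s \<longleftrightarrow> fractional (reval e s)"
  by (simp add: BFrac_def fractional_def)

text \<open>Integer arrays: 4 and 5 hold the numbers of rows and columns; 20 tells whether a fractional entry
  was found, 21 and 22 are the current row and column, 29 and 30 the next column and row; 24 and 25 hold the rows
  and columns of the walk, 28 its length, and 23 one plus the position of each row on it (0 if not visited);
  26 tells whether the walk is closed, and 27 is the position where it closes up; 10 to 14 are loop counters.
  Real arrays: 3 is the matrix, 4 the weights, 20 the circulation, 21 its weight, 22 the sign and
  23 the size of the step.\<close>

definition find_entry :: lprog where
  "find_entry = LSeq (LN 20 (INum 0)) (LFor 10 4 (LFor 11 5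
     (LIf (BFrac (RGet 3 (iv 10) (iv 11)))
       (LSeq (LN 20 (INum 1)) (LSeq (LN 21 (iv 10)) (LN 22 (iv 11)))) LSkip)))"

definition find_col :: lprog where
  "find_col = LFor 11 5 (LIf (BAnd (BFrac (RGet 3 (iv 21) (iv 11))) (INe (iv 11) (iv 22)))
     (LN 29 (iv 11)) LSkip)"

definition find_row :: lprog where
  "find_row = LFor 10 4 (LIf (BAnd (BFrac (RGet 3 (iv 10) (iv 29))) (INe (iv 10) (iv 21)))
     (LN 30 (iv 10)) LSkip)"

definition walk_step :: lprog where
  "walk_step = LSeq find_col (LSeq find_row
     (LSeq (LI 23 (iv 21) (INum 0) (IAdd (iv 28) (INum 1)))
     (LSeq (LI 25 (iv 28) (INum 0) (iv 29))
     (LSeq (LN 28 (IAdd (iv 28) (INum 1)))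
     (LSeq (LI 24 (iv 28) (INum 0) (iv 30))
     (LSeq (LN 21 (iv 30))
     (LSeq (LN 22 (iv 29))
     (LIf (ILess (INum 0) (IGet 23 (iv 21) (INum 0)))
       (LSeq (LN 26 (INum 1)) (LN 27 (ISub (IGet 23 (iv 21) (INum 0)) (INum 1)))) LSkip))))))))"

definition init_walk :: lprog where
  "init_walk = LSeq (LFor 10 4 (LI 23 (iv 10) (INum 0) (INum 0)))
     (LSeq (LN 26 (INum 0)) (LSeq (LN 28 (INum 0)) (LI 24 (INum 0) (INum 0) (iv 21))))"

definition walk_loop :: lprog where
  "walk_loop = LFor 12 4 (LIf (ILess (iv 26) (INum 1)) walk_step LSkip)"

definition clear_circulation :: lprog where
  "clear_circulation = LFor 10 4 (LFor 11 5 (LR 20 (iv 10) (iv 11) (RNum 0)))"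

definition add_edge :: "iexp \<Rightarrow> rexp \<Rightarrow> lprog" where
  "add_edge i p = LR 20 (IGet 24 i (INum 0)) (IGet 25 (iv 12) (INum 0))
     (RAdd (RGet 20 (IGet 24 i (INum 0)) (IGet 25 (iv 12) (INum 0))) p)"

definition build_circulation :: lprog where
  "build_circulation = LFor 12 4 (LIf (BAnd (BNot (ILess (iv 12) (iv 27))) (ILess (iv 12) (iv 28)))
     (LSeq (add_edge (iv 12) (RNum 1)) (add_edge (IAdd (iv 12) (INum 1)) (RSub (RNum 0) (RNum 1))))
     LSkip)"

definition slope :: lprog where
  "slope = LSeq (LX 21 (RNum 0)) (LFor 10 4 (LFor 11 5
     (LX 21 (RAdd (rv 21) (RMul (RGet 4 (iv 10) (iv 11)) (RGet 20 (iv 10) (iv 11)))))))"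

definition choose_sign :: lprog where
  "choose_sign = LIf (RLess (rv 21) (RNum 0)) (LX 22 (RSub (RNum 0) (RNum 1))) (LX 22 (RNum 1))"

definition step_size :: lprog where
  "step_size = LSeq (LX 23 (RNum 1)) (LFor 10 4 (LFor 11 5
     (LSeq (LX 24 (RMul (rv 22) (RGet 20 (iv 10) (iv 11))))
     (LSeq (LIf (RLess (RNum 0) (rv 24))
              (LX 25 (RDiv (RSub (RNum 1) (RGet 3 (iv 10) (iv 11))) (rv 24)))
              (LIf (RLess (rv 24) (RNum 0))
                 (LX 25 (RDiv (RGet 3 (iv 10) (iv 11)) (RSub (RNum 0) (rv 24))))
                 (LX 25 (RNum 1))))
       (LIf (RLess (rv 25) (rv 23)) (LX 23 (rv 25)) LSkip)))))"

definition apply_step :: lprog where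
  "apply_step = LFor 10 4 (LFor 11 5 (LR 3 (iv 10) (iv 11)
     (RAdd (RGet 3 (iv 10) (iv 11)) (RMul (rv 23) (RMul (rv 22) (RGet 20 (iv 10) (iv 11)))))))"

definition cancel_step :: lprog where
  "cancel_step = LSeq find_entry (LIf (ILess (INum 0) (iv 20))
     (LSeq init_walk (LSeq walk_loop (LSeq clear_circulation (LSeq build_circulation
       (LSeq slope (LSeq choose_sign (LSeq step_size apply_step)))))))
     LSkip)"

definition cancel :: lprog where
  "cancel = LFor 13 4 (LFor 14 5 cancel_step)"

lemmas cancel_defs = find_entry_def find_col_def find_row_def walk_step_def init_walk_def
  walk_loop_def clear_circulation_def add_edge_def build_circulation_def slope_def choose_sign_def
  step_size_def apply_step_def cancel_step_def

abbreviation nrows :: "memory \<Rightarrow> nat" where "nrows s \<equiv> fst s 4 0 0"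
abbreviation ncols :: "memory \<Rightarrow> nat" where "ncols s \<equiv> fst s 5 0 0"
abbreviation wrow :: "memory \<Rightarrow> nat \<Rightarrow> nat" where "wrow s \<equiv> (\<lambda>i. fst s 24 i 0)"
abbreviation wcol :: "memory \<Rightarrow> nat \<Rightarrow> nat" where "wcol s \<equiv> (\<lambda>i. fst s 25 i 0)"

section \<open>Correctness of the cycle cancelling program\<close>

lemma find_entry_correct:
  fixes s :: memory
  defines "s' \<equiv> den find_entry s"
  shows "fst s' 20 0 0 = 0 \<longrightarrow> fracs (nrows s) (ncols s) (snd s 3) = {}"
    and "fst s' 20 0 0 > 0 \<longrightarrow> fst s' 21 0 0 < nrows s \<and> fst s' 22 0 0 < ncols s \<and>
           fractional (snd s 3 (fst s' 21 0 0) (fst s' 22 0 0))"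
proof -
  define J where "J = (\<lambda>S (s'::memory).
    (fst s' 20 0 0 = 0 \<longrightarrow> (\<forall>(b, j)\<in>S. \<not> fractional (snd s 3 b j))) \<and>
    (fst s' 20 0 0 > 0 \<longrightarrow> fst s' 21 0 0 < nrows s \<and> fst s' 22 0 0 < ncols s \<and>
           fractional (snd s 3 (fst s' 21 0 0) (fst s' 22 0 0))))"
  have "J ({..<nrows s} \<times> {..<ncols s}) s'"
    unfolding s'_def find_entry_def den.simps(4)
  proof (rule den_for_pairs)
    fix k l S s1
    assume kl: "k < nrows s" "l < ncols s" "fst s1 10 0 0 = k" "fst s1 11 0 0 = l" "J S s1"
      and ag: "agree (insert 10 (insert 11 (iwrites (LIf (BFrac (RGet 3 (iv 10) (iv 11)))
       (LSeq (LN 20 (INum 1)) (LSeq (LN 21 (iv 10)) (LN 22 (iv 11)))) LSkip))))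
       (rwrites (LIf (BFrac (RGet 3 (iv 10) (iv 11)))
       (LSeq (LN 20 (INum 1)) (LSeq (LN 21 (iv 10)) (LN 22 (iv 11)))) LSkip))
       (den (LN 20 (INum 0)) s) s1"
    have "snd s1 3 = snd s 3" using agreeD(2)[OF ag, of 3] by simp
    then show "J (insert (k, l) S) (den (LIf (BFrac (RGet 3 (iv 10) (iv 11)))
       (LSeq (LN 20 (INum 1)) (LSeq (LN 21 (iv 10)) (LN 22 (iv 11)))) LSkip) s1)"
      using kl by (auto simp: J_def upd3_def)
  qed (auto simp: J_def upd3_def)
  then show "fst s' 20 0 0 = 0 \<longrightarrow> fracs (nrows s) (ncols s) (snd s 3) = {}"
    and "fst s' 20 0 0 > 0 \<longrightarrow> fst s' 21 0 0 < nrows s \<and> fst s' 22 0 0 < ncols s \<and>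
           fractional (snd s 3 (fst s' 21 0 0) (fst s' 22 0 0))"
    by (auto simp: J_def fracs_def)
qed

lemma find_col_correct:
  fixes s :: memory
  assumes "\<exists>j<ncols s. j \<noteq> fst s 22 0 0 \<and> fractional (snd s 3 (fst s 21 0 0) j)"
  shows "fst (den find_col s) 29 0 0 < ncols s \<and> fst (den find_col s) 29 0 0 \<noteq> fst s 22 0 0 \<and>
    fractional (snd s 3 (fst s 21 0 0) (fst (den find_col s) 29 0 0))"
proof -
  define P where "P = (\<lambda>j. j < ncols s \<and> j \<noteq> fst s 22 0 0 \<and> fractional (snd s 3 (fst s 21 0 0) j))"
  have "(\<exists>j<ncols s. P j) \<longrightarrow> P (fst (den find_col s) 29 0 0)"
    unfolding find_col_def
  proof (rule den_for[where I = "\<lambda>k s'. (\<exists>j<k. P j) \<longrightarrow> P (fst s' 29 0 0)"], goal_cases)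
    case (2 k s1)
    have eq: "snd s1 3 = snd s 3" "fst s1 21 = fst s 21" "fst s1 22 = fst s 22"
      using agreeD[OF 2(3)] by simp_all
    have P: "P k \<longleftrightarrow> k \<noteq> fst s 22 0 0 \<and> fractional (snd s 3 (fst s 21 0 0) k)" using 2(1) by (auto simp: P_def)
    show ?case using 2(1,2,4) P by (auto simp: eq upd3_def less_Suc_eq)
  qed auto
  with assms show ?thesis by (auto simp: P_def)
qed

lemma find_row_correct:
  fixes s :: memory
  assumes "\<exists>b<nrows s. b \<noteq> fst s 21 0 0 \<and> fractional (snd s 3 b (fst s 29 0 0))"
  shows "fst (den find_row s) 30 0 0 < nrows s \<and> fst (den find_row s) 30 0 0 \<noteq> fst s 21 0 0 \<and>
    fractional (snd s 3 (fst (den find_row s) 30 0 0) (fst s 29 0 0))"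
proof -
  define P where "P = (\<lambda>b. b < nrows s \<and> b \<noteq> fst s 21 0 0 \<and> fractional (snd s 3 b (fst s 29 0 0)))"
  have "(\<exists>b<nrows s. P b) \<longrightarrow> P (fst (den find_row s) 30 0 0)"
    unfolding find_row_def
  proof (rule den_for[where I = "\<lambda>k s'. (\<exists>b<k. P b) \<longrightarrow> P (fst s' 30 0 0)"], goal_cases)
    case (2 k s1)
    have eq: "snd s1 3 = snd s 3" "fst s1 21 = fst s 21" "fst s1 29 = fst s 29"
      using agreeD[OF 2(3)] by simp_all
    have P: "P k \<longleftrightarrow> k \<noteq> fst s 21 0 0 \<and> fractional (snd s 3 k (fst s 29 0 0))" using 2(1) by (auto simp: P_def)
    show ?case using 2(1,2,4) P by (auto simp: eq upd3_def less_Suc_eq)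
  qed auto
  with assms show ?thesis by (auto simp: P_def)
qed

definition open_inv :: "nat \<Rightarrow> memory \<Rightarrow> bool" where
  "open_inv t s \<longleftrightarrow> fst s 26 0 0 = 0 \<and> fst s 28 0 0 = t \<and> fst s 21 0 0 = wrow s t \<and>
     open_walk (nrows s) (ncols s) (snd s 3) (wrow s) (wcol s) t (fst s 22 0 0) (\<lambda>b. fst s 23 b 0)"

definition closed_inv :: "memory \<Rightarrow> bool" where
  "closed_inv s \<longleftrightarrow> fst s 26 0 0 > 0 \<and>
     walk (nrows s) (ncols s) (snd s 3) (wrow s) (wcol s) (fst s 28 0 0) \<and>
     fst s 27 0 0 < fst s 28 0 0 \<and> wrow s (fst s 28 0 0) = wrow s (fst s 27 0 0)"

lemma walk_step_correct:
  assumes inv: "open_inv t s" and Y: "int_margins (nrows s) (ncols s) (snd s 3)"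
  shows "open_inv (Suc t) (den walk_step s) \<or> closed_inv (den walk_step s)"
proof -
  let ?p = "nrows s" and ?q = "ncols s" and ?Y = "snd s 3"
  define r where "r = fst s 21 0 0"
  define c where "c = fst s 22 0 0"
  define R where "R = wrow s"
  define C where "C = wcol s"
  define pos where "pos = (\<lambda>b. fst s 23 b 0)"
  have ow: "open_walk ?p ?q ?Y R C t c pos" and r: "r = R t"
    and t: "fst s 28 0 0 = t" "fst s 26 0 0 = 0"
    using inv by (auto simp: open_inv_def R_def C_def c_def pos_def r_def)
  define s1 where "s1 = den find_col s"
  define c' where "c' = fst s1 29 0 0"
  have fr1: "fst s1 a = fst s a" if "a \<noteq> 11" "a \<noteq> 29" for a
    unfolding s1_def using that by (intro den_frame_int) (auto simp: find_col_def)
  have frx1: "snd s1 = snd s"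
    unfolding s1_def by (rule ext, rule den_frame_real) (auto simp: find_col_def)
  have rc: "r < ?p" "c < ?q" "fractional (?Y r c)"
    using ow by (auto simp: open_walk_def walk_def r)
  have c': "c' < ?q" "c' \<noteq> c" "fractional (?Y r c')"
    using find_col_correct[of s] other_fractional_in_row[OF Y rc]
    by (auto simp: c'_def s1_def r_def c_def)
  define s2 where "s2 = den find_row s1"
  define r' where "r' = fst s2 30 0 0"
  have fr2: "fst s2 a = fst s1 a" if "a \<noteq> 10" "a \<noteq> 30" for a
    unfolding s2_def using that by (intro den_frame_int) (auto simp: find_row_def)
  have frx2: "snd s2 = snd s1"
    unfolding s2_def by (rule ext, rule den_frame_real) (auto simp: find_row_def)
  have "\<exists>b<?p. b \<noteq> r \<and> fractional (?Y b c')"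
    using other_fractional_in_column[OF Y rc(1) c'(1,3)] .
  then have r': "r' < ?p" "r' \<noteq> R t" "fractional (?Y r' c')"
    using find_row_correct[of s1] fr1[of 4] fr1[of 21] frx1
    by (auto simp: r'_def s2_def r_def c'_def r[symmetric])
  define s' where "s' = den walk_step s"
  define R' where "R' = R(Suc t := r')"
  define C' where "C' = C(t := c')"
  define pos' where "pos' = pos(R t := Suc t)"
  have vals: "fst s2 21 0 0 = R t" "fst s2 28 0 0 = t" "fst s2 29 0 0 = c'" "fst s2 30 0 0 = r'"
    "fst s2 26 0 0 = 0" "(\<lambda>b. fst s2 23 b 0) = pos" "wrow s2 = R" "wcol s2 = C"
    "nrows s2 = ?p" "ncols s2 = ?q" "snd s2 3 = ?Y"
    using fr1 fr2 frx1 frx2 t r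
    by (simp_all add: r_def c'_def r'_def pos_def R_def C_def)
  have pos_at: "fst s2 23 b 0 = pos b" and R_at: "fst s2 24 b 0 = R b" and C_at: "fst s2 25 b 0 = C b" for b
    using vals by metis+
  have res: "wrow s' = R'" "wcol s' = C'" "(\<lambda>b. fst s' 23 b 0) = pos'" "fst s' 28 0 0 = Suc t"
    "fst s' 21 0 0 = r'" "fst s' 22 0 0 = c'" "nrows s' = ?p" "ncols s' = ?q" "snd s' 3 = ?Y"
    "fst s' 26 0 0 = (if pos' r' > 0 then 1 else 0)" "pos' r' > 0 \<Longrightarrow> fst s' 27 0 0 = pos' r' - 1"
    using vals pos_at R_at C_at
    by (auto simp: s'_def walk_step_def upd3_def s1_def[symmetric] s2_def[symmetric]
        R'_def C'_def pos'_def fun_eq_iff)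
  note ext = ow c'[unfolded r] r'
  have wrow: "wrow s' i = R' i" for i using res(1) by metis
  show ?thesis
  proof (cases "pos' r' > 0")
    case True
    then show ?thesis
      using walk_extend[OF ext] walk_close[OF ext]
      unfolding s'_def[symmetric] closed_inv_def wrow R'_def[symmetric] C'_def[symmetric] pos'_def[symmetric]
      by (simp add: res)
  next
    case False
    then show ?thesis
      using open_walk_extend[OF ext]
      unfolding s'_def[symmetric] open_inv_def res R'_def[symmetric] C'_def[symmetric] pos'_def[symmetric]
      by (simp add: R'_def wrow)
  qed
qed

lemma init_walk_correct:
  assumes "fst s 21 0 0 < nrows s" "fst s 22 0 0 < ncols s"
    "fractional (snd s 3 (fst s 21 0 0) (fst s 22 0 0))"
  shows "open_inv 0 (den init_walk s)"
proof -
  define s1 where "s1 = den (LFor 10 4 (LI 23 (iv 10) (INum 0) (INum 0))) s"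
  have z: "\<forall>b<nrows s. fst s1 23 b 0 = 0"
    unfolding s1_def
    by (rule den_for[where I = "\<lambda>k s'. \<forall>b<k. fst s' 23 b 0 = 0"]) (auto simp: upd3_def)
  have fr: "fst s1 a = fst s a" if "a \<noteq> 10" "a \<noteq> 23" for a
    unfolding s1_def using that by (intro den_frame_int) auto
  have frx: "snd s1 = snd s"
    unfolding s1_def by (rule ext, rule den_frame_real) auto
  show ?thesis
    unfolding open_inv_def init_walk_def den.simps(4) s1_def[symmetric]
    using assms fr frx z by (auto simp: upd3_def intro!: open_walk_0)
qed

text \<open>A walk still open after as many steps as there are rows would have visited more distinct
  rows than exist. Iterations after the closing do nothing.\<close>

lemma walk_loop_correct:
  assumes inv: "open_inv 0 s" and Y: "int_margins (nrows s) (ncols s) (snd s 3)"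
  shows "closed_inv (den walk_loop s)"
proof -
  have "open_inv (nrows s) (den walk_loop s) \<or> closed_inv (den walk_loop s)"
    unfolding walk_loop_def
  proof (rule den_for[where I = "\<lambda>k s. open_inv k s \<or> closed_inv s"], goal_cases)
    case 1
    then show ?case using inv by (simp add: open_inv_def)
  next
    case (2 k s1)
    have eq: "snd s1 3 = snd s 3" "fst s1 4 = fst s 4" "fst s1 5 = fst s 5"
      using agreeD[OF 2(3)] by (simp_all add: cancel_defs)
    let ?s2 = "den (LIf (ILess (iv 26) (INum 1)) walk_step LSkip) s1"
    have "open_inv (Suc k) ?s2 \<or> closed_inv ?s2"
    proof (cases "open_inv k s1")
      case True
      moreover have "fst s1 26 0 0 = 0" using True by (simp add: open_inv_def)
      ultimately show ?thesis using walk_step_correct[of k s1] Y eq by simp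
    next
      case False
      then have "closed_inv s1" using 2(4) by simp
      then show ?thesis by (simp add: closed_inv_def)
    qed
    then show ?case by (simp add: open_inv_def closed_inv_def)
  qed auto
  moreover have "\<not> open_inv (nrows s) (den walk_loop s)"
  proof
    assume "open_inv (nrows s) (den walk_loop s)"
    then have "nrows s < nrows (den walk_loop s)"
      using open_walk_length_less unfolding open_inv_def by blast
    moreover have "nrows (den walk_loop s) = nrows s"
      by (subst den_frame_int) (simp_all add: cancel_defs)
    ultimately show False by simp
  qed
  ultimately show ?thesis by blast
qed

lemma clear_circulation_correct:
  assumes "b < nrows s" "j < ncols s"
  shows "snd (den clear_circulation s) 20 b j = 0"
proof -
  have "\<forall>(b, j) \<in> {..<nrows s} \<times> {..<ncols s}. snd (den clear_circulation s) 20 b j = 0"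
    unfolding clear_circulation_def
    by (rule den_for_pairs[where J = "\<lambda>S s'. \<forall>(b, j) \<in> S. snd s' 20 b j = 0"]) (auto simp: upd3_def)
  with assms show ?thesis by auto
qed

text \<open>Counting loops start at 0, so the loop runs through as many positions as there are rows
  and a guard selects those from \<open>a\<close> to \<open>t - 1\<close>;
  \<open>t <= nrows s\<close> ensures that all are reached. The \<open>min k t\<close> in the
  invariant freezes the circulation at the end of the walk.\<close>

lemma build_circulation_correct:
  assumes a: "fst s 27 0 0 = a" "fst s 28 0 0 = t" "a < t" "t \<le> nrows s"
    and "\<And>b j. b < nrows s \<Longrightarrow> j < ncols s \<Longrightarrow> snd s 20 b j = 0"
    and "b < nrows s" "j < ncols s"
  shows "snd (den build_circulation s) 20 b j = circulation (wrow s) (wcol s) a t b j"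
proof -
  have "\<forall>b<nrows s. \<forall>j<ncols s. snd (den build_circulation s) 20 b j =
    circulation (wrow s) (wcol s) a (min (nrows s) t) b j"
    unfolding build_circulation_def
  proof (rule den_for[where I = "\<lambda>k s'. \<forall>b<nrows s. \<forall>j<ncols s. snd s' 20 b j =
      circulation (wrow s) (wcol s) a (min k t) b j"], goal_cases)
    case 1
    then show ?case using assms(5) by (simp add: circulation_empty)
  next
    case (2 k s1)
    have eq: "fst s1 27 = fst s 27" "fst s1 28 = fst s 28" "fst s1 24 = fst s 24" "fst s1 25 = fst s 25"
      using agreeD[OF 2(3)] by (simp_all add: cancel_defs)
    show ?case
    proof (cases "a \<le> k \<and> k < t")
      case True
      then have "min k t = k" "min (Suc k) t = Suc k" by auto
      then show ?thesis using 2(1,2,4) True a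
        by (auto simp: eq add_edge_def upd3_def circulation_Suc)
    next
      case False
      then have "circulation (wrow s) (wcol s) a (min k t) = circulation (wrow s) (wcol s) a (min (Suc k) t)"
        by (cases "t \<le> k") (auto simp: fun_eq_iff circulation_empty min_def)
      then show ?thesis using 2(1,2,4) False a by (auto simp: eq)
    qed
  qed auto
  then show ?thesis using assms by (simp add: min_absorb2)
qed

lemma slope_correct:
  "snd (den slope s) 21 0 0 = (\<Sum>b<nrows s. \<Sum>j<ncols s. snd s 4 b j * snd s 20 b j)"
proof -
  have "snd (den slope s) 21 0 0 = (\<Sum>(b, j) \<in> {..<nrows s} \<times> {..<ncols s}. snd s 4 b j * snd s 20 b j)"
    unfolding slope_def den.simps(4)
  proof (rule den_for_pairs[where J = "\<lambda>S s'. snd s' 21 0 0 = (\<Sum>(b, j) \<in> S. snd s 4 b j * snd s 20 b j)"], goal_cases)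
    case (4 k l S s1)
    have eq: "snd s1 4 = snd s 4" "snd s1 20 = snd s 20"
      using agreeD[OF 4(5)] by (simp_all add: upd3_def)
    have "finite S" using 4(6) finite_subset by blast
    then show ?case using 4 by (simp add: eq upd3_def)
  qed (auto simp: upd3_def)
  then show ?thesis by (simp add: sum.cartesian_product)
qed

lemma step_size_correct:
  fixes s :: memory
  defines "e \<equiv> snd (den step_size s) 23 0 0"
    and "cap \<equiv> \<lambda>b j. step_cap (snd s 3 b j) (snd s 22 0 0 * snd s 20 b j)"
  shows "b < nrows s \<Longrightarrow> j < ncols s \<Longrightarrow> e \<le> cap b j"
    and "e = 1 \<or> (\<exists>b<nrows s. \<exists>j<ncols s. e = cap b j)"
proof -
  define J where "J = (\<lambda>S (s'::memory). (\<forall>(b, j)\<in>S. snd s' 23 0 0 \<le> cap b j) \<and>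
    (snd s' 23 0 0 = 1 \<or> (\<exists>b<nrows s. \<exists>j<ncols s. snd s' 23 0 0 = cap b j)))"
  have "J ({..<nrows s} \<times> {..<ncols s}) (den step_size s)"
    unfolding step_size_def den.simps(4)[of "LX 23 _"]
  proof (rule den_for_pairs, goal_cases)
    case (4 k l S s1)
    have eq: "snd s1 3 = snd s 3" "snd s1 20 = snd s 20" "snd s1 22 = snd s 22"
      using agreeD[OF 4(5)] by (simp_all add: upd3_def)
    define x where "x = cap k l"
    have x: "x = step_cap (snd s 3 k l) (snd s 22 0 0 * snd s 20 k l)" by (simp add: x_def cap_def)
    let ?body = "LSeq (LX 24 (RMul (rv 22) (RGet 20 (iv 10) (iv 11))))
     (LSeq (LIf (RLess (RNum 0) (rv 24))
              (LX 25 (RDiv (RSub (RNum 1) (RGet 3 (iv 10) (iv 11))) (rv 24)))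
              (LIf (RLess (rv 24) (RNum 0))
                 (LX 25 (RDiv (RGet 3 (iv 10) (iv 11)) (RSub (RNum 0) (rv 24))))
                 (LX 25 (RNum 1))))
       (LIf (RLess (rv 25) (rv 23)) (LX 23 (rv 25)) LSkip))"
    have "snd (den ?body s1) 23 0 0 = (if x < snd s1 23 0 0 then x else snd s1 23 0 0)"
      using 4(3,4) by (simp add: eq upd3_def x step_cap_def)
    then show ?case using 4(1,2,8) x_def unfolding J_def
      by (auto split: if_splits)
  qed (auto simp: J_def upd3_def)
  then show "b < nrows s \<Longrightarrow> j < ncols s \<Longrightarrow> e \<le> cap b j"
    and "e = 1 \<or> (\<exists>b<nrows s. \<exists>j<ncols s. e = cap b j)"
    by (auto simp: J_def e_def)
qed

lemma apply_step_correct: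
  assumes "b < nrows s" "j < ncols s"
  shows "snd (den apply_step s) 3 b j = snd s 3 b j + snd s 23 0 0 * (snd s 22 0 0 * snd s 20 b j)"
proof -
  have "\<forall>b j. snd (den apply_step s) 3 b j = snd s 3 b j +
    (if (b, j) \<in> {..<nrows s} \<times> {..<ncols s} then snd s 23 0 0 * (snd s 22 0 0 * snd s 20 b j) else 0)"
    unfolding apply_step_def
  proof (rule den_for_pairs[where J = "\<lambda>S s'. \<forall>b j. snd s' 3 b j = snd s 3 b j +
      (if (b, j) \<in> S then snd s 23 0 0 * (snd s 22 0 0 * snd s 20 b j) else 0)"], goal_cases)
    case (4 k l S s1)
    have eq: "snd s1 23 = snd s 23" "snd s1 20 = snd s 20" "snd s1 22 = snd s 22"
      using agreeD[OF 4(5)] by (simp_all add: upd3_def)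
    show ?case using 4(3,4,7,8) by (auto simp: eq upd3_def)
  qed (auto simp: upd3_def)
  with assms show ?thesis by simp
qed

text \<open>Truncated subtraction covers the case that no fractional entry is left, in which the
  matrix stays unchanged.\<close>

lemma cancel_step_correct:
  fixes s :: memory
  assumes Y: "int_margins (nrows s) (ncols s) (snd s 3)"
  defines "Y' \<equiv> snd (den cancel_step s) 3"
  shows "rounding_progress (nrows s) (ncols s) (snd s 4) (snd s 3) Y' \<and>
    card (fracs (nrows s) (ncols s) Y') \<le> card (fracs (nrows s) (ncols s) (snd s 3)) - 1"
proof -
  let ?p = "nrows s" and ?q = "ncols s" and ?Y = "snd s 3"
  define s1 where "s1 = den find_entry s"
  have fr1: "fst s1 a = fst s a" if "a \<notin> {10, 11, 20, 21, 22}" for a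
    unfolding s1_def using that by (intro den_frame_int) (auto simp: cancel_defs)
  have frx1: "snd s1 = snd s"
    unfolding s1_def by (rule ext, rule den_frame_real) (auto simp: cancel_defs)
  show ?thesis
  proof (cases "fst s1 20 0 0 > 0")
    case False
    then have "fracs ?p ?q ?Y = {}" using find_entry_correct(1)[of s] by (simp add: s1_def)
    moreover have "Y' = ?Y" using False frx1 by (simp add: Y'_def cancel_step_def s1_def)
    ultimately show ?thesis using rounding_progress_refl[OF Y] by simp
  next
    case True
    define s2 where "s2 = den walk_loop (den init_walk s1)"
    define s3 where "s3 = den clear_circulation s2"
    define s4 where "s4 = den build_circulation s3"
    define s5 where "s5 = den slope s4"
    define s6 where "s6 = den choose_sign s5"
    define s7 where "s7 = den step_size s6"
    define s8 where "s8 = den apply_step s7"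
    have Y': "Y' = snd s8 3"
      using True by (simp add: Y'_def cancel_step_def s1_def s2_def s3_def s4_def s5_def s6_def s7_def s8_def)
    have fr_i: "fst (den init_walk s1) a = fst s1 a" "snd (den init_walk s1) = snd s1" if "a \<in> {4, 5}" for a
    proof -
      show "fst (den init_walk s1) a = fst s1 a"
        using that by (intro den_frame_int) (auto simp: cancel_defs)
      show "snd (den init_walk s1) = snd s1"
        by (rule ext, rule den_frame_real) (auto simp: cancel_defs)
    qed
    have fr2: "fst s2 4 = fst s 4" "fst s2 5 = fst s 5" "snd s2 = snd s"
    proof -
      have "fst s2 a = fst s a" if "a \<in> {4, 5}" for a
        using that fr1[of a] fr_i[of a] unfolding s2_def
        by (subst den_frame_int) (auto simp: cancel_defs)
      then show "fst s2 4 = fst s 4" "fst s2 5 = fst s 5" by auto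
      have "snd s2 = snd (den init_walk s1)"
        unfolding s2_def by (rule ext, rule den_frame_real) (auto simp: cancel_defs)
      then show "snd s2 = snd s" using fr_i(2)[of 4] frx1 by simp
    qed
    define R C a t where "R = wrow s2" and "C = wcol s2" and "a = fst s2 27 0 0" and "t = fst s2 28 0 0"
    have "fst s1 21 0 0 < nrows s1 \<and> fst s1 22 0 0 < ncols s1 \<and>
        fractional (snd s1 3 (fst s1 21 0 0) (fst s1 22 0 0))"
      using find_entry_correct(2)[of s] True fr1[of 4] fr1[of 5] frx1 by (simp add: s1_def)
    then have "open_inv 0 (den init_walk s1)" by (intro init_walk_correct) auto
    then have "closed_inv s2"
      unfolding s2_def using Y fr_i(1) fr_i(2)[of 4] frx1 fr1[of 4] fr1[of 5]
      by (intro walk_loop_correct) simp_all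
    then have w: "walk ?p ?q ?Y R C t" "a < t" "R t = R a"
      using fr2 by (auto simp: closed_inv_def R_def C_def a_def t_def)
    have fr3: "fst s3 b = fst s2 b" if "b \<notin> {10, 11}" for b
      unfolding s3_def using that by (intro den_frame_int) (auto simp: cancel_defs)
    have frx3: "snd s3 b = snd s2 b" if "b \<noteq> 20" for b
      unfolding s3_def using that by (intro den_frame_real) (auto simp: cancel_defs)
    have fr4: "fst s4 b = fst s3 b" if "b \<noteq> 12" for b
      unfolding s4_def using that by (intro den_frame_int) (auto simp: cancel_defs)
    have frx4: "snd s4 b = snd s3 b" if "b \<noteq> 20" for b
      unfolding s4_def using that by (intro den_frame_real) (auto simp: cancel_defs)
    have G: "snd s4 20 b j = circulation R C a t b j" if "b < ?p" "j < ?q" for b j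
    proof -
      have "snd s4 20 b j = circulation (wrow s3) (wcol s3) a t b j"
        unfolding s4_def
      proof (rule build_circulation_correct)
        show "\<And>b j. b < nrows s3 \<Longrightarrow> j < ncols s3 \<Longrightarrow> snd s3 20 b j = 0"
          using clear_circulation_correct[of _ s2] fr3[of 4] fr3[of 5] by (simp add: s3_def)
      qed (use w walk_length_le[OF w(1)] fr3 fr2 that in \<open>auto simp: a_def t_def\<close>)
      then show ?thesis using fr3 by (simp add: R_def C_def)
    qed
    have fr5: "fst s5 b = fst s4 b" if "b \<notin> {10, 11}" for b
      unfolding s5_def using that by (intro den_frame_int) (auto simp: cancel_defs)
    have frx5: "snd s5 b = snd s4 b" if "b \<noteq> 21" for b
      unfolding s5_def using that by (intro den_frame_real) (auto simp: cancel_defs)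
    have fr6: "fst s6 b = fst s5 b" for b
      unfolding s6_def by (intro den_frame_int) (auto simp: cancel_defs)
    have frx6: "snd s6 b = snd s5 b" if "b \<noteq> 22" for b
      unfolding s6_def using that by (intro den_frame_real) (auto simp: cancel_defs)
    have fr7: "fst s7 b = fst s6 b" if "b \<notin> {10, 11}" for b
      unfolding s7_def using that by (intro den_frame_int) (auto simp: cancel_defs)
    have frx7: "snd s7 b = snd s6 b" if "b \<notin> {23, 24, 25}" for b
      unfolding s7_def using that by (intro den_frame_real) (auto simp: cancel_defs)
    have dims: "nrows s4 = ?p" "ncols s4 = ?q" "nrows s6 = ?p" "ncols s6 = ?q" "nrows s7 = ?p" "ncols s7 = ?q"
      using fr2 fr3 fr4 fr5 fr6 fr7 by simp_all
    have arrays: "snd s4 3 = ?Y" "snd s4 4 = snd s 4" "snd s6 3 = ?Y" "snd s6 20 = snd s4 20"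
      "snd s7 3 = ?Y" "snd s7 20 = snd s4 20" "snd s7 22 = snd s6 22"
      using fr2 frx3 frx4 frx5 frx6 frx7 by simp_all
    define sg e where "sg = snd s6 22 0 0" and "e = snd s7 23 0 0"
    have slope: "snd s5 21 0 0 = (\<Sum>b<?p. \<Sum>j<?q. snd s 4 b j * circulation R C a t b j)"
      using slope_correct[of s4] G by (simp add: s5_def dims arrays)
    have sg: "sg = (if snd s5 21 0 0 < 0 then -1 else 1)"
      by (simp add: sg_def s6_def choose_sign_def upd3_def)
    have cap: "step_cap (snd s6 3 b j) (snd s6 22 0 0 * snd s6 20 b j) =
        step_cap (?Y b j) (sg * circulation R C a t b j)" if "b < ?p" "j < ?q" for b j
      using G that by (simp add: arrays sg_def)
    have e_le: "e \<le> step_cap (?Y b j) (sg * circulation R C a t b j)" if "b < ?p" "j < ?q" for b j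
      using step_size_correct(1)[of b s6 j] cap[OF that] that by (simp add: dims e_def s7_def)
    have e_cases: "e = 1 \<or> (\<exists>b<?p. \<exists>j<?q. e = step_cap (?Y b j) (sg * circulation R C a t b j))"
      using step_size_correct(2)[of s6] unfolding e_def s7_def dims by (metis cap)
    have Y'_eq: "Y' b j = ?Y b j + e * (sg * circulation R C a t b j)" if "b < ?p" "j < ?q" for b j
      using apply_step_correct[of b s7 j] G that by (simp add: Y' s8_def dims arrays e_def sg_def)
    have "sg \<noteq> 0" "\<bar>sg\<bar> = 1" "sg * (\<Sum>b<?p. \<Sum>j<?q. snd s 4 b j * circulation R C a t b j) \<ge> 0"
      by (auto simp: sg slope)
    note cancel_circulation[OF Y w this(1,3) e_le e_cases this(2)]
    then show ?thesis
      using rounding_progress_cong[OF Y'_eq] fracs_cong[OF Y'_eq] by simp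
  qed
qed

text \<open>As many rounds as the matrix has cells suffice, since each removes a fractional entry
  while there is one. The set of visited pairs counts the rounds.\<close>

lemma cancel_correct:
  fixes s :: memory
  assumes Y: "int_margins (nrows s) (ncols s) (snd s 3)"
  defines "Y' \<equiv> snd (den cancel s) 3"
  shows "rounding_progress (nrows s) (ncols s) (snd s 4) (snd s 3) Y'"
    and "fracs (nrows s) (ncols s) Y' = {}"
proof -
  let ?p = "nrows s" and ?q = "ncols s" and ?Y = "snd s 3"
  define J where "J = (\<lambda>(S :: (nat \<times> nat) set) (s'::memory). rounding_progress ?p ?q (snd s 4) ?Y (snd s' 3) \<and>
    card (fracs ?p ?q (snd s' 3)) \<le> card (fracs ?p ?q ?Y) - card S)"
  have J: "J ({..<?p} \<times> {..<?q}) (den cancel s)"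
    unfolding cancel_def
  proof (rule den_for_pairs, goal_cases)
    case 1
    then show ?case using rounding_progress_refl[OF Y] by (simp add: J_def)
  next
    case (4 k l S s1)
    have eq: "fst s1 4 = fst s 4" "fst s1 5 = fst s 5" "snd s1 4 = snd s 4"
      using agreeD[OF 4(5)] by (simp_all add: cancel_defs)
    have prog: "rounding_progress ?p ?q (snd s 4) ?Y (snd s1 3)" using 4(8) by (simp add: J_def)
    then have "int_margins ?p ?q (snd s1 3)" by (simp add: rounding_progress_def)
    note step = cancel_step_correct[of s1, unfolded eq, OF this]
    have "finite S" using 4(6) finite_subset by blast
    then show ?case
      using step 4(7,8) rounding_progress_trans[OF prog] by (auto simp: J_def)
  qed (auto simp: J_def cancel_defs)
  then show "rounding_progress ?p ?q (snd s 4) ?Y Y'" by (simp add: J_def Y'_def)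
  from J have "card (fracs ?p ?q Y') = 0"
    using card_fracs_le[of ?p ?q ?Y] by (simp add: J_def Y'_def card_cartesian_product)
  then show "fracs ?p ?q Y' = {}" using finite_fracs by simp
qed

section \<open>The program that sets up the matching\<close>

declare One_nat_def [simp del]

text \<open>Row \<open>b\<close> of the matrix is bucket \<open>b mod m\<close> of agent \<open>b div m\<close>. As the language has neither
  multiplication of integers nor conversion of integers to reals, these two numbers are tabulated, in
  integer array 6 and in real array 5. Further real arrays: 6 holds the prefix masses and
  7 the largest value in each row; for each agent, 8, 9 and 10 to 12 hold \<open>u\<close>, \<open>R\<close>, \<open>B\<close>, \<open>E0\<close> and
  \<open>E1 - c / u * (B - R) + c\<close> from the locale \<open>buckets\<close>, and 13 and 14 hold \<open>shift\<close> and \<open>rate\<close>.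
  Cells outside the input are initially 0, so sums are accumulated without initialisation.\<close>

abbreviation nagents :: "memory \<Rightarrow> nat" where "nagents s \<equiv> fst s 0 0 0"
abbreviation nitems :: "memory \<Rightarrow> nat" where "nitems s \<equiv> fst s 1 0 0"
abbreviation owner :: "memory \<Rightarrow> nat \<Rightarrow> nat" where "owner s \<equiv> (\<lambda>b. fst s 6 b 0)"
abbreviation brank :: "memory \<Rightarrow> nat \<Rightarrow> real" where "brank s \<equiv> (\<lambda>b. snd s 5 b 0)"

definition init_rows :: lprog where
  "init_rows = LSeq (LN 5 (IAdd (iv 1) (INum 1)))
     (LFor 13 0 (LSeq (LX 17 (RNum 0)) (LFor 14 1
       (LSeq (LI 6 (iv 4) (INum 0) (iv 13))
       (LSeq (LR 5 (iv 4) (INum 0) (rv 17))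
       (LSeq (LX 17 (RAdd (rv 17) (RNum 1)))
         (LN 4 (IAdd (iv 4) (INum 1)))))))))"

abbreviation xown :: "nat \<Rightarrow> rexp" where "xown a \<equiv> RGet a (IGet 6 (iv 10) (INum 0)) (iv 11)"
abbreviation xown0 :: "nat \<Rightarrow> rexp" where "xown0 a \<equiv> RGet a (IGet 6 (iv 10) (INum 0)) (INum 0)"
abbreviation xrank :: rexp where "xrank \<equiv> RGet 5 (iv 10) (INum 0)"
abbreviation xY :: rexp where "xY \<equiv> RGet 3 (iv 10) (iv 11)"

text \<open>The condition is \<open>precedes\<close>, expressed by negation and conjunction of
  strict comparisons.\<close>

definition prefix_sums :: lprog where
  "prefix_sums = LFor 10 0 (LFor 11 1 (LFor 12 1
     (LIf (BAnd (BNot (RLess (RGet 1 (iv 10) (iv 12)) (RGet 1 (iv 10) (iv 11))))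
            (BNot (BAnd (BNot (RLess (RGet 1 (iv 10) (iv 11)) (RGet 1 (iv 10) (iv 12))))
                        (BNot (ILess (iv 12) (iv 11))))))
       (LR 6 (iv 10) (iv 11) (RAdd (RGet 6 (iv 10) (iv 11)) (RGet 2 (iv 10) (iv 12)))) LSkip)))"

definition clamp :: "nat \<Rightarrow> lprog" where
  "clamp a = LSeq (LIf (RLess (RNum 1) (rv a)) (LX a (RNum 1)) LSkip)
     (LIf (RLess (rv a) (RNum 0)) (LX a (RNum 0)) LSkip)"

definition fill_rows :: lprog where
  "fill_rows = LFor 10 4 (LFor 11 1
     (LSeq (LX 15 (RSub (RAdd (xown 6) (xown 2)) xrank)) (LSeq (clamp 15)
     (LSeq (LX 16 (RSub (xown 6) xrank)) (LSeq (clamp 16)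
       (LR 3 (iv 10) (iv 11) (RSub (rv 15) (rv 16))))))))"

definition fill_slack :: lprog where
  "fill_slack = LSeq (LFor 10 4 (LR 3 (iv 10) (iv 1) (RNum 1)))
     (LFor 10 4 (LFor 11 1 (LR 3 (iv 10) (iv 1) (RSub (RGet 3 (iv 10) (iv 1)) xY))))"

definition row_maxima :: lprog where
  "row_maxima = LFor 10 4 (LFor 11 1
     (LIf (BAnd (RLess (RNum 0) xY) (RLess (RGet 7 (iv 10) (INum 0)) (xown 1)))
       (LR 7 (iv 10) (INum 0) (xown 1)) LSkip))"

definition addown :: "nat \<Rightarrow> rexp \<Rightarrow> lprog" where
  "addown a p = LR a (IGet 6 (iv 10) (INum 0)) (INum 0) (RAdd (xown0 a) p)"

text \<open>Ranks are whole numbers stored as reals. Above 1 they contribute to \<open>R\<close>;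
  the only other positive one is 1, whose maximum is \<open>u\<close>.\<close>

definition tail_maxima :: lprog where
  "tail_maxima = LFor 10 4 (LIf (RLess (RNum 1) xrank) (addown 9 (RGet 7 (iv 10) (INum 0)))
     (LIf (RLess (RNum 0) xrank) (addown 8 (RGet 7 (iv 10) (INum 0))) LSkip))"

definition candidates :: lprog where
  "candidates = LFor 10 4 (LFor 11 1 (LIf (RLess (RNum 0) xrank) (addown 10 (RMul xY (xown 1)))
     (LSeq (addown 11 (RMul xY (RLn (RAdd (xown 1) (xown0 9)))))
           (addown 12 (RMul xY (RLn (RAdd (RAdd (xown 1) (xown0 9)) (xown0 8))))))))"

abbreviation xi :: "nat \<Rightarrow> rexp" where "xi a \<equiv> RGet a (iv 10) (INum 0)"

text \<open>If \<open>u = 0\<close>, then \<open>R = 0\<close>, and the conventions for division and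
  \<open>ln\<close> give \<open>c = 0\<close> and \<open>c / u = 0\<close>. Both candidates then
  coincide and the strict comparison selects the first, without a separate case.\<close>

definition select_candidate :: lprog where
  "select_candidate = LFor 10 0
     (LSeq (LX 15 (RLn (RDiv (RAdd (RMul (RNum 2) (xi 8)) (xi 9)) (RAdd (xi 8) (xi 9)))))
     (LIf (RLess (xi 11) (RSub (RAdd (xi 12) (RMul (RDiv (rv 15) (xi 8)) (RSub (xi 10) (xi 9)))) (rv 15)))
       (LSeq (LR 13 (iv 10) (INum 0) (RAdd (xi 9) (xi 8))) (LR 14 (iv 10) (INum 0) (RDiv (rv 15) (xi 8))))
       (LSeq (LR 13 (iv 10) (INum 0) (xi 9)) (LR 14 (iv 10) (INum 0) (RNum 0)))))"

text \<open>The slack column is not written and keeps its initial weight 0.\<close>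

definition edge_weights :: lprog where
  "edge_weights = LFor 10 4 (LFor 11 1 (LIf (RLess (RNum 0) xrank)
     (LR 4 (iv 10) (iv 11) (RMul (xown0 0) (RMul (xown0 14) (xown 1))))
     (LR 4 (iv 10) (iv 11) (RMul (xown0 0) (RLn (RAdd (xown 1) (xown0 13)))))))"

definition read_off :: lprog where
  "read_off = LFor 10 4 (LFor 11 1
     (LIf (RLess (RNum 0) xY) (LI 3 (iv 11) (INum 0) (IGet 6 (iv 10) (INum 0))) LSkip))"

text \<open>The product \<open>n * m\<close> arises by counting: cell 4 is the index of the next row
  and ends as the number of rows.\<close>

lemma init_rows_correct:
  fixes s :: memory
  assumes "nrows s = 0"
  defines "s' \<equiv> den init_rows s"
  shows "nrows s' = nagents s * nitems s" "ncols s' = nitems s + 1"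
    and "b < nagents s * nitems s \<Longrightarrow> owner s' b = b div nitems s \<and> brank s' b = real (b mod nitems s)"
proof -
  define m where "m = nitems s"
  define I where "I = (\<lambda>t (s'::memory). nrows s' = t \<and>
    (\<forall>b<t. owner s' b = b div m \<and> brank s' b = real (b mod m)) \<and> ncols s' = m + 1)"
  have "I (nagents s * m) s'"
    unfolding s'_def init_rows_def den.simps(4)[of "LN 5 _"]
  proof (rule den_for[where I = "\<lambda>k s. I (k * m) s"], goal_cases)
    case 1
    then show ?case using assms by (simp add: I_def upd3_def m_def)
  next
    case (2 k s1)
    have fr: "fst s1 1 = fst s 1" using agreeD[OF 2(3)] by (simp add: upd3_def)
    have "I (k * m + m) (den (LFor 14 1
       (LSeq (LI 6 (iv 4) (INum 0) (iv 13))
       (LSeq (LR 5 (iv 4) (INum 0) (rv 17))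
       (LSeq (LX 17 (RAdd (rv 17) (RNum 1)))
         (LN 4 (IAdd (iv 4) (INum 1))))))) (den (LX 17 (RNum 0)) s1)) \<and>
       snd (den (LFor 14 1
       (LSeq (LI 6 (iv 4) (INum 0) (iv 13))
       (LSeq (LR 5 (iv 4) (INum 0) (rv 17))
       (LSeq (LX 17 (RAdd (rv 17) (RNum 1)))
         (LN 4 (IAdd (iv 4) (INum 1))))))) (den (LX 17 (RNum 0)) s1)) 17 0 0 = real m"
    proof (rule den_for[where I = "\<lambda>l s. I (k * m + l) s \<and> snd s 17 0 0 = real l"], goal_cases)
      case 1
      then show ?case using 2(4) by (simp add: I_def upd3_def)
    next
      case (2 l s2)
      have "fst s2 13 0 0 = k" using agreeD(1)[OF 2(3), of 13] \<open>fst s1 13 0 0 = k\<close> by simp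
      moreover have "(k * m + l) div m = k" "(k * m + l) mod m = l" using 2(1) by simp_all
      ultimately show ?case using 2(4) by (auto simp: I_def upd3_def less_Suc_eq)
    qed (simp add: fr m_def)
    then show ?case by (simp add: I_def add.commute)
  qed (simp add: upd3_def)
  then show "nrows s' = nagents s * nitems s" "ncols s' = nitems s + 1"
    "b < nagents s * nitems s \<Longrightarrow> owner s' b = b div nitems s \<and> brank s' b = real (b mod nitems s)"
    by (auto simp: I_def m_def)
qed

lemma prefix_sums_correct:
  fixes s :: memory
  assumes "\<And>i j. snd s 6 i j = 0" "i < nagents s" "j < nitems s"
  shows "snd (den prefix_sums s) 6 i j = prefix_mass {..<nitems s} (snd s 1 i) (snd s 2 i) j"
proof -
  let ?m = "nitems s"
  define J where "J = (\<lambda>S (s'::memory). \<forall>i j. snd s' 6 i j =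
    (if (i, j) \<in> S then prefix_mass {..<?m} (snd s 1 i) (snd s 2 i) j else 0))"
  have "J ({..<nagents s} \<times> {..<?m}) (den prefix_sums s)"
    unfolding prefix_sums_def
  proof (rule den_for_pairs, goal_cases)
    case (4 i j S s1)
    have fr: "snd s1 1 = snd s 1" "snd s1 2 = snd s 2" "fst s1 1 = fst s 1"
      using agreeD[OF 4(5)] by simp_all
    \<comment> \<open>The prefix mass restricted to items below \<open>l\<close>, which is what the
      innermost loop has accumulated before iteration \<open>l\<close>.\<close>
    define pre where "pre = (\<lambda>l. \<Sum>j'\<in>{j'\<in>{..<l}. precedes (snd s 1 i) j' j}. snd s 2 i j')"
    define I where "I = (\<lambda>l (s'::memory). \<forall>i' j'. snd s' 6 i' j' =
      (if i' = i \<and> j' = j then pre l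
       else if (i', j') \<in> S then prefix_mass {..<?m} (snd s 1 i') (snd s 2 i') j' else 0))"
    have pre_Suc: "pre (Suc l) = pre l + (if precedes (snd s 1 i) l j then snd s 2 i l else 0)" for l
    proof -
      have "{j'\<in>{..<Suc l}. precedes (snd s 1 i) j' j} = (if precedes (snd s 1 i) l j
          then insert l {j'\<in>{..<l}. precedes (snd s 1 i) j' j} else {j'\<in>{..<l}. precedes (snd s 1 i) j' j})"
        by (auto simp: less_Suc_eq)
      then show ?thesis by (simp add: pre_def)
    qed
    show ?case
    proof (rule back_subst[where P = "\<lambda>x. x"])
      show "I ?m (den (LFor 12 1
     (LIf (BAnd (BNot (RLess (RGet 1 (iv 10) (iv 12)) (RGet 1 (iv 10) (iv 11))))
            (BNot (BAnd (BNot (RLess (RGet 1 (iv 10) (iv 11)) (RGet 1 (iv 10) (iv 12))))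
                        (BNot (ILess (iv 12) (iv 11))))))
       (LR 6 (iv 10) (iv 11) (RAdd (RGet 6 (iv 10) (iv 11)) (RGet 2 (iv 10) (iv 12)))) LSkip)) s1)"
      proof (rule den_for, goal_cases)
        case 1
        then show ?case using 4(7,8) by (auto simp: I_def J_def pre_def)
      next
        case (2 l s2)
        have "snd s2 1 = snd s 1" "snd s2 2 = snd s 2" "fst s2 10 0 0 = i" "fst s2 11 0 0 = j"
          using agreeD[OF 2(3)] 4(3,4) fr by simp_all
        then show ?case using 2(2,4) unfolding I_def
          by (auto simp: upd3_def pre_Suc precedes_def)
      qed (simp add: fr)
    qed (auto simp: I_def J_def pre_def prefix_mass_def)
  qed (use assms in \<open>auto simp: J_def\<close>)
  then show ?thesis using assms by (simp add: J_def)
qed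

lemma den_clamp:
  "den (clamp a) s = (fst s, upd3 (snd s) a 0 0 (max 0 (min 1 (snd s a 0 0))))"
  by (cases s) (auto simp: clamp_def upd3_def fun_eq_iff)

lemma fill_rows_correct:
  fixes s :: memory
  assumes "b < nrows s" "j < nitems s" "brank s b = real k"
  shows "snd (den fill_rows s) 3 b j =
    clip k (snd s 6 (owner s b) j + snd s 2 (owner s b) j) - clip k (snd s 6 (owner s b) j)"
proof -
  define F where "F = (\<lambda>b j. max 0 (min 1 (snd s 6 (owner s b) j + snd s 2 (owner s b) j - brank s b))
    - max 0 (min 1 (snd s 6 (owner s b) j - brank s b)))"
  have "\<forall>(b, j)\<in>{..<nrows s} \<times> {..<nitems s}. snd (den fill_rows s) 3 b j = F b j"
    unfolding fill_rows_def
  proof (rule den_for_pairs[where J = "\<lambda>S s'. \<forall>(b, j)\<in>S. snd s' 3 b j = F b j"], goal_cases)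
    case (4 k l S s1)
    have fr: "snd s1 6 = snd s 6" "snd s1 2 = snd s 2" "fst s1 6 = fst s 6" "snd s1 5 = snd s 5"
      using agreeD[OF 4(5)] by (simp_all add: clamp_def)
    show ?case using 4(3,4,7,8)
      by (auto simp: fr upd3_def den_clamp F_def)
  qed (auto simp: clamp_def)
  then show ?thesis using assms by (simp add: F_def clip_def)
qed

lemma fill_slack_correct:
  fixes s :: memory
  assumes "b < nrows s"
  shows "snd (den fill_slack s) 3 b (nitems s) = 1 - (\<Sum>j<nitems s. snd s 3 b j)"
    and "j \<noteq> nitems s \<Longrightarrow> snd (den fill_slack s) 3 b j = snd s 3 b j"
proof -
  let ?m = "nitems s"
  define s1 where "s1 = den (LFor 10 4 (LR 3 (iv 10) (iv 1) (RNum 1))) s"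
  have "\<forall>b j. snd s1 3 b j = (if b < nrows s \<and> j = ?m then 1 else snd s 3 b j)"
    unfolding s1_def
    by (rule den_for[where I = "\<lambda>k s'. \<forall>b j. snd s' 3 b j = (if b < k \<and> j = ?m then 1 else snd s 3 b j)"])
      (auto simp: upd3_def agree_def)
  moreover have fr: "fst s1 4 = fst s 4" "fst s1 1 = fst s 1"
    unfolding s1_def by (subst den_frame_int; simp)+
  \<comment> \<open>Visited cells are sliced by row because each cell is subtracted from the slack
    of its own row.\<close>
  moreover define sl where "sl = (\<lambda>(S :: (nat \<times> nat) set) b. {j. (b, j) \<in> S})"
  have sl_insert: "sl (insert (k, l) S) b = (if b = k then insert l (sl S b) else sl S b)" for k l S b
    by (auto simp: sl_def)
  have "\<forall>b j. snd (den fill_slack s) 3 b j =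
      (if j = ?m then snd s1 3 b ?m - (\<Sum>j\<in>sl ({..<nrows s} \<times> {..<?m}) b. snd s1 3 b j) else snd s1 3 b j)"
    unfolding fill_slack_def den.simps(4) s1_def[symmetric]
  proof (rule den_for_pairs[where J = "\<lambda>S s'. \<forall>b j. snd s' 3 b j =
      (if j = ?m then snd s1 3 b ?m - (\<Sum>j\<in>sl S b. snd s1 3 b j) else snd s1 3 b j)"], goal_cases)
    case (4 k l S s2)
    have "fst s2 1 = fst s 1" using agreeD[OF 4(5)] fr by simp
    moreover have "finite (sl S b)" for b
      by (rule finite_subset[of _ "{..<?m}"]) (use 4(6) in \<open>auto simp: sl_def\<close>)
    moreover have "l \<notin> sl S k" using 4(7) by (simp add: sl_def)
    ultimately show ?case using 4(2,3,4,8) by (auto simp: upd3_def sl_insert)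
  qed (simp_all add: fr sl_def)
  moreover have "sl ({..<nrows s} \<times> {..<?m}) b = {..<?m}"
    using assms by (auto simp: sl_def)
  ultimately show "snd (den fill_slack s) 3 b ?m = 1 - (\<Sum>j<?m. snd s 3 b j)"
    and "j \<noteq> ?m \<Longrightarrow> snd (den fill_slack s) 3 b j = snd s 3 b j"
    using assms by simp_all
qed

lemma row_maxima_correct:
  fixes s :: memory
  assumes "\<And>b. snd s 7 b 0 = 0" "b < nrows s"
  shows "snd (den row_maxima s) 7 b 0 =
    Max (insert 0 (snd s 1 (owner s b) ` {j\<in>{..<nitems s}. snd s 3 b j > 0}))"
proof -
  let ?M = "\<lambda>S b. Max (insert 0 (snd s 1 (owner s b) ` {j. (b, j) \<in> S \<and> snd s 3 b j > 0}))"
  have "\<forall>b. snd (den row_maxima s) 7 b 0 = ?M ({..<nrows s} \<times> {..<nitems s}) b"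
    unfolding row_maxima_def
  proof (rule den_for_pairs[where J = "\<lambda>S s'. \<forall>b. snd s' 7 b 0 = ?M S b"], goal_cases)
    case (4 k l S s1)
    have fr: "snd s1 1 = snd s 1" "snd s1 3 = snd s 3" "fst s1 6 = fst s 6"
      using agreeD[OF 4(5)] by simp_all
    have fin: "finite {j. (b, j) \<in> S \<and> snd s 3 b j > 0}" for b
      by (rule finite_subset[of _ "{..<nitems s}"]) (use 4(6) in auto)
    have ins: "{j. (b, j) \<in> insert (k, l) S \<and> snd s 3 b j > 0} = (if b = k \<and> snd s 3 k l > 0
       then insert l {j. (b, j) \<in> S \<and> snd s 3 b j > 0} else {j. (b, j) \<in> S \<and> snd s 3 b j > 0})" for b
      by auto
    have "?M (insert (k, l) S) b = (if b = k \<and> snd s 3 k l > 0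
        then max (snd s 1 (owner s k) l) (?M S b) else ?M S b)" for b
      unfolding ins using fin[of b] by (auto simp: insert_commute[of 0])
    then show ?case using 4(3,4,8) by (auto simp: fr upd3_def)
  qed (use assms in auto)
  then show ?thesis using assms(2) by simp
qed

lemma tail_maxima_correct:
  fixes s :: memory
  assumes "\<And>i. snd s 8 i 0 = 0" "\<And>i. snd s 9 i 0 = 0"
  shows "snd (den tail_maxima s) 9 i 0 = (\<Sum>b<nrows s. if owner s b = i \<and> brank s b > 1 then snd s 7 b 0 else 0)"
    and "snd (den tail_maxima s) 8 i 0 =
      (\<Sum>b<nrows s. if owner s b = i \<and> 0 < brank s b \<and> brank s b \<le> 1 then snd s 7 b 0 else 0)"
proof -
  have "(\<forall>i. snd (den tail_maxima s) 9 i 0 = (\<Sum>b<nrows s. if owner s b = i \<and> brank s b > 1 then snd s 7 b 0 else 0)) \<and>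
    (\<forall>i. snd (den tail_maxima s) 8 i 0 =
      (\<Sum>b<nrows s. if owner s b = i \<and> 0 < brank s b \<and> brank s b \<le> 1 then snd s 7 b 0 else 0))"
    unfolding tail_maxima_def
  proof (rule den_for[where I = "\<lambda>k s'.
    (\<forall>i. snd s' 9 i 0 = (\<Sum>b<k. if owner s b = i \<and> brank s b > 1 then snd s 7 b 0 else 0)) \<and>
    (\<forall>i. snd s' 8 i 0 = (\<Sum>b<k. if owner s b = i \<and> 0 < brank s b \<and> brank s b \<le> 1 then snd s 7 b 0 else 0))"],
      goal_cases)
    case (2 k s1)
    have fr: "snd s1 7 = snd s 7" "snd s1 5 = snd s 5" "fst s1 6 = fst s 6"
      using agreeD[OF 2(3)] by (simp_all add: addown_def)
    show ?case using 2(2,4) by (auto simp: fr upd3_def addown_def)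
  qed (use assms in auto)
  then show "snd (den tail_maxima s) 9 i 0 = (\<Sum>b<nrows s. if owner s b = i \<and> brank s b > 1 then snd s 7 b 0 else 0)"
    and "snd (den tail_maxima s) 8 i 0 =
      (\<Sum>b<nrows s. if owner s b = i \<and> 0 < brank s b \<and> brank s b \<le> 1 then snd s 7 b 0 else 0)"
    by auto
qed

lemma candidates_correct:
  fixes s :: memory
  assumes "\<And>i. snd s 10 i 0 = 0" "\<And>i. snd s 11 i 0 = 0" "\<And>i. snd s 12 i 0 = 0"
  shows "snd (den candidates s) 10 i 0 = (\<Sum>b<nrows s. \<Sum>j<nitems s.
      if owner s b = i \<and> brank s b > 0 then snd s 3 b j * snd s 1 i j else 0)"
    and "snd (den candidates s) 11 i 0 = (\<Sum>b<nrows s. \<Sum>j<nitems s.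
      if owner s b = i \<and> \<not> brank s b > 0 then snd s 3 b j * ln (snd s 1 i j + snd s 9 i 0) else 0)"
    and "snd (den candidates s) 12 i 0 = (\<Sum>b<nrows s. \<Sum>j<nitems s.
      if owner s b = i \<and> \<not> brank s b > 0 then snd s 3 b j * ln (snd s 1 i j + snd s 9 i 0 + snd s 8 i 0) else 0)"
proof -
  define f10 where "f10 = (\<lambda>i (b, j). if owner s b = i \<and> brank s b > 0 then snd s 3 b j * snd s 1 i j else 0)"
  define f11 where "f11 = (\<lambda>i (b, j). if owner s b = i \<and> \<not> brank s b > 0
    then snd s 3 b j * ln (snd s 1 i j + snd s 9 i 0) else 0)"
  define f12 where "f12 = (\<lambda>i (b, j). if owner s b = i \<and> \<not> brank s b > 0
    then snd s 3 b j * ln (snd s 1 i j + snd s 9 i 0 + snd s 8 i 0) else 0)"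
  define J where "J = (\<lambda>S (s'::memory). \<forall>i. snd s' 10 i 0 = sum (f10 i) S \<and>
    snd s' 11 i 0 = sum (f11 i) S \<and> snd s' 12 i 0 = sum (f12 i) S)"
  have "J ({..<nrows s} \<times> {..<nitems s}) (den candidates s)"
    unfolding candidates_def
  proof (rule den_for_pairs, goal_cases)
    case (4 k l S s1)
    have fr: "snd s1 1 = snd s 1" "snd s1 3 = snd s 3" "snd s1 5 = snd s 5" "fst s1 6 = fst s 6"
      "snd s1 8 = snd s 8" "snd s1 9 = snd s 9"
      using agreeD[OF 4(5)] by (simp_all add: addown_def)
    have "finite S" using 4(6) finite_subset by blast
    then show ?case using 4(3,4,7,8)
      by (auto simp: J_def fr upd3_def addown_def f10_def f11_def f12_def)
  qed (use assms in \<open>auto simp: J_def addown_def\<close>)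
  then show "snd (den candidates s) 10 i 0 = (\<Sum>b<nrows s. \<Sum>j<nitems s.
      if owner s b = i \<and> brank s b > 0 then snd s 3 b j * snd s 1 i j else 0)"
    and "snd (den candidates s) 11 i 0 = (\<Sum>b<nrows s. \<Sum>j<nitems s.
      if owner s b = i \<and> \<not> brank s b > 0 then snd s 3 b j * ln (snd s 1 i j + snd s 9 i 0) else 0)"
    and "snd (den candidates s) 12 i 0 = (\<Sum>b<nrows s. \<Sum>j<nitems s.
      if owner s b = i \<and> \<not> brank s b > 0 then snd s 3 b j * ln (snd s 1 i j + snd s 9 i 0 + snd s 8 i 0) else 0)"
    by (auto simp: J_def f10_def f11_def f12_def sum.cartesian_product)
qed

lemma select_candidate_correct:
  fixes s :: memory and i :: nat
  defines "U \<equiv> \<lambda>i. snd s 8 i 0" and "R \<equiv> \<lambda>i. snd s 9 i 0"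
  defines "c \<equiv> \<lambda>i. ln ((2 * U i + R i) / (U i + R i))"
  defines "better \<equiv> \<lambda>i. snd s 11 i 0 < snd s 12 i 0 + c i / U i * (snd s 10 i 0 - R i) - c i"
  assumes "i < nagents s"
  shows "snd (den select_candidate s) 13 i 0 = (if better i then R i + U i else R i)"
    and "snd (den select_candidate s) 14 i 0 = (if better i then c i / U i else 0)"
proof -
  have "\<forall>i<nagents s. snd (den select_candidate s) 13 i 0 = (if better i then R i + U i else R i) \<and>
      snd (den select_candidate s) 14 i 0 = (if better i then c i / U i else 0)"
    unfolding select_candidate_def
  proof (rule den_for[where I = "\<lambda>k s'. \<forall>i<k. snd s' 13 i 0 = (if better i then R i + U i else R i) \<and>
      snd s' 14 i 0 = (if better i then c i / U i else 0)"], goal_cases)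
    case (2 k s1)
    have fr: "snd s1 8 = snd s 8" "snd s1 9 = snd s 9" "snd s1 10 = snd s 10" "snd s1 11 = snd s 11"
      "snd s1 12 = snd s 12"
      using agreeD[OF 2(3)] by simp_all
    show ?case using 2(2,4)
      by (simp add: fr upd3_def U_def R_def c_def better_def less_Suc_eq)
  qed auto
  then show "snd (den select_candidate s) 13 i 0 = (if better i then R i + U i else R i)"
    and "snd (den select_candidate s) 14 i 0 = (if better i then c i / U i else 0)"
    using assms by blast+
qed

lemma edge_weights_correct:
  fixes s :: memory
  shows "snd (den edge_weights s) 4 b j = (if b < nrows s \<and> j < nitems s then
    snd s 0 (owner s b) 0 * (if brank s b > 0 then snd s 14 (owner s b) 0 * snd s 1 (owner s b) j
       else ln (snd s 1 (owner s b) j + snd s 13 (owner s b) 0)) else snd s 4 b j)"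
proof -
  define F where "F = (\<lambda>b j. snd s 0 (owner s b) 0 * (if brank s b > 0 then snd s 14 (owner s b) 0 * snd s 1 (owner s b) j
       else ln (snd s 1 (owner s b) j + snd s 13 (owner s b) 0)))"
  have "\<forall>b j. snd (den edge_weights s) 4 b j = (if (b, j) \<in> {..<nrows s} \<times> {..<nitems s} then F b j else snd s 4 b j)"
    unfolding edge_weights_def
  proof (rule den_for_pairs[where J = "\<lambda>S s'. \<forall>b j. snd s' 4 b j = (if (b, j) \<in> S then F b j else snd s 4 b j)"], goal_cases)
    case (4 k l S s1)
    have fr: "snd s1 0 = snd s 0" "snd s1 1 = snd s 1" "snd s1 13 = snd s 13" "snd s1 14 = snd s 14"
      "snd s1 5 = snd s 5" "fst s1 6 = fst s 6"
      using agreeD[OF 4(5)] by simp_all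
    show ?case using 4(3,4,7,8) by (auto simp: fr upd3_def F_def)
  qed auto
  then show ?thesis by (simp add: F_def)
qed

text \<open>Each item's column has at most one positive entry, so no later write destroys the owner
  found.\<close>

lemma read_off_correct:
  fixes s :: memory
  assumes "\<And>b b' j. j < nitems s \<Longrightarrow> b < nrows s \<Longrightarrow> b' < nrows s \<Longrightarrow> snd s 3 b j > 0 \<Longrightarrow> snd s 3 b' j > 0 \<Longrightarrow> b = b'"
    and "b < nrows s" "j < nitems s" "snd s 3 b j > 0"
  shows "fst (den read_off s) 3 j 0 = owner s b"
proof -
  define J where "J = (\<lambda>S (s'::memory). \<forall>b j. (b, j) \<in> S \<and> snd s 3 b j > 0 \<longrightarrow> fst s' 3 j 0 = owner s b)"
  have "J ({..<nrows s} \<times> {..<nitems s}) (den read_off s)"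
    unfolding read_off_def
  proof (rule den_for_pairs, goal_cases)
    case (4 k l S s1)
    have fr: "snd s1 3 = snd s 3" "fst s1 6 = fst s 6"
      using agreeD[OF 4(5)] by simp_all
    have uniq: "b = k" if "(b, l) \<in> S" "snd s 3 b l > 0" "snd s 3 k l > 0" for b
      using assms(1)[of l b k] that 4(1,2,6) by auto
    show ?case
      using 4(3,4,8) uniq unfolding J_def by (auto simp: fr upd3_def)
  qed (auto simp: J_def)
  with assms(2-4) show ?thesis by (auto simp: J_def)
qed

declare One_nat_def [simp]

section \<open>The rounding guarantee\<close>

text \<open>Intermediate values: at the smallest value \<open>lo\<close> all minima equal
  \<open>lo\<close>, and mass at least 1 makes the left side at least \<open>lo\<close>; at
  \<open>hi\<close> the left side is bounded by the untruncated sum, which is at most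
  \<open>hi\<close>.\<close>

lemma is_level_level:
  assumes fin: "finite (items_of E i)" and x: "\<And>j. (i, j) \<in> E \<Longrightarrow> x i j \<ge> 0"
    and mass: "(\<Sum>j\<in>items_of E i. x i j) \<ge> 1" and v: "\<And>j. (i, j) \<in> E \<Longrightarrow> v i j > 0"
  shows "is_level E v x i (level E v x i)"
proof -
  let ?I = "items_of E i"
  have ne: "?I \<noteq> {}" using mass by auto
  define F where "F h = (\<Sum>j\<in>?I. min (v i j) h * x i j) - h" for h
  define lo where "lo = Min (v i ` ?I)"
  define hi where "hi = max lo (\<Sum>j\<in>?I. v i j * x i j)"
  have lo_le: "lo \<le> v i j" if "j \<in> ?I" for j using that fin by (simp add: lo_def)
  have "lo \<in> v i ` ?I" unfolding lo_def using fin ne by (intro Min_in) auto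
  then have "lo > 0" using v by (auto simp: items_of_def)
  have "lo * 1 \<le> lo * (\<Sum>j\<in>?I. x i j)" using mass \<open>lo > 0\<close> by (intro mult_left_mono) auto
  then have "F lo \<ge> 0" using lo_le by (simp add: F_def sum_distrib_left min_absorb2)
  moreover have "F hi \<le> 0"
  proof -
    have "(\<Sum>j\<in>?I. min (v i j) hi * x i j) \<le> (\<Sum>j\<in>?I. v i j * x i j)"
      using x by (intro sum_mono mult_right_mono) (auto simp: items_of_def)
    then show ?thesis by (simp add: F_def hi_def)
  qed
  moreover have "continuous_on {lo..hi} F" unfolding F_def by (intro continuous_intros)
  moreover have "lo \<le> hi" by (simp add: hi_def)
  ultimately obtain h where "lo \<le> h" "F h = 0" using IVT2'[of F hi 0 lo] by auto
  with \<open>lo > 0\<close> have "is_level E v x i h" by (simp add: is_level_def F_def)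
  then show ?thesis unfolding level_def by (rule someI)
qed

section \<open>Rows of the matrix as pairs of agent and bucket\<close>

lemma sum_rows:
  fixes f :: "nat \<Rightarrow> 'c::comm_monoid_add"
  shows "(\<Sum>b<n * m. f b) = (\<Sum>i<n. \<Sum>k<m. f (i * m + k))"
proof -
  have "(\<Sum>b<n * m. f b) = (\<Sum>i<n. sum f {i * m..<i * m + m})"
    by (rule sum.nat_group[symmetric])
  also have "\<dots> = (\<Sum>i<n. \<Sum>k<m. f (i * m + k))"
  proof (rule sum.cong[OF refl])
    fix i
    show "sum f {i * m..<i * m + m} = (\<Sum>k<m. f (i * m + k))"
      using sum.shift_bounds_nat_ivl[of f 0 "i * m" m] by (simp add: lessThan_atLeast0 add.commute)
  qed
  finally show ?thesis .
qed

lemma row_less: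
  fixes m :: nat
  assumes "i < n" "k < m"
  shows "i * m + k < n * m"
proof -
  have "i * m + k < Suc i * m" using assms(2) by simp
  also have "\<dots> \<le> n * m" using assms(1) by (intro mult_le_mono1) simp
  finally show ?thesis .
qed

locale fractional_instance =
  fixes n m :: nat and E :: "(nat \<times> nat) set" and w :: "nat \<Rightarrow> real" and v x :: "nat \<Rightarrow> nat \<Rightarrow> real"
  assumes inst: "nsw_instance {..<n} {..<m} E w v" and feas: "cp_feasible {..<n} {..<m} E x"
begin

text \<open>Extension by 0 outside \<open>E\<close> matches the contents of the input memory and
  gives all agents the index set \<open>{..<m}\<close>.\<close>

definition val :: "nat \<Rightarrow> nat \<Rightarrow> real" where "val i j = (if (i, j) \<in> E then v i j else 0)"
definition amt :: "nat \<Rightarrow> nat \<Rightarrow> real" where "amt i j = (if (i, j) \<in> E then x i j else 0)"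
definition share :: "nat \<Rightarrow> nat \<Rightarrow> nat \<Rightarrow> real" where "share i = bucket_share {..<m} (val i) (amt i)"

lemma E_bounds: "(i, j) \<in> E \<Longrightarrow> i < n \<and> j < m"
  using inst by (auto simp: nsw_instance_def)

lemma v_pos: "(i, j) \<in> E \<Longrightarrow> v i j > 0"
  using inst by (auto simp: nsw_instance_def)

lemma x_nonneg: "(i, j) \<in> E \<Longrightarrow> x i j \<ge> 0"
  using feas by (auto simp: cp_feasible_def)

lemma amt_nonneg: "amt i j \<ge> 0"
  using x_nonneg by (simp add: amt_def)

lemma val_pos: "amt i j > 0 \<Longrightarrow> val i j > 0"
  using v_pos by (auto simp: amt_def val_def split: if_splits)

lemma w_pos: "i < n \<Longrightarrow> w i > 0" and sum_w: "(\<Sum>i<n. w i) = 1"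
  using inst by (auto simp: nsw_instance_def)

lemma sum_items: "(\<Sum>j\<in>items_of E i. f j) = (\<Sum>j<m. if (i, j) \<in> E then f j else 0)"
proof -
  have "items_of E i = {j\<in>{..<m}. (i, j) \<in> E}" using E_bounds by (auto simp: items_of_def)
  then show ?thesis using sum.inter_filter[of "{..<m}" f "\<lambda>j. (i, j) \<in> E"] by simp
qed

lemma amt_mass: "i < n \<Longrightarrow> (\<Sum>j<m. amt i j) \<ge> 1"
proof -
  assume "i < n"
  then have "(\<Sum>j\<in>items_of E i. x i j) \<ge> 1" using feas by (simp add: cp_feasible_def)
  then show ?thesis using sum_items[where i = i and f = "x i"] by (simp add: amt_def)
qed

lemma amt_column: "j < m \<Longrightarrow> (\<Sum>i<n. amt i j) = 1"
proof -
  assume "j < m"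
  then have "(\<Sum>i\<in>agents_of E j. x i j) = 1" using feas by (simp add: cp_feasible_def)
  moreover have "agents_of E j = {i\<in>{..<n}. (i, j) \<in> E}" using E_bounds by (auto simp: agents_of_def)
  ultimately show ?thesis
    using sum.inter_filter[of "{..<n}" "\<lambda>i. x i j" "\<lambda>i. (i, j) \<in> E"] by (simp add: amt_def)
qed

lemma amt_le_1: "i < n \<Longrightarrow> j < m \<Longrightarrow> amt i j \<le> 1"
  using member_le_sum[of i "{..<n}" "\<lambda>i. amt i j"] amt_nonneg amt_column by simp

lemma amt_mass_le: "i < n \<Longrightarrow> (\<Sum>j<m. amt i j) \<le> real m"
  using sum_bounded_above[of "{..<m}" "amt i" 1] amt_le_1 by simp

lemma share_buckets: "i < n \<Longrightarrow> buckets {..<m} (val i) (share i) m"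
  unfolding share_def using amt_nonneg amt_mass amt_mass_le val_pos
  by (intro buckets_bucket_share) auto

lemma share_total: "i < n \<Longrightarrow> j < m \<Longrightarrow> (\<Sum>k<m. share i k j) = amt i j"
  unfolding share_def using amt_nonneg amt_mass amt_mass_le val_pos
  by (intro bucket_share_total) auto

lemma share_pos_edge: "i < n \<Longrightarrow> j < m \<Longrightarrow> share i k j > 0 \<Longrightarrow> (i, j) \<in> E"
  using bucket_share_posD(3)[of "{..<m}" "amt i" m "val i" k j] amt_nonneg amt_mass amt_mass_le val_pos
  by (auto simp: share_def amt_def split: if_splits)

abbreviation "Shift i \<equiv> buckets.shift {..<m} (val i) (share i) m"
abbreviation "Rate i \<equiv> buckets.rate {..<m} (val i) (share i) m"
abbreviation "Offset i \<equiv> buckets.offset {..<m} (val i) (share i) m"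
abbreviation "Best i \<equiv> max (buckets.E0 {..<m} (val i) (share i) m) (buckets.E1 {..<m} (val i) (share i) m)"

lemma agent_obj_le: "i < n \<Longrightarrow> agent_obj E v x i - 1 / exp 1 \<le> Best i"
proof -
  assume i: "i < n"
  interpret A: buckets "{..<m}" "val i" "share i" m by (rule share_buckets[OF i])
  define h where "h = level E v x i"
  have fin: "finite (items_of E i)"
    by (rule finite_subset[of _ "{..<m}"]) (use E_bounds in \<open>auto simp: items_of_def\<close>)
  have "is_level E v x i h"
    unfolding h_def using fin x_nonneg v_pos feas i
    by (intro is_level_level) (auto simp: cp_feasible_def)
  then have h: "h > 0" "(\<Sum>j\<in>items_of E i. min (v i j) h * x i j) = h" by (auto simp: is_level_def)
  have tot: "(\<Sum>k<m. share i k j) = amt i j" if "j \<in> {..<m}" for j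
    using share_total[OF i] that by simp
  have "(\<Sum>j<m. min (val i j) h * (\<Sum>k<m. share i k j)) = (\<Sum>j\<in>items_of E i. min (v i j) h * x i j)"
    unfolding sum_items by (intro sum.cong refl) (simp add: tot val_def amt_def)
  from A.surrogate_bound[OF h(1) trans[OF this h(2)]]
  have "Best i \<ge> (\<Sum>j\<in>{j\<in>{..<m}. val i j > h}. (\<Sum>k<m. share i k j) * ln (val i j / h)) + ln h - 1 / exp 1" .
  also have "{j\<in>{..<m}. val i j > h} = {j\<in>items_of E i. v i j > h}"
    using h(1) E_bounds by (auto simp: val_def items_of_def split: if_splits)
  also have "(\<Sum>j\<in>{j\<in>items_of E i. v i j > h}. (\<Sum>k<m. share i k j) * ln (val i j / h))
      = (\<Sum>j\<in>{j\<in>items_of E i. v i j > h}. x i j * ln (v i j / h))"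
    using E_bounds by (intro sum.cong refl) (auto simp: tot val_def amt_def items_of_def)
  finally show ?thesis by (simp add: agent_obj_def h_def)
qed

lemma m_pos: "m > 0"
proof -
  have "n > 0" using sum_w by (cases n) auto
  then show ?thesis using amt_mass[of 0] by (cases m) auto
qed

definition Y0 :: "nat \<Rightarrow> nat \<Rightarrow> real" where
  "Y0 b j = (if j = m then 1 - (\<Sum>j<m. share (b div m) (b mod m) j) else share (b div m) (b mod m) j)"

definition weight :: "nat \<Rightarrow> nat \<Rightarrow> real" where
  "weight b j = (if j = m then 0 else w (b div m) *
     (if b mod m > 0 then Rate (b div m) * val (b div m) j else ln (val (b div m) j + Shift (b div m))))"

lemma row_div: "b < n * m \<Longrightarrow> b div m < n"
  by (simp add: less_mult_imp_div_less)

text \<open>Rows sum to 1 through the slack column, and item columns sum to 1 by feasibility. The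
  slack column is left with \<open>n * m - m\<close>, again an integer.\<close>

lemma int_margins_Y0: "int_margins (n * m) (m + 1) Y0"
proof -
  have rows: "(\<Sum>j<m. share (b div m) (b mod m) j) \<le> 1" "\<And>j. j < m \<Longrightarrow> share (b div m) (b mod m) j \<ge> 0"
    if "b < n * m" for b
  proof -
    interpret A: buckets "{..<m}" "val (b div m)" "share (b div m)" m
      by (rule share_buckets[OF row_div[OF that]])
    show "(\<Sum>j<m. share (b div m) (b mod m) j) \<le> 1" by (rule A.sum_le_1)
    show "\<And>j. j < m \<Longrightarrow> share (b div m) (b mod m) j \<ge> 0" using A.y_nonneg by simp
  qed
  have col: "(\<Sum>b<n * m. share (b div m) (b mod m) j) = 1" if "j < m" for j
  proof -
    have "(\<Sum>b<n * m. share (b div m) (b mod m) j) = (\<Sum>i<n. \<Sum>k<m. share i k j)"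
      unfolding sum_rows by (intro sum.cong refl) simp
    also have "\<dots> = (\<Sum>i<n. amt i j)" using share_total that by (intro sum.cong) auto
    finally show ?thesis using amt_column[OF that] by simp
  qed
  have "0 \<le> Y0 b j \<and> Y0 b j \<le> 1" if b: "b < n * m" and j: "j < m + 1" for b j
  proof (cases "j = m")
    case True
    then show ?thesis using rows[OF b] sum_nonneg[of "{..<m}" "share (b div m) (b mod m)"]
      by (auto simp: Y0_def)
  next
    case False
    then have "j < m" using j by simp
    then show ?thesis
      using rows[OF b] member_le_sum[of j "{..<m}" "share (b div m) (b mod m)"] by (auto simp: Y0_def)
  qed
  moreover have "(\<Sum>j<m + 1. Y0 b j) = 1" for b by (simp add: Y0_def)
  moreover have "(\<Sum>b<n * m. Y0 b j) \<in> \<int>" if "j < m + 1" for j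
  proof (cases "j = m")
    case True
    have "(\<Sum>b<n * m. Y0 b m) = real (n * m) - (\<Sum>b<n * m. \<Sum>j<m. share (b div m) (b mod m) j)"
      by (simp add: Y0_def sum_subtractf)
    also have "(\<Sum>b<n * m. \<Sum>j<m. share (b div m) (b mod m) j) = (\<Sum>j<m. \<Sum>b<n * m. share (b div m) (b mod m) j)"
      by (rule sum.swap)
    also have "\<dots> = real m" using col by simp
    finally show ?thesis using True by simp
  next
    case False
    then show ?thesis using col[of j] that by (simp add: Y0_def)
  qed
  ultimately show ?thesis by (simp add: int_margins_def)
qed

text \<open>Row \<open>i * m\<close> is the first bucket of agent \<open>i\<close> and carries the
  logarithmic weights; the agent's other rows form the sum multiplied by \<open>Rate i\<close>. The
  matrix objective is thus the weighted sum of the chosen bounds up to their offsets.\<close>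

lemma weighted_rows:
  assumes "\<And>i k j. i < n \<Longrightarrow> k < m \<Longrightarrow> j < m \<Longrightarrow> Y (i * m + k) j = y i k j"
  shows "(\<Sum>b<n * m. \<Sum>j<m + 1. weight b j * Y b j) =
    (\<Sum>i<n. w i * ((\<Sum>j<m. y i 0 j * ln (val i j + Shift i))
      + Rate i * (\<Sum>k\<in>{1..<m}. \<Sum>j<m. y i k j * val i j)))"
proof -
  have first: "(\<Sum>k<m. F k) = F 0 + (\<Sum>k\<in>{1..<m}. F k)" for F :: "nat \<Rightarrow> real"
    using sum.atLeast_Suc_lessThan[OF m_pos, of F] by (simp add: lessThan_atLeast0)
  have "(\<Sum>b<n * m. \<Sum>j<m + 1. weight b j * Y b j) =
      (\<Sum>i<n. \<Sum>k<m. \<Sum>j<m. weight (i * m + k) j * Y (i * m + k) j)"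
    unfolding sum_rows by (simp add: weight_def)
  also have "\<dots> = (\<Sum>i<n. w i * ((\<Sum>j<m. y i 0 j * ln (val i j + Shift i))
      + Rate i * (\<Sum>k\<in>{1..<m}. \<Sum>j<m. y i k j * val i j)))"
  proof (intro sum.cong refl)
    fix i assume "i \<in> {..<n}"
    then have "(\<Sum>k<m. \<Sum>j<m. weight (i * m + k) j * Y (i * m + k) j) =
      (\<Sum>k<m. \<Sum>j<m. w i * (if k > 0 then Rate i * val i j else ln (val i j + Shift i)) * y i k j)"
      using assms by (intro sum.cong refl) (auto simp: weight_def)
    also have "\<dots> = (\<Sum>j<m. w i * ln (val i j + Shift i) * y i 0 j) +
        (\<Sum>k\<in>{1..<m}. \<Sum>j<m. w i * (if k > 0 then Rate i * val i j else ln (val i j + Shift i)) * y i k j)"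
      by (subst first) simp
    also have "(\<Sum>k\<in>{1..<m}. \<Sum>j<m. w i * (if k > 0 then Rate i * val i j else ln (val i j + Shift i)) * y i k j)
      = (\<Sum>k\<in>{1..<m}. \<Sum>j<m. w i * (Rate i * (y i k j * val i j)))"
      by (intro sum.cong refl) auto
    finally show "(\<Sum>k<m. \<Sum>j<m. weight (i * m + k) j * Y (i * m + k) j) =
      w i * ((\<Sum>j<m. y i 0 j * ln (val i j + Shift i)) + Rate i * (\<Sum>k\<in>{1..<m}. \<Sum>j<m. y i k j * val i j))"
      unfolding distrib_left sum_distrib_left by (simp only: mult_ac)
  qed
  finally show ?thesis .
qed

theorem rounding:
  assumes prog: "rounding_progress (n * m) (m + 1) weight Y0 Z"
    and int: "fracs (n * m) (m + 1) Z = {}"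
    and \<rho>: "\<rho> \<in> extensional {..<m}"
    and \<rho>_Z: "\<And>b j. b < n * m \<Longrightarrow> j < m \<Longrightarrow> Z b j > 0 \<Longrightarrow> \<rho> j = b div m"
  shows "\<rho> \<in> allocations {..<m} E"
    and "nsw {..<n} {..<m} w v \<rho> \<ge> exp (- 1 / exp 1) * exp (cp_obj {..<n} E w v x)"
proof -
  have Z01: "Z b j = 0 \<or> Z b j = 1 \<and> Y0 b j > 0" if "b < n * m" "j < m + 1" for b j
  proof (cases "Z b j = 0")
    case False
    have "0 \<le> Z b j" "Z b j \<le> 1" using prog that by (auto simp: rounding_progress_def int_margins_def)
    moreover have "\<not> fractional (Z b j)" using int that by (auto simp: fracs_def)
    ultimately have "Z b j = 1" using False by (auto simp: fractional_def)
    moreover have "Y0 b j \<noteq> 0" using prog that False by (auto simp: rounding_progress_def)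
    moreover have "Y0 b j \<ge> 0" using int_margins_Y0 that by (simp add: int_margins_def)
    ultimately show ?thesis by simp
  qed simp
  have row: "(\<Sum>j<m. Z b j) = 1 - Z b m" if "b < n * m" for b
  proof -
    have "(\<Sum>j<m + 1. Z b j) = (\<Sum>j<m + 1. Y0 b j)" using prog that by (simp add: rounding_progress_def)
    also have "\<dots> = 1" by (simp add: Y0_def)
    finally show ?thesis by simp
  qed
  have col: "(\<Sum>b<n * m. Z b j) = 1" if "j < m" for j
  proof -
    have "(\<Sum>b<n * m. Z b j) = (\<Sum>b<n * m. Y0 b j)" using prog that by (simp add: rounding_progress_def)
    also have "\<dots> = (\<Sum>i<n. \<Sum>k<m. share i k j)"
      unfolding sum_rows using that by (intro sum.cong refl) (simp add: Y0_def)
    also have "\<dots> = (\<Sum>i<n. amt i j)" using share_total that by (intro sum.cong) auto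
    finally show ?thesis using amt_column[OF that] by simp
  qed
  \<comment> \<open>Without the cutoff, \<open>i * m + k\<close> with \<open>k >= m\<close> would
    point into the rows of another agent.\<close>
  define z where "z i k j = (if k < m then Z (i * m + k) j else 0)" for i k j
  \<comment> \<open>The column sums to 1 and agents other than \<open>\<rho> j\<close> contribute 0,
    so the whole unit sits in the buckets of \<open>\<rho> j\<close>.\<close>
  have assigned: "(\<Sum>k<m. z i k j) = of_bool (\<rho> j = i)" if "i < n" "j < m" for i j
  proof -
    have nonneg: "(\<Sum>k<m. z i k j) \<ge> 0" if "i < n" for i
      using Z01[OF row_less[OF that], of _ j] \<open>j < m\<close> by (intro sum_nonneg) (force simp: z_def)
    have zero: "(\<Sum>k<m. z i k j) = 0" if "i < n" "\<rho> j \<noteq> i" for i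
    proof (intro sum.neutral ballI)
      fix k assume k: "k \<in> {..<m}"
      then have "\<not> Z (i * m + k) j > 0" using \<rho>_Z[OF row_less[of i n k m]] that \<open>j < m\<close> by auto
      then show "z i k j = 0" using Z01[OF row_less[of i n k m], of j] that k \<open>j < m\<close> by (auto simp: z_def)
    qed
    have "(\<Sum>i<n. \<Sum>k<m. z i k j) = 1"
      using col[OF \<open>j < m\<close>] unfolding sum_rows by (simp add: z_def)
    then have "(\<Sum>k<m. z i k j) + (\<Sum>i\<in>{..<n} - {i}. \<Sum>k<m. z i k j) = 1"
      using \<open>i < n\<close> by (simp add: sum.remove)
    moreover have "(\<Sum>i\<in>{..<n} - {i}. \<Sum>k<m. z i k j) = 0" if "\<rho> j = i"
      using zero that by (intro sum.neutral) auto
    ultimately show ?thesis using zero[OF \<open>i < n\<close>] by (cases "\<rho> j = i") auto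
  qed
  have edge: "(\<rho> j, j) \<in> E" if j: "j < m" for j
  proof -
    obtain b where b: "b < n * m" "Z b j \<noteq> 0"
      using col[OF j] by (metis lessThan_iff sum.neutral zero_neq_one)
    then have "Z b j = 1" "Y0 b j > 0" using Z01[of b j] j by auto
    then have "\<rho> j = b div m" "share (b div m) (b mod m) j > 0"
      using \<rho>_Z[OF b(1) j] j by (auto simp: Y0_def)
    then show ?thesis using share_pos_edge[OF row_div[OF b(1)] j] by simp
  qed
  show "\<rho> \<in> allocations {..<m} E"
    using \<rho> edge by (auto simp: allocations_def agents_of_def PiE_def)
  define V where "V i = (\<Sum>k<m. \<Sum>j<m. z i k j * val i j)" for i
  define S where "S y i = (\<Sum>j<m. y i 0 j * ln (val i j + Shift i))
      + Rate i * (\<Sum>k\<in>{1..<m}. \<Sum>j<m. y i k j * val i j)" for y :: "nat \<Rightarrow> nat \<Rightarrow> nat \<Rightarrow> real" and i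
  have V_nsw: "(\<Sum>j\<in>{j\<in>{..<m}. \<rho> j = i}. v i j) = V i" if i: "i < n" for i
  proof -
    have "V i = (\<Sum>j<m. (\<Sum>k<m. z i k j) * val i j)"
      unfolding V_def by (subst sum.swap) (simp add: sum_distrib_right)
    also have "\<dots> = (\<Sum>j<m. if \<rho> j = i then v i j else 0)"
      using edge assigned[OF i] by (intro sum.cong) (auto simp: val_def)
    finally show ?thesis
      using sum.inter_filter[of "{..<m}" "\<lambda>j. v i j" "\<lambda>j. \<rho> j = i"] by simp
  qed
  have agent: "V i > 0" "S z i - Offset i \<le> ln (V i)" "S share i - Offset i = Best i" if i: "i < n" for i
  proof -
    interpret A: buckets "{..<m}" "val i" "share i" m by (rule share_buckets[OF i])
    have "S share i - Offset i = Best i"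
      using A.surrogate_fractional by (simp add: S_def A.B_def)
    then show "S share i - Offset i = Best i" .
    have z01: "z i k j = 0 \<or> z i k j = 1 \<and> share i k j > 0" if "j \<in> {..<m}" for k j
    proof (cases "k < m")
      case True
      then show ?thesis using Z01[OF row_less[OF i True], of j] that by (auto simp: z_def Y0_def)
    qed (simp add: z_def)
    have row_z: "(\<Sum>j<m. z i k j) = 1 - Z (i * m + k) m" "Y0 (i * m + k) m = 1 - (\<Sum>j<m. share i k j)"
      "Z (i * m + k) m = 0 \<or> Z (i * m + k) m = 1 \<and> Y0 (i * m + k) m > 0" if "k < m" for k
      using row[OF row_less[OF i that]] Z01[OF row_less[OF i that], of m] that
      by (auto simp: z_def Y0_def)
    have le: "(\<Sum>j<m. z i k j) \<le> 1" for k
      by (cases "k < m") (use row_z[of k] in \<open>auto simp: z_def\<close>)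
    \<comment> \<open>A full bucket has slack 0 in \<open>Y0\<close>. Zeros are preserved, so the
      slack is still 0 in \<open>Z\<close> and the row sum 1 must come from an item.\<close>
    have full: "(\<Sum>j<m. z i k j) = 1" if "(\<Sum>j<m. share i k j) = 1" for k
    proof -
      have "k < m" using that A.y_beyond[of _ k] by (cases "k < m") auto
      then show ?thesis using row_z[of k] that by auto
    qed
    have V: "A.V (z i) = V i" unfolding V_def by (rule A.V_def[OF z01 le full])
    have X: "A.X (z i) = (\<Sum>k\<in>{1..<m}. \<Sum>j<m. z i k j * val i j)" by (rule A.X_def[OF z01 le full])
    show "V i > 0" using A.V_pos[OF z01 le full] unfolding V .
    show "S z i - Offset i \<le> ln (V i)"
      using A.surrogate_integral[OF z01 le full] unfolding V X S_def .
  qed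
  have obj: "(\<Sum>i<n. w i * S share i) \<le> (\<Sum>i<n. w i * S z i)"
  proof -
    have "(\<Sum>b<n * m. \<Sum>j<m + 1. weight b j * Y0 b j) \<le> (\<Sum>b<n * m. \<Sum>j<m + 1. weight b j * Z b j)"
      using prog by (simp add: rounding_progress_def)
    moreover have "(\<Sum>b<n * m. \<Sum>j<m + 1. weight b j * Y0 b j) = (\<Sum>i<n. w i * S share i)"
      unfolding S_def by (rule weighted_rows) (simp add: Y0_def)
    moreover have "(\<Sum>b<n * m. \<Sum>j<m + 1. weight b j * Z b j) = (\<Sum>i<n. w i * S z i)"
      unfolding S_def by (rule weighted_rows) (simp add: z_def)
    ultimately show ?thesis by simp
  qed
  \<comment> \<open>The weights sum to 1, so the losses of \<open>1 / exp 1\<close> for the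
    individual agents average to the same amount.\<close>
  have "cp_obj {..<n} E w v x - 1 / exp 1 = (\<Sum>i<n. w i * (agent_obj E v x i - 1 / exp 1))"
    using sum_w by (simp add: cp_obj_def right_diff_distrib sum_subtractf flip: sum_divide_distrib)
  also have "\<dots> \<le> (\<Sum>i<n. w i * Best i)"
    using agent_obj_le w_pos by (intro sum_mono mult_left_mono) (auto intro: less_imp_le)
  also have "\<dots> = (\<Sum>i<n. w i * S share i) - (\<Sum>i<n. w i * Offset i)"
    unfolding sum_subtractf[symmetric] right_diff_distrib[symmetric] using agent(3) by (intro sum.cong) auto
  also have "\<dots> \<le> (\<Sum>i<n. w i * S z i) - (\<Sum>i<n. w i * Offset i)" using obj by simp
  also have "\<dots> = (\<Sum>i<n. w i * (S z i - Offset i))"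
    by (simp add: right_diff_distrib sum_subtractf)
  also have "\<dots> \<le> (\<Sum>i<n. w i * ln (V i))"
    using agent(2) w_pos by (intro sum_mono mult_left_mono) (auto intro: less_imp_le)
  finally have "exp (cp_obj {..<n} E w v x - 1 / exp 1) \<le> exp (\<Sum>i<n. w i * ln (V i))" by simp
  also have "\<dots> = nsw {..<n} {..<m} w v \<rho>"
    unfolding nsw_def exp_sum[OF finite_lessThan]
  proof (intro prod.cong refl)
    fix i assume i: "i \<in> {..<n}"
    show "exp (w i * ln (V i)) = (\<Sum>j\<in>{j\<in>{..<m}. \<rho> j = i}. v i j) powr w i"
      using V_nsw[of i] agent(1)[of i] i by (simp add: powr_def)
  qed
  finally show "nsw {..<n} {..<m} w v \<rho> \<ge> exp (- 1 / exp 1) * exp (cp_obj {..<n} E w v x)"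
    by (simp flip: exp_add)
qed

end

section \<open>The rounding algorithm\<close>

declare One_nat_def [simp del]

definition preprocess :: lprog where
  "preprocess = LSeq prefix_sums (LSeq fill_rows (LSeq fill_slack (LSeq row_maxima
     (LSeq tail_maxima (LSeq candidates (LSeq select_candidate edge_weights))))))"

text \<open>\<open>init_rows\<close> is kept apart because it writes cells 4 and 5, which bound
  loops here, while \<open>runs_compile\<close> requires that bounds are not written.\<close>

definition round_rows :: lprog where
  "round_rows = LSeq preprocess (LSeq cancel read_off)"

lemmas program_defs = cancel_defs cancel_def preprocess_def round_rows_def init_rows_def
  prefix_sums_def fill_rows_def clamp_def fill_slack_def row_maxima_def addown_def tail_maxima_def
  candidates_def select_candidate_def edge_weights_def read_off_def

section \<open>Correctness of the complete program\<close>

context fractional_instance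
begin

abbreviation "s0 \<equiv> input_memory n m E w v x"

lemma input_simps:
  "fst s0 0 0 0 = n" "fst s0 1 0 0 = m" "fst s0 4 0 0 = 0" "i < n \<Longrightarrow> snd s0 0 i 0 = w i"
  "snd s0 1 = val" "snd s0 2 = amt" "a > 2 \<Longrightarrow> snd s0 a i j = 0"
  by (auto simp: input_memory_def val_def amt_def fun_eq_iff)

lemma preprocess_correct:
  defines "s \<equiv> den preprocess (den init_rows s0)"
  shows "nrows s = n * m" "ncols s = m + 1" "nitems s = m"
    and "b < n * m \<Longrightarrow> owner s b = b div m"
    and "b < n * m \<Longrightarrow> j < m + 1 \<Longrightarrow> snd s 3 b j = Y0 b j"
    and "b < n * m \<Longrightarrow> j < m + 1 \<Longrightarrow> snd s 4 b j = weight b j"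
proof -
  define s1 where "s1 = den init_rows s0"
  define s2 where "s2 = den prefix_sums s1"
  define s3 where "s3 = den fill_rows s2"
  define s4 where "s4 = den fill_slack s3"
  define s5 where "s5 = den row_maxima s4"
  define s6 where "s6 = den tail_maxima s5"
  define s7 where "s7 = den candidates s6"
  define s8 where "s8 = den select_candidate s7"
  have s: "s = den edge_weights s8"
    by (simp add: s_def preprocess_def s1_def s2_def s3_def s4_def s5_def s6_def s7_def s8_def)
  have fi: "fst s1 a = fst s0 a" if "a \<in> {0, 1}" for a
    unfolding s1_def using that by (intro den_frame_int) (auto simp: program_defs)
  have fr1: "snd s1 a = snd s0 a" if "a \<notin> {5, 17}" for a
    unfolding s1_def using that by (intro den_frame_real) (auto simp: program_defs)
  \<comment> \<open>The data that stays fixed during preprocessing: the low integer arrays, the real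
    input arrays and the ranks. One predicate replaces frame facts for every phase and
    array.\<close>
  define ok where "ok s' \<longleftrightarrow> (\<forall>a<10. fst s' a = fst s1 a) \<and> (\<forall>a\<in>{0, 1, 2, 5}. snd s' a = snd s1 a)" for s' :: memory
  have ok1: "ok s1" by (simp add: ok_def)
  have ok_den: "ok (den p s')"
    if "ok s'" "\<forall>a\<in>iwrites p. 10 \<le> a" "\<forall>a\<in>{0, 1, 2, 5}. a \<notin> rwrites p" for p s'
  proof -
    have "a \<notin> iwrites p" if "a < 10" for a using that \<open>\<forall>a\<in>iwrites p. 10 \<le> a\<close> by force
    then show ?thesis using that by (auto simp: ok_def den_frame_int den_frame_real)
  qed
  have ok2: "ok s2" unfolding s2_def by (rule ok_den[OF ok1]) (auto simp: program_defs)
  have ok3: "ok s3" unfolding s3_def by (rule ok_den[OF ok2]) (auto simp: program_defs)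
  have ok4: "ok s4" unfolding s4_def by (rule ok_den[OF ok3]) (auto simp: program_defs)
  have ok5: "ok s5" unfolding s5_def by (rule ok_den[OF ok4]) (auto simp: program_defs)
  have ok6: "ok s6" unfolding s6_def by (rule ok_den[OF ok5]) (auto simp: program_defs)
  have ok7: "ok s7" unfolding s7_def by (rule ok_den[OF ok6]) (auto simp: program_defs)
  have ok8: "ok s8" unfolding s8_def by (rule ok_den[OF ok7]) (auto simp: program_defs)
  have ok9: "ok s" unfolding s by (rule ok_den[OF ok8]) (auto simp: program_defs)
  have int: "fst s' 0 0 0 = n" "fst s' 1 0 0 = m" "fst s' 4 0 0 = n * m" "fst s' 5 0 0 = m + 1"
    if "ok s'" for s'
    using that fi[of 0] fi[of 1] init_rows_correct(1,2)[of s0]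
    by (simp_all add: ok_def input_simps s1_def)
  have own: "fst s' 6 b 0 = b div m" if "b < n * m" "ok s'" for s' b
    using that init_rows_correct(3)[of s0 b] by (simp add: ok_def input_simps s1_def)
  have fr2: "snd s2 a = snd s1 a" if "a \<noteq> 6" for a
    unfolding s2_def using that by (intro den_frame_real) (auto simp: program_defs)
  have fr3: "snd s3 a = snd s2 a" if "a \<notin> {3, 15, 16}" for a
    unfolding s3_def using that by (intro den_frame_real) (auto simp: program_defs)
  have fr4: "snd s4 a = snd s3 a" if "a \<noteq> 3" for a
    unfolding s4_def using that by (intro den_frame_real) (auto simp: program_defs)
  have fr5: "snd s5 a = snd s4 a" if "a \<noteq> 7" for a
    unfolding s5_def using that by (intro den_frame_real) (auto simp: program_defs)
  have fr6: "snd s6 a = snd s5 a" if "a \<notin> {8, 9}" for a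
    unfolding s6_def using that by (intro den_frame_real) (auto simp: program_defs)
  have fr7: "snd s7 a = snd s6 a" if "a \<notin> {10, 11, 12}" for a
    unfolding s7_def using that by (intro den_frame_real) (auto simp: program_defs)
  have fr8: "snd s8 a = snd s7 a" if "a \<notin> {13, 14, 15}" for a
    unfolding s8_def using that by (intro den_frame_real) (auto simp: program_defs)
  have fr9: "snd s a = snd s8 a" if "a \<noteq> 4" for a
    unfolding s using that by (intro den_frame_real) (auto simp: program_defs)
  have vals: "snd s' 1 = val" "snd s' 2 = amt" "i < n \<Longrightarrow> snd s' 0 i 0 = w i"
    if "ok s'" for s' i
    using that by (simp_all add: ok_def fr1 input_simps)
  have brank: "snd s' 5 b 0 = real (b mod m)" if "b < n * m" "ok s'" for s' b
    using that init_rows_correct(3)[of s0 b] by (simp add: ok_def input_simps s1_def)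
  have zero: "snd s1 a i j = 0" if "a > 2" "a \<notin> {5, 17}" for a i j
    using that fr1[of a] input_simps(7)[of a] by simp
  have prefix: "snd s2 6 i j = prefix_mass {..<m} (val i) (amt i) j" if "i < n" "j < m" for i j
    using prefix_sums_correct[of s1 i j] that zero[of 6] int[OF ok1] vals[OF ok1] by (simp add: s2_def)
  have Y3: "snd s3 3 b j = share (b div m) (b mod m) j" if b: "b < n * m" and j: "j < m" for b j
    using fill_rows_correct[of b s2 j "b mod m"] int[OF ok2] brank[OF b ok2] own[OF b ok2] vals[OF ok2]
      prefix[OF row_div[OF b] j] b j by (simp add: s3_def share_def bucket_share_def)
  have Y4: "snd s4 3 b j = Y0 b j" if b: "b < n * m" and j: "j < m + 1" for b j
  proof (cases "j = m")
    case True
    then show ?thesis using fill_slack_correct(1)[of b s3] int[OF ok3] Y3[OF b] b by (simp add: s4_def Y0_def)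
  next
    case False
    then show ?thesis using fill_slack_correct(2)[of b s3 j] int[OF ok3] Y3[OF b, of j] b j by (simp add: s4_def Y0_def)
  qed
  have Y6: "snd s6 3 = snd s4 3" and Y9: "snd s 3 = snd s4 3" by (simp_all add: fr5 fr6 fr7 fr8 fr9)
  show "nrows s = n * m" "ncols s = m + 1" "nitems s = m" using int[OF ok9] by auto
  show "owner s b = b div m" if "b < n * m" using own[OF that ok9] by simp
  show "snd s 3 b j = Y0 b j" if "b < n * m" "j < m + 1" using Y4[of b j] Y9 that by simp
  have mx: "snd s5 7 b 0 = buckets.maxval {..<m} (val (b div m)) (share (b div m)) (b mod m)"
    if b: "b < n * m" for b
  proof -
    interpret A: buckets "{..<m}" "val (b div m)" "share (b div m)" m
      by (rule share_buckets[OF row_div[OF b]])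
    have "snd s5 7 b 0 = Max (insert 0 (val (b div m) ` {j\<in>{..<m}. snd s4 3 b j > 0}))"
      using row_maxima_correct[of s4 b] int[OF ok4] vals[OF ok4] own[OF b ok4] zero[of 7] b
      by (simp add: s5_def fr2 fr3 fr4)
    also have "{j\<in>{..<m}. snd s4 3 b j > 0} = {j\<in>{..<m}. share (b div m) (b mod m) j > 0}"
      using Y4[OF b] by (auto simp: Y0_def)
    finally show ?thesis by (simp add: A.maxval_def)
  qed
  \<comment> \<open>Accumulation over all rows into the owner's cell amounts to a sum over that
    agent's own buckets.\<close>
  have agent_sum: "(\<Sum>b<n * m. if owner s' b = i \<and> P (brank s' b) then f b else 0)
      = (\<Sum>k<m. if P (real k) then f (i * m + k) else 0)"
    if s': "ok s'" and i: "i < n" for s' :: memory and i P and f :: "nat \<Rightarrow> real"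
  proof -
    have "(\<Sum>b<n * m. if owner s' b = i \<and> P (brank s' b) then f b else 0)
        = (\<Sum>b<n * m. if b div m = i \<and> P (real (b mod m)) then f b else 0)"
      using own brank s' by (intro sum.cong refl) simp
    also have "\<dots> = (\<Sum>i'<n. if i' = i then \<Sum>k<m. if P (real k) then f (i * m + k) else 0 else 0)"
      unfolding sum_rows by (intro sum.cong refl) auto
    finally show ?thesis using i by simp
  qed
  have select: "snd s8 13 i 0 = Shift i \<and> snd s8 14 i 0 = Rate i" if i: "i < n" for i
  proof -
    interpret A: buckets "{..<m}" "val i" "share i" m by (rule share_buckets[OF i])
    have mxi: "snd s5 7 (i * m + k) 0 = A.maxval k" if "k < m" for k
      using mx[OF row_less[OF i that]] that by simp
    have Yi: "snd s6 3 (i * m + k) j = share i k j" if "k < m" "j < m" for k j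
      using Y4[OF row_less[OF i that(1)], of j] Y6 that by (simp add: Y0_def)
    have "snd s6 9 i 0 = (\<Sum>k<m. if real k > 1 then snd s5 7 (i * m + k) 0 else 0)"
      using tail_maxima_correct(1)[of s5 i] zero[of 8] zero[of 9] int[OF ok5] agent_sum[OF ok5, of i "\<lambda>k. k > 1"] i
      by (simp add: s6_def fr2 fr3 fr4 fr5)
    also have "\<dots> = (\<Sum>k<m. if k \<in> {2..<m} then A.maxval k else 0)"
      using mxi by (intro sum.cong refl) auto
    also have "\<dots> = A.R"
      unfolding A.R_def by (subst sum.inter_restrict[symmetric]) (auto intro!: sum.cong)
    finally have R: "snd s6 9 i 0 = A.R" .
    have "snd s6 8 i 0 = (\<Sum>k<m. if 0 < real k \<and> real k \<le> 1 then snd s5 7 (i * m + k) 0 else 0)"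
      using tail_maxima_correct(2)[of s5 i] zero[of 8] zero[of 9] int[OF ok5]
        agent_sum[OF ok5, of i "\<lambda>k. 0 < k \<and> k \<le> 1"] i
      by (simp add: s6_def fr2 fr3 fr4 fr5)
    also have "\<dots> = (\<Sum>k<m. if k = 1 then A.maxval 1 else 0)"
      using mxi by (intro sum.cong refl) (auto simp: le_Suc_eq)
    \<comment> \<open>For \<open>m = 1\<close> no index equals 1 and the sum is 0, in accordance
      with \<open>maxval 1 = 0\<close>.\<close>
    also have "\<dots> = A.u" using A.maxval_beyond[of 1] by (auto simp: A.u_def not_less)
    finally have u: "snd s6 8 i 0 = A.u" .
    have rows_sum: "(\<Sum>b<n * m. \<Sum>j<m. if owner s6 b = i \<and> P (brank s6 b) then F (snd s6 3 b j) j else 0)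
        = (\<Sum>k<m. if P (real k) then \<Sum>j<m. F (share i k j) j else 0)" for P and F :: "real \<Rightarrow> nat \<Rightarrow> real"
    proof -
      have "(\<Sum>b<n * m. \<Sum>j<m. if owner s6 b = i \<and> P (brank s6 b) then F (snd s6 3 b j) j else 0)
        = (\<Sum>b<n * m. if owner s6 b = i \<and> P (brank s6 b) then \<Sum>j<m. F (snd s6 3 b j) j else 0)"
        by (intro sum.cong refl) auto
      also have "\<dots> = (\<Sum>k<m. if P (real k) then \<Sum>j<m. F (snd s6 3 (i * m + k) j) j else 0)"
        using i ok6 by (intro agent_sum) auto
      also have "\<dots> = (\<Sum>k<m. if P (real k) then \<Sum>j<m. F (share i k j) j else 0)"
        using Yi by (intro sum.cong refl) auto
      finally show ?thesis .
    qed
    have z10: "snd s6 10 i' 0 = 0" and z11: "snd s6 11 i' 0 = 0" and z12: "snd s6 12 i' 0 = 0" for i'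
      using zero[of 10] zero[of 11] zero[of 12] by (simp_all add: fr2 fr3 fr4 fr5 fr6)
    note cand = candidates_correct[where i = i, OF z10 z11 z12, folded s7_def,
        unfolded int(2,3)[OF ok6] vals(1)[OF ok6] R u]
    have first: "(\<Sum>k<m. if \<not> real k > 0 then f k else 0) = f 0" for f :: "nat \<Rightarrow> real"
    proof -
      have "(\<Sum>k<m. if \<not> real k > 0 then f k else 0) = (\<Sum>k<m. if k = 0 then f 0 else 0)"
        by (intro sum.cong refl) auto
      then show ?thesis using m_pos by simp
    qed
    have B: "snd s7 10 i 0 = A.B"
    proof -
      have "snd s7 10 i 0 = (\<Sum>k<m. if real k > 0 then \<Sum>j<m. share i k j * val i j else 0)"
        unfolding cand(1) by (rule rows_sum)
      also have "\<dots> = (\<Sum>k<m. if k \<in> {1..<m} then \<Sum>j<m. share i k j * val i j else 0)"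
        by (intro sum.cong refl) auto
      also have "\<dots> = A.B"
        unfolding A.B_def by (subst sum.inter_restrict[symmetric]) (auto intro!: sum.cong)
      finally show ?thesis .
    qed
    have E0: "snd s7 11 i 0 = A.E0"
      unfolding cand(2) A.E0_def
      by (rule trans[OF rows_sum[of "\<lambda>k. \<not> k > 0" "\<lambda>y j. y * ln (val i j + A.R)"] first])
    have E1: "snd s7 12 i 0 + A.c / A.u * (A.B - A.R) - A.c = A.E1"
      unfolding cand(3) A.E1_def
      by (simp only: rows_sum[of "\<lambda>k. \<not> k > 0" "\<lambda>y j. y * ln (val i j + A.R + A.u)"] first)
    have c: "ln ((2 * A.u + A.R) / (A.u + A.R)) = A.c" by (simp add: A.c_def)
    have R7: "snd s7 9 i 0 = A.R" and u7: "snd s7 8 i 0 = A.u" using R u by (simp_all add: fr7)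
    note select_candidate_correct[of i s7, folded s8_def, unfolded R7 u7 B E0 c E1 int(1)[OF ok7], OF i]
    then show ?thesis by (simp add: A.shift_def A.rate_def)
  qed
  show "snd s 4 b j = weight b j" if b: "b < n * m" and j: "j < m + 1"
  proof (cases "j = m")
    case True
    then show ?thesis using edge_weights_correct[of s8 b j] int[OF ok8] zero[of 4]
      by (simp add: s weight_def fr2 fr3 fr4 fr5 fr6 fr7 fr8)
  next
    case False
    have "0 < real (b mod m) \<longleftrightarrow> 0 < b mod m" by simp
    then show ?thesis
      using edge_weights_correct[of s8 b j] int[OF ok8] own[OF b ok8] brank[OF b ok8] vals[OF ok8] b j False
        select[OF row_div[OF b]] row_div[OF b]
      by (simp add: s weight_def)
  qed
qed

lemma round_rows_correct:
  defines "s \<equiv> den round_rows (den init_rows s0)"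
  shows "output_allocation m s \<in> allocations {..<m} E"
    and "nsw {..<n} {..<m} w v (output_allocation m s) \<ge> exp (- 1 / exp 1) * exp (cp_obj {..<n} E w v x)"
proof -
  define s1 where "s1 = den preprocess (den init_rows s0)"
  define s2 where "s2 = den cancel s1"
  have s: "s = den read_off s2" by (simp add: s_def round_rows_def s1_def s2_def)
  note pre = preprocess_correct[folded s1_def]
  have margins: "int_margins (n * m) (m + 1) (snd s1 3) = int_margins (n * m) (m + 1) Y0"
    unfolding int_margins_def using pre(5) by (simp cong: sum.cong_simp)
  then have "int_margins (nrows s1) (ncols s1) (snd s1 3)" using int_margins_Y0 pre by simp
  note canc = cancel_correct[OF this, folded s2_def, unfolded pre(1,2)]
  have prog: "rounding_progress (n * m) (m + 1) weight Y0 (snd s2 3)"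
    using canc(1) pre(5,6) unfolding rounding_progress_def by (simp cong: sum.cong_simp)
  have fr: "fst s2 a = fst s1 a" if "a < 10" for a
    unfolding s2_def using that by (intro den_frame_int) (auto simp: program_defs)
  have dims: "nrows s2 = n * m" "nitems s2 = m" using pre fr by simp_all
  have Z1: "snd s2 3 b j = 1" if "b < n * m" "j < m + 1" "snd s2 3 b j > 0" for b j
  proof -
    have "snd s2 3 b j \<le> 1" using prog that by (simp add: rounding_progress_def int_margins_def)
    moreover have "\<not> fractional (snd s2 3 b j)" using canc(2) that by (auto simp: fracs_def)
    ultimately show ?thesis using that by (simp add: fractional_def)
  qed
  have uniq: "b = b'" if "j < m" "b < n * m" "b' < n * m" "snd s2 3 b j > 0" "snd s2 3 b' j > 0" for b b' j
  proof (rule ccontr)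
    assume ne: "b \<noteq> b'"
    have "(\<Sum>b\<in>{b, b'}. snd s2 3 b j) \<le> (\<Sum>b<n * m. snd s2 3 b j)"
      using that prog by (intro sum_mono2) (auto simp: rounding_progress_def int_margins_def)
    also have "\<dots> = (\<Sum>b<n * m. Y0 b j)" using prog that by (simp add: rounding_progress_def)
    also have "\<dots> = (\<Sum>i<n. \<Sum>k<m. share i k j)"
      unfolding sum_rows using that by (intro sum.cong refl) (simp add: Y0_def)
    also have "\<dots> = (\<Sum>i<n. amt i j)" using share_total that by (intro sum.cong) auto
    also have "\<dots> = 1" using amt_column that by simp
    finally show False using ne Z1[of b j] Z1[of b' j] that by simp
  qed
  have out: "fst s 3 j 0 = b div m" if "b < n * m" "j < m" "snd s2 3 b j > 0" for b j
    using read_off_correct[of s2 b j] uniq that dims pre(4)[of b] fr[of 6] by (simp add: s)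
  have \<rho>: "output_allocation m s j = b div m" if "b < n * m" "j < m" "snd s2 3 b j > 0" for b j
    using out[OF that] that by (simp add: output_allocation_def)
  have ext: "output_allocation m s \<in> extensional {..<m}" by (simp add: output_allocation_def)
  show "output_allocation m s \<in> allocations {..<m} E"
    and "nsw {..<n} {..<m} w v (output_allocation m s) \<ge> exp (- 1 / exp 1) * exp (cp_obj {..<n} E w v x)"
    using rounding[OF prog canc(2) ext \<rho>] by auto
qed

end

text \<open>The first phase has only the loop bounds \<open>n\<close> and \<open>m\<close>.
  Afterwards the bounding cells also hold \<open>n * m\<close> and \<open>m + 1\<close>; all are at
  most the square of \<open>1 + n + m\<close>, which is the polynomial \<open>[:1, 2, 1:]\<close> at
  \<open>n + m\<close>.\<close>

theorem polytime_rounding_exists: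
  "polytime_rounding (exp (- 1 / exp 1)) (Seq (compile init_rows) (compile round_rows))"
  unfolding polytime_rounding_def
proof (intro exI[of _ "cost init_rows + pcompose (cost round_rows) [:1, 2, 1:]"] allI impI)
  fix n m :: nat and E :: "(nat \<times> nat) set" and w :: "nat \<Rightarrow> real" and v x :: "nat \<Rightarrow> nat \<Rightarrow> real"
  assume "nsw_instance {..<n} {..<m} E w v" "cp_feasible {..<n} {..<m} E x"
  then interpret fractional_instance n m E w v x by unfold_locales
  let ?B = "1 + 2 * (n + m) + (n + m) * (n + m)"
  have "\<exists>t\<le>poly (cost init_rows) (n + m). runs (compile init_rows) s0 t (den init_rows s0)"
    by (intro runs_compile) (auto simp: init_rows_def input_memory_def)
  then obtain t1 where t1: "t1 \<le> poly (cost init_rows) (n + m)"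
    "runs (compile init_rows) s0 t1 (den init_rows s0)" by blast
  define s1 where "s1 = den init_rows s0"
  have "fst s1 a = fst s0 a" if "a \<in> {0, 1}" for a
    unfolding s1_def using that by (intro den_frame_int) (auto simp: program_defs)
  then have "fst s1 0 0 0 = n" "fst s1 1 0 0 = m" by (auto simp: input_simps)
  moreover have "fst s1 4 0 0 = n * m" "fst s1 5 0 0 = m + 1"
    using init_rows_correct(1,2)[of s0] by (simp_all add: s1_def input_simps)
  moreover have "n * m \<le> (n + m) * (n + m)" by (simp add: algebra_simps)
  ultimately have "\<exists>t\<le>poly (cost round_rows) ?B. runs (compile round_rows) s1 t (den round_rows s1)"
    by (intro runs_compile) (auto simp: program_defs)
  then obtain t2 where t2: "t2 \<le> poly (cost round_rows) ?B"
    "runs (compile round_rows) s1 t2 (den round_rows s1)" by blast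
  have "poly [:1, 2, 1:] (n + m) = ?B" by (simp add: algebra_simps)
  then have "poly (cost init_rows + pcompose (cost round_rows) [:1, 2, 1:]) (n + m)
      = poly (cost init_rows) (n + m) + poly (cost round_rows) ?B"
    by (simp only: poly_add poly_pcompose)
  then have "t1 + t2 \<le> poly (cost init_rows + pcompose (cost round_rows) [:1, 2, 1:]) (n + m)"
    using t1(1) t2(1) by (simp only: add_mono)
  moreover have "runs (Seq (compile init_rows) (compile round_rows)) s0 (t1 + t2) (den round_rows s1)"
    using t1 t2 by (auto simp: s1_def intro: runs.Seq)
  ultimately show "\<exists>t s. runs (Seq (compile init_rows) (compile round_rows)) (input_memory n m E w v x) t s \<and>
      t \<le> poly (cost init_rows + pcompose (cost round_rows) [:1, 2, 1:]) (n + m) \<and>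
      output_allocation m s \<in> allocations {..<m} E \<and>
      exp (- 1 / exp 1) * exp (cp_obj {..<n} E w v x) \<le> nsw {..<n} {..<m} w v (output_allocation m s)"
    using round_rows_correct[folded s1_def] by blast
qed

declare One_nat_def [simp]

section \<open>Arbitrary agents and items\<close>

lemma relabelled_instance:
  fixes N :: "'a set" and M :: "'b set" and n m :: nat
  assumes inst: "nsw_instance N M E w v" and f: "bij_betw f {..<n} N" and g: "bij_betw g {..<m} M"
  defines "E' \<equiv> {(a, b). a < n \<and> b < m \<and> (f a, g b) \<in> E}"
    and "w' \<equiv> \<lambda>a. w (f a)" and "v' \<equiv> \<lambda>a b. v (f a) (g b)"
  shows "nsw_instance {..<n} {..<m} E' w' v'"
    and "cp_feasible N M E x \<Longrightarrow> cp_feasible {..<n} {..<m} E' (\<lambda>a b. x (f a) (g b))"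
    and "cp_obj {..<n} E' w' v' (\<lambda>a b. x (f a) (g b)) = cp_obj N E w v x"
    and "\<rho>' \<in> allocations {..<m} E' \<Longrightarrow>
      \<exists>\<rho>\<in>allocations M E. nsw N M w v \<rho> = nsw {..<n} {..<m} w' v' \<rho>'"
proof -
  have E: "E \<subseteq> N \<times> M" using inst by (simp add: nsw_instance_def)
  have fN: "f a \<in> N" if "a < n" for a using bij_betwE[OF f] that by auto
  have gM: "g b \<in> M" if "b < m" for b using bij_betwE[OF g] that by auto
  have f_img: "N = f ` {..<n}" using f by (simp add: bij_betw_def)
  have g_img: "M = g ` {..<m}" using g by (simp add: bij_betw_def)
  have inj: "inj_on f {..<n}" "inj_on g {..<m}" using f g by (auto simp: bij_betw_def)
  have items: "bij_betw g (items_of E' a) (items_of E (f a))" if "a < n" for a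
  proof -
    have "items_of E' a \<subseteq> {..<m}" by (auto simp: items_of_def E'_def)
    moreover have "g ` items_of E' a = items_of E (f a)"
      using E that by (auto simp: items_of_def E'_def g_img)
    ultimately show ?thesis using inj by (auto simp: bij_betw_def intro: inj_on_subset)
  qed
  have agents: "bij_betw f (agents_of E' b) (agents_of E (g b))" if "b < m" for b
  proof -
    have "agents_of E' b \<subseteq> {..<n}" by (auto simp: agents_of_def E'_def)
    moreover have "f ` agents_of E' b = agents_of E (g b)"
      using E that by (auto simp: agents_of_def E'_def f_img)
    ultimately show ?thesis using inj by (auto simp: bij_betw_def intro: inj_on_subset)
  qed
  have sum_items: "(\<Sum>b\<in>items_of E' a. F (g b)) = (\<Sum>j\<in>items_of E (f a). F j)" if "a < n" for a and F :: "'b \<Rightarrow> real"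
    by (rule sum.reindex_bij_betw[OF items[OF that]])
  show "nsw_instance {..<n} {..<m} E' w' v'"
    unfolding nsw_instance_def
  proof (intro conjI)
    show "\<forall>i\<in>{..<n}. 0 < w' i \<and> w' i \<le> 1" using inst fN by (simp add: nsw_instance_def w'_def)
    show "(\<Sum>i<n. w' i) = 1"
      using inst sum.reindex_bij_betw[OF f, of w] by (simp add: nsw_instance_def w'_def)
    show "\<forall>(i, j)\<in>E'. 0 < v' i j" using inst by (auto simp: nsw_instance_def E'_def v'_def)
    show "\<forall>i\<in>{..<n}. items_of E' i \<noteq> {}"
    proof
      fix a assume "a \<in> {..<n}"
      then have "items_of E (f a) \<noteq> {}" "bij_betw g (items_of E' a) (items_of E (f a))"
        using inst fN items by (auto simp: nsw_instance_def)
      then show "items_of E' a \<noteq> {}" by (auto simp: bij_betw_def)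
    qed
    show "\<forall>j\<in>{..<m}. agents_of E' j \<noteq> {}"
    proof
      fix b assume "b \<in> {..<m}"
      then have "agents_of E (g b) \<noteq> {}" "bij_betw f (agents_of E' b) (agents_of E (g b))"
        using inst gM agents by (auto simp: nsw_instance_def)
      then show "agents_of E' b \<noteq> {}" by (auto simp: bij_betw_def)
    qed
  qed (auto simp: E'_def)
  show "cp_feasible {..<n} {..<m} E' (\<lambda>a b. x (f a) (g b))" if x: "cp_feasible N M E x"
    unfolding cp_feasible_def
  proof (intro conjI ballI)
    show "1 \<le> (\<Sum>b\<in>items_of E' a. x (f a) (g b))" if "a \<in> {..<n}" for a
      using x sum_items[of a "x (f a)"] fN that by (simp add: cp_feasible_def)
    show "(\<Sum>a\<in>agents_of E' b. x (f a) (g b)) = 1" if "b \<in> {..<m}" for b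
      using x sum.reindex_bij_betw[OF agents[of b], of "\<lambda>i. x i (g b)"] gM that by (simp add: cp_feasible_def)
    show "case e of (a, b) \<Rightarrow> 0 \<le> x (f a) (g b)" if "e \<in> E'" for e
      using x that by (auto simp: cp_feasible_def E'_def)
  qed
  show "cp_obj {..<n} E' w' v' (\<lambda>a b. x (f a) (g b)) = cp_obj N E w v x"
  proof -
    have "agent_obj E' v' (\<lambda>a b. x (f a) (g b)) a = agent_obj E v x (f a)" if a: "a < n" for a
    proof -
      have "is_level E' v' (\<lambda>a b. x (f a) (g b)) a h = is_level E v x (f a) h" for h
        using sum_items[OF a, of "\<lambda>j. min (v (f a) j) h * x (f a) j"] by (simp add: is_level_def v'_def)
      \<comment> \<open>Both levels are \<open>SOME\<close> of the same predicate, so they coincide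
        even where it has several solutions.\<close>
      then have level: "level E' v' (\<lambda>a b. x (f a) (g b)) a = level E v x (f a)"
        by (simp add: level_def)
      define h where "h = level E v x (f a)"
      have "bij_betw g {b\<in>items_of E' a. v' a b > h} {j\<in>items_of E (f a). v (f a) j > h}"
      proof -
        have "{j\<in>items_of E (f a). v (f a) j > h} = g ` {b\<in>items_of E' a. v' a b > h}"
          using items[OF a] by (auto simp: bij_betw_def v'_def)
        then show ?thesis
          using items[OF a] by (auto simp: bij_betw_def intro: inj_on_subset)
      qed
      from sum.reindex_bij_betw[OF this, of "\<lambda>j. x (f a) j * ln (v (f a) j / h)"]
      show ?thesis by (simp add: agent_obj_def level flip: h_def) (simp add: v'_def)
    qed
    then show ?thesis
      using sum.reindex_bij_betw[OF f, of "\<lambda>i. w i * agent_obj E v x i"] by (simp add: cp_obj_def w'_def)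
  qed
  show "\<exists>\<rho>\<in>allocations M E. nsw N M w v \<rho> = nsw {..<n} {..<m} w' v' \<rho>'" if \<rho>': "\<rho>' \<in> allocations {..<m} E'"
  proof -
    have edge: "\<rho>' b < n" "(f (\<rho>' b), g b) \<in> E" if "b < m" for b
    proof -
      have "\<rho>' b \<in> agents_of E' b" using \<rho>' that by (auto simp: allocations_def)
      then show "\<rho>' b < n" "(f (\<rho>' b), g b) \<in> E" by (auto simp: agents_of_def E'_def)
    qed
    define \<rho> where "\<rho> = restrict (\<lambda>j. f (\<rho>' (inv_into {..<m} g j))) M"
    have \<rho>_g: "\<rho> (g b) = f (\<rho>' b)" if "b < m" for b
      using that gM inj by (simp add: \<rho>_def)
    have "\<rho> \<in> allocations M E"
      unfolding allocations_def
    proof (rule PiE_I)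
      show "\<rho> j \<in> agents_of E j" if "j \<in> M" for j
        using that edge \<rho>_g by (auto simp: g_img agents_of_def)
    qed (simp add: \<rho>_def)
    moreover have "nsw N M w v \<rho> = nsw {..<n} {..<m} w' v' \<rho>'"
    proof -
      have "(\<Sum>j\<in>{j\<in>M. \<rho> j = f a}. v (f a) j) = (\<Sum>b\<in>{b\<in>{..<m}. \<rho>' b = a}. v' a b)" if a: "a < n" for a
      proof -
        have "\<rho> (g b) = f a \<longleftrightarrow> \<rho>' b = a" if "b < m" for b
          using \<rho>_g[OF that] edge(1)[OF that] a inj(1) by (auto simp: inj_on_def)
        then have "bij_betw g {b\<in>{..<m}. \<rho>' b = a} {j\<in>M. \<rho> j = f a}"
          using inj(2) by (auto simp: bij_betw_def g_img intro: inj_on_subset)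
        from sum.reindex_bij_betw[OF this, of "v (f a)"] show ?thesis by (simp add: v'_def)
      qed
      then show ?thesis
        using prod.reindex_bij_betw[OF f, of "\<lambda>i. (\<Sum>j\<in>{j\<in>M. \<rho> j = i}. v i j) powr w i"]
        by (simp add: nsw_def w'_def)
    qed
    ultimately show ?thesis by blast
  qed
qed

section \<open>The integrality gap\<close>

lemma nsw_le_max_nsw:
  assumes "nsw_instance N M E w v" "\<rho> \<in> allocations M E"
  shows "nsw N M w v \<rho> \<le> max_nsw N M E w v"
proof -
  have "finite N" "finite M" "E \<subseteq> N \<times> M" using assms(1) by (auto simp: nsw_instance_def)
  then have "finite (agents_of E j)" for j
    by (auto simp: agents_of_def intro!: finite_subset[of "{i. (i, j) \<in> E}" N])
  then have "finite (allocations M E)"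
    unfolding allocations_def using \<open>finite M\<close> by (intro finite_PiE)
  then show ?thesis unfolding max_nsw_def using assms(2) by (intro Max_ge) auto
qed

lemma max_nsw_nonneg:
  assumes "nsw_instance N M E w v"
  shows "max_nsw N M E w v \<ge> 0"
proof -
  have "\<forall>j\<in>M. agents_of E j \<noteq> {}" using assms by (simp add: nsw_instance_def)
  then have "allocations M E \<noteq> {}" by (simp add: allocations_def PiE_eq_empty_iff)
  then obtain \<rho> where "\<rho> \<in> allocations M E" by blast
  have "0 \<le> nsw N M w v \<rho>" unfolding nsw_def by (intro prod_nonneg) auto
  also have "\<dots> \<le> max_nsw N M E w v" using assms \<open>\<rho> \<in> allocations M E\<close> by (rule nsw_le_max_nsw)
  finally show ?thesis .
qed

text \<open>A good allocation is read off from the run of the algorithm on the instance relabelled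
  by natural numbers.\<close>

lemma max_nsw_ge:
  fixes N :: "'a set" and M :: "'b set" and n m :: nat
  assumes inst: "nsw_instance N M E w v" and feas: "cp_feasible N M E x"
  shows "exp (- 1 / exp 1) * exp (cp_obj N E w v x) \<le> max_nsw N M E w v"
proof -
  have "finite N" "finite M" using inst by (auto simp: nsw_instance_def)
  obtain f where "bij_betw f {0..<card N} N" using ex_bij_betw_nat_finite[OF \<open>finite N\<close>] by blast
  then have f: "bij_betw f {..<card N} N" by (simp only: lessThan_atLeast0)
  obtain g where "bij_betw g {0..<card M} M" using ex_bij_betw_nat_finite[OF \<open>finite M\<close>] by blast
  then have g: "bij_betw g {..<card M} M" by (simp only: lessThan_atLeast0)
  define E' where "E' = {(a, b). a < card N \<and> b < card M \<and> (f a, g b) \<in> E}"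
  define w' where "w' = (\<lambda>a. w (f a))"
  define v' where "v' = (\<lambda>a b. v (f a) (g b))"
  note rel = relabelled_instance[OF inst f g, folded E'_def w'_def v'_def]
  obtain s where s: "output_allocation (card M) s \<in> allocations {..<card M} E'"
    "exp (- 1 / exp 1) * exp (cp_obj {..<card N} E' w' v' (\<lambda>a b. x (f a) (g b)))
      \<le> nsw {..<card N} {..<card M} w' v' (output_allocation (card M) s)"
    using polytime_rounding_exists[unfolded polytime_rounding_def] rel(1) rel(2)[OF feas] by meson
  obtain \<rho> where \<rho>: "\<rho> \<in> allocations M E"
    "nsw N M w v \<rho> = nsw {..<card N} {..<card M} w' v' (output_allocation (card M) s)"
    using rel(4)[OF s(1)] by blast
  show ?thesis using s(2) nsw_le_max_nsw[OF inst \<rho>(1)] unfolding rel(3) \<rho>(2) by (rule order_trans)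
qed

text \<open>For empty \<open>A\<close> the supremum is minus infinity and its exponential 0, whence
  \<open>b >= 0\<close>. Otherwise the supremum lies between a real number and \<open>ln b\<close>,
  so it is finite.\<close>

lemma exp_ereal_SUP_le:
  assumes "b \<ge> 0" "\<And>x. x \<in> A \<Longrightarrow> exp (f x) \<le> b"
  shows "exp_ereal (SUP x\<in>A. ereal (f x)) \<le> ereal b"
proof (cases "A = {}")
  case True
  then show ?thesis using assms(1) by (simp add: exp_ereal_def bot_ereal_def)
next
  case False
  then obtain x where x: "x \<in> A" by blast
  then have "b > 0" using assms(2)[OF x] by (meson exp_gt_zero less_le_trans)
  have "f x \<le> ln b" if "x \<in> A" for x using assms(2)[OF that] \<open>b > 0\<close> by (simp add: ln_ge_iff)
  then have "(SUP x\<in>A. ereal (f x)) \<le> ereal (ln b)" by (intro SUP_least) simp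
  moreover have "ereal (f x) \<le> (SUP x\<in>A. ereal (f x))" using x by (rule SUP_upper)
  ultimately have "\<exists>r. (SUP x\<in>A. ereal (f x)) = ereal r \<and> r \<le> ln b"
    by (cases "SUP x\<in>A. ereal (f x)") simp_all
  then obtain r where r: "(SUP x\<in>A. ereal (f x)) = ereal r" "r \<le> ln b" by blast
  then show ?thesis using \<open>b > 0\<close> by (simp add: exp_ereal_def ln_ge_iff)
qed

theorem theorem1:
  shows "(\<forall>(N :: 'a set) (M :: 'b set) E w v. nsw_instance N M E w v \<longrightarrow>
            ereal (max_nsw N M E w v) \<ge> ereal (exp (- 1 / exp 1)) * exp_ereal (cp_opt N M E w v))
       \<and> (\<exists>c. polytime_rounding (exp (- 1 / exp 1)) c)"
proof (intro conjI allI impI)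
  show "\<exists>c. polytime_rounding (exp (- 1 / exp 1)) c" using polytime_rounding_exists by blast
next
  fix N :: "'a set" and M :: "'b set" and E w v
  assume inst: "nsw_instance N M E w v"
  let ?\<alpha> = "exp (- 1 / exp 1) :: real"
  have "exp_ereal (cp_opt N M E w v) \<le> ereal (max_nsw N M E w v / ?\<alpha>)"
    unfolding cp_opt_def
  proof (rule exp_ereal_SUP_le)
    show "0 \<le> max_nsw N M E w v / ?\<alpha>" using max_nsw_nonneg[OF inst] by simp
    show "exp (cp_obj N E w v x) \<le> max_nsw N M E w v / ?\<alpha>" if "x \<in> {x. cp_feasible N M E x}" for x
      using max_nsw_ge[OF inst, of x] that by (simp add: pos_le_divide_eq mult.commute)
  qed
  then have "ereal ?\<alpha> * exp_ereal (cp_opt N M E w v) \<le> ereal ?\<alpha> * ereal (max_nsw N M E w v / ?\<alpha>)"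
    by (intro ereal_mult_left_mono) auto
  then show "ereal (max_nsw N M E w v) \<ge> ereal ?\<alpha> * exp_ereal (cp_opt N M E w v)" by simp
qed

end
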